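(* Let $G\subseteq GL(V)$ be a finite group acting on $V=\mathbb{F}^n$. For homogeneous $\theta_1,\dots,\theta_n\in(S\otimes V)^G$ the following are equivalent: (a) $(S\otimes V)^G$ is a free $S^G$-module with basis $\theta_1,\dots,\theta_n$; (b) $\theta_1\wedge\dots\wedge\theta_n\doteq Q\,\mathrm{vol}_V$; (c) $\theta_1,\dots,\theta_n$ are independent over $\mathcal F(S)$ and $\sum_i\deg\theta_i=\deg Q=|\mathcal A|$. For homogeneous $\omega_1,\dots,\omega_n\in(S\otimes V^* )^G$ the following are equivalent: (a) $(S\otimes V^* )^G$ is a free $S^G$-module with basis $\omega_1,\dots,\omega_n$; (b) $\omega_1\wedge\dots\wedge\omega_n\doteq Q(\tilde{\mathcal A})\,Q_{\det}\,\mathrm{vol}_{V^*}$; (c) $\omega_1,\dots,\omega_n$ are independent over $\mathcal F(S)$ and $\sum_i\deg\omega_i=\sum_{H\in\mathcal A}(e_Hb_H+e_H-1)$.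
   Context: $\mathbb{F}$ is any field, $V=\mathbb{F}^n$ with basis $v_1,\dots,v_n$, dual basis $x_1,\dots,x_n$, $S=\mathbb{F}[x_1,\dots,x_n]$ graded by degree, $\mathcal F(S)$ its fraction field; $G$ acts on $V^*$ contragrediently and on $S$; $S\otimes M$ has diagonal action and $S$-module structure via the first factor; elements of $S_i\otimes M$ have degree $i$. Wedges are in $S\otimes\wedge V$ or $S\otimes\wedge V^*$, $\mathrm{vol}_V=v_1\wedge\dots\wedge v_n$, $\mathrm{vol}_{V^*}=x_1\wedge\dots\wedge x_n$, $\doteq$ is equality up to a nonzero scalar. A reflection is a non-identity element of $GL(V)$ fixing a hyperplane pointwise, a transvection is a non-diagonalizable reflection. $\mathcal A$ is the set of hyperplanes fixed pointwise by some reflection of $G$; $\ell_H\in V^*$ has kernel $H$. $e_H$: maximal order of a diagonalizable reflection in $G$ about $H$ ($1$ if none). Root vector $v_s$ of a reflection $s$ about $H$: $s(v)=v+\ell_H(v)v_s$; $b_H$: dimension of the span of root vectors of transvections in $G$ about $H$. $Q=\prod_{H\in\mathcal A}\ell_H$, $Q_{\det}=\prod_H\ell_H^{e_H-1}$, $Q(\tilde{\mathcal A})=\prod_H\ell_H^{e_Hb_H}$. *)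

theory Defs
  imports
    "HOL-Analysis.Cartesian_Space"
    "HOL-Algebra.Multiplicative_Group"
    "HOL-Library.Poly_Mapping"
    "HOL-Computational_Algebra.Fraction_Field"
begin

section \<open>The general linear group\<close>

definition GL :: "('a::field ^ 'n ^ 'n) monoid" where
  "GL = \<lparr>carrier = {A. invertible A}, monoid.mult = (**), one = mat 1\<rparr>"

lemma group_GL: "group (GL :: ('a::field ^ 'n ^ 'n) monoid)"
proof (rule groupI)
  fix A :: "'a ^ 'n ^ 'n"
  assume "A \<in> carrier GL"
  then obtain B where "A ** B = mat 1" "B ** A = mat 1"
    by (auto simp: GL_def invertible_def)
  then show "\<exists>B\<in>carrier GL. B \<otimes>\<^bsub>GL\<^esub> A = \<one>\<^bsub>GL\<^esub>"
    by (auto simp: GL_def invertible_def)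
qed (auto simp: GL_def matrix_mul_assoc invertible_mult, auto simp: invertible_def)

text \<open>
  \<open>'a ^ 'n\<close> also serves as the dual space: \<open>\<phi>\<close> stands for the linear form
  \<open>\<Sum>i. \<phi> $ i \<cdot> x\<^sub>i\<close>.
\<close>

definition dual_apply :: "'a::field ^ 'n \<Rightarrow> 'a ^ 'n \<Rightarrow> 'a" where
  "dual_apply \<phi> v = (\<Sum>i\<in>UNIV. \<phi> $ i * v $ i)"

text \<open>The contragredient action \<open>(g \<phi>)(v) = \<phi> (g\<^sup>-\<^sup>1 v)\<close>, in the coordinates of the dual basis.\<close>

definition dual_act :: "'a::field ^ 'n ^ 'n \<Rightarrow> 'a ^ 'n \<Rightarrow> 'a ^ 'n" where
  "dual_act g \<phi> = \<phi> v* matrix_inv g"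

lemma dual_apply_dual_act: "dual_apply (dual_act g \<phi>) v = dual_apply \<phi> (matrix_inv g *v v)"
  unfolding dual_apply_def dual_act_def vector_matrix_mult_def matrix_vector_mult_def
  by (simp add: sum_distrib_left sum_distrib_right mult.assoc) (rule sum.swap)


section \<open>Reflections\<close>

definition hyperplane :: "('a::field ^ 'n) set \<Rightarrow> bool" where
  "hyperplane H \<longleftrightarrow> vec.subspace H \<and> vec.dim H = CARD('n) - 1"

definition reflection_about :: "('a::field ^ 'n) set \<Rightarrow> 'a ^ 'n ^ 'n \<Rightarrow> bool" where
  "reflection_about H s \<longleftrightarrow>
     hyperplane H \<and> invertible s \<and> s \<noteq> mat 1 \<and> (\<forall>v\<in>H. s *v v = v)"

definition diagonalizable :: "'a::field ^ 'n ^ 'n \<Rightarrow> bool" where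
  "diagonalizable A \<longleftrightarrow>
     (\<exists>(P :: 'a ^ 'n ^ 'n) (D :: 'a ^ 'n ^ 'n). invertible P \<and>
        (\<forall>i j. i \<noteq> j \<longrightarrow> D $ i $ j = 0) \<and> A = P ** D ** matrix_inv P)"

definition transvection_about :: "('a::field ^ 'n) set \<Rightarrow> 'a ^ 'n ^ 'n \<Rightarrow> bool" where
  "transvection_about H s \<longleftrightarrow> reflection_about H s \<and> \<not> diagonalizable s"

definition refl_hyperplanes :: "('a::field ^ 'n ^ 'n) set \<Rightarrow> ('a ^ 'n) set set" where
  "refl_hyperplanes G = {H. \<exists>s\<in>G. reflection_about H s}"

definition diag_refls :: "('a::field ^ 'n ^ 'n) set \<Rightarrow> ('a ^ 'n) set \<Rightarrow> ('a ^ 'n ^ 'n) set" where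
  "diag_refls G H = {s\<in>G. reflection_about H s \<and> diagonalizable s}"

definition e_num :: "('a::field ^ 'n ^ 'n) set \<Rightarrow> ('a ^ 'n) set \<Rightarrow> nat" where
  "e_num G H = (if diag_refls G H = {} then 1 else Max (group.ord GL ` diag_refls G H))"

text \<open>\<open>\<phi>\<close> is a linear form with kernel \<open>H\<close>; replacing it by a nonzero multiple only rescales \<open>w\<close>.\<close>

definition root_vector :: "'a::field ^ 'n \<Rightarrow> 'a ^ 'n ^ 'n \<Rightarrow> 'a ^ 'n \<Rightarrow> bool" where
  "root_vector \<phi> s w \<longleftrightarrow> (\<forall>v. s *v v = v + dual_apply \<phi> v *s w)"

definition b_num :: "('a::field ^ 'n ^ 'n) set \<Rightarrow> ('a ^ 'n) set \<Rightarrow> 'a ^ 'n \<Rightarrow> nat" where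
  "b_num G H \<phi> = vec.dim (vec.span {w. \<exists>s\<in>G. transvection_about H s \<and> root_vector \<phi> s w})"


section \<open>The polynomial ring\<close>

text \<open>
  The linear order on \<open>'n\<close> enumerates the coordinates \<open>v\<^sub>1, \<dots>, v\<^sub>n\<close>. It fixes the signs in
  the exterior algebra, and through it the polynomial ring is an instance of \<open>idom\<close>.
\<close>

type_synonym ('a, 'n) poly_ring = "('n \<Rightarrow>\<^sub>0 nat) \<Rightarrow>\<^sub>0 'a"

definition PConst :: "'a::field \<Rightarrow> ('a, 'n) poly_ring" where
  "PConst c = Poly_Mapping.single 0 c"

definition PVar :: "'n \<Rightarrow> ('a::field, 'n) poly_ring" where
  "PVar i = Poly_Mapping.single (Poly_Mapping.single i 1) 1"

definition monom_deg :: "('n::finite \<Rightarrow>\<^sub>0 nat) \<Rightarrow> nat" where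
  "monom_deg m = (\<Sum>i\<in>UNIV. Poly_Mapping.lookup m i)"

text \<open>Total degree, with value \<open>0\<close> at the zero polynomial.\<close>

definition poly_deg :: "('a::field, 'n::finite) poly_ring \<Rightarrow> nat" where
  "poly_deg p = Max (insert 0 (monom_deg ` Poly_Mapping.keys p))"

definition poly_homogeneous :: "nat \<Rightarrow> ('a::field, 'n::finite) poly_ring \<Rightarrow> bool" where
  "poly_homogeneous d p \<longleftrightarrow> (\<forall>m\<in>Poly_Mapping.keys p. monom_deg m = d)"

definition poly_subst ::
  "('n::finite \<Rightarrow> ('a::field, 'n) poly_ring) \<Rightarrow> ('a, 'n) poly_ring \<Rightarrow> ('a, 'n) poly_ring" where
  "poly_subst \<sigma> p =
     (\<Sum>m\<in>Poly_Mapping.keys p. PConst (Poly_Mapping.lookup p m) *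
        (\<Prod>i\<in>UNIV. \<sigma> i ^ Poly_Mapping.lookup m i))"

definition lin_form :: "'a::field ^ 'n \<Rightarrow> ('a, 'n) poly_ring" where
  "lin_form \<phi> = (\<Sum>i\<in>UNIV. PConst (\<phi> $ i) * PVar i)"

definition poly_act :: "'a::field ^ 'n ^ 'n \<Rightarrow> ('a, 'n) poly_ring \<Rightarrow> ('a, 'n) poly_ring" where
  "poly_act g = poly_subst (\<lambda>i. lin_form (dual_act g (axis i 1)))"

definition poly_invariants :: "('a::field ^ 'n ^ 'n) set \<Rightarrow> ('a, 'n) poly_ring set" where
  "poly_invariants G = {p. \<forall>g\<in>G. poly_act g p = p}"


section \<open>The modules \<open>S \<otimes> V\<close> and \<open>S \<otimes> V\<^sup>*\<close>\<close>

text \<open>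
  Both are represented by the free module \<open>('a, 'n) poly_ring ^ 'n\<close>, where \<open>\<theta>\<close> stands for
  \<open>\<Sum>i. \<theta> $ i \<otimes> v\<^sub>i\<close> and \<open>\<Sum>i. \<theta> $ i \<otimes> x\<^sub>i\<close> respectively. They differ in the action
  \<open>\<rho>\<close> of matrices on the second factor.
\<close>

definition tensor_one :: "'a::field ^ 'n \<Rightarrow> ('a, 'n) poly_ring ^ 'n" where
  "tensor_one v = (\<chi> j. PConst (v $ j))"

definition tensor_act ::
  "('a::field ^ 'n ^ 'n \<Rightarrow> 'a ^ 'n \<Rightarrow> 'a ^ 'n) \<Rightarrow> 'a ^ 'n ^ 'n \<Rightarrow>
    ('a, 'n) poly_ring ^ 'n \<Rightarrow> ('a, 'n) poly_ring ^ 'n" where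
  "tensor_act \<rho> g \<theta> = (\<Sum>i\<in>UNIV. poly_act g (\<theta> $ i) *s tensor_one (\<rho> g (axis i 1)))"

definition vec_invariants :: "('a::field ^ 'n ^ 'n) set \<Rightarrow> (('a, 'n) poly_ring ^ 'n) set" where
  "vec_invariants G = {\<theta>. \<forall>g\<in>G. tensor_act (*v) g \<theta> = \<theta>}"

definition form_invariants :: "('a::field ^ 'n ^ 'n) set \<Rightarrow> (('a, 'n) poly_ring ^ 'n) set" where
  "form_invariants G = {\<omega>. \<forall>g\<in>G. tensor_act dual_act g \<omega> = \<omega>}"

definition homogeneous :: "nat \<Rightarrow> ('a::field, 'n::finite) poly_ring ^ 'n \<Rightarrow> bool" where
  "homogeneous d \<theta> \<longleftrightarrow> (\<forall>i. poly_homogeneous d (\<theta> $ i))"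

definition free_basis :: "'r::comm_ring_1 set \<Rightarrow> ('r ^ 'n) set \<Rightarrow> ('k::finite \<Rightarrow> 'r ^ 'n) \<Rightarrow> bool" where
  "free_basis R M \<theta> \<longleftrightarrow>
     M = {\<Sum>i\<in>UNIV. c i *s \<theta> i | c. \<forall>i. c i \<in> R} \<and>
     (\<forall>c. (\<forall>i. c i \<in> R) \<and> (\<Sum>i\<in>UNIV. c i *s \<theta> i) = 0 \<longrightarrow> (\<forall>i. c i = 0))"

definition to_fract_vec :: "'r::idom ^ 'n \<Rightarrow> 'r fract ^ 'n" where
  "to_fract_vec \<theta> = (\<chi> j. Fract (\<theta> $ j) 1)"

text \<open>Independence of a family, hence the injectivity.\<close>

definition fract_independent :: "('k \<Rightarrow> 'r::idom ^ 'n) \<Rightarrow> bool" where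
  "fract_independent \<theta> \<longleftrightarrow>
     inj (\<lambda>i. to_fract_vec (\<theta> i)) \<and> vec.independent (range (\<lambda>i. to_fract_vec (\<theta> i)))"


section \<open>The exterior algebra\<close>

text \<open>
  The exterior algebra of the free module \<open>'r ^ 'n\<close> with basis \<open>(e\<^sub>i)\<close> has the basis
  \<open>e\<^sub>I = e\<^bsub>i\<^sub>1\<^esub> \<and> \<dots> \<and> e\<^bsub>i\<^sub>k\<^esub>\<close> for \<open>I = {i\<^sub>1 < \<dots> < i\<^sub>k}\<close>; an element is given by its
  coefficients at the \<open>e\<^sub>I\<close>. For disjoint \<open>I\<close> and \<open>J\<close>, \<open>e\<^sub>I \<and> e\<^sub>J\<close> is \<open>e\<^bsub>I \<union> J\<^esub>\<close> up
  to the sign of the permutation sorting \<open>I\<close> followed by \<open>J\<close>; otherwise it is zero.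
  Via the bases \<open>(v\<^sub>i)\<close> and \<open>(x\<^sub>i)\<close> this describes both \<open>S \<otimes> \<Lambda>V\<close> and \<open>S \<otimes> \<Lambda>V\<^sup>*\<close>.
\<close>

type_synonym ('r, 'n) exterior = "('r, 'n set) vec"

definition wedge_sign :: "'n::{finite,linorder} set \<Rightarrow> 'n set \<Rightarrow> 'r::comm_ring_1" where
  "wedge_sign I J = (-1) ^ card {(i, j). i \<in> I \<and> j \<in> J \<and> j < i}"

definition wedge ::
  "('r::comm_ring_1, 'n::{finite,linorder}) exterior \<Rightarrow> ('r, 'n) exterior \<Rightarrow> ('r, 'n) exterior"
  where "wedge a b = (\<chi> K. \<Sum>I\<in>Pow K. wedge_sign I (K - I) * a $ I * b $ (K - I))"

definition exterior_one :: "('r::comm_ring_1, 'n::{finite,linorder}) exterior" where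
  "exterior_one = axis {} 1"

definition exterior_embed ::
  "('r::comm_ring_1, 'n::{finite,linorder}) vec \<Rightarrow> ('r, 'n) exterior" where
  "exterior_embed \<theta> = (\<Sum>i\<in>UNIV. \<theta> $ i *s axis {i} 1)"

definition wedge_family ::
  "('n::{finite,linorder} \<Rightarrow> ('r::comm_ring_1, 'n) vec) \<Rightarrow> ('r, 'n) exterior" where
  "wedge_family \<theta> =
     foldr wedge (map (\<lambda>i. exterior_embed (\<theta> i)) (sorted_list_of_set UNIV)) exterior_one"

definition vol :: "('r::comm_ring_1, 'n::{finite,linorder}) exterior" where
  "vol = wedge_family (\<lambda>i. axis i 1)"

definition eq_up_to_scalar ::
  "(('a::field, 'n::finite) poly_ring, 'k::finite) vec \<Rightarrow> (('a, 'n) poly_ring, 'k) vec \<Rightarrow> bool"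
  (infix \<open>\<doteq>\<close> 50) where
  "a \<doteq> b \<longleftrightarrow> (\<exists>c. c \<noteq> 0 \<and> a = PConst c *s b)"


section \<open>The arrangement polynomials\<close>

text \<open>The argument \<open>\<l>\<close> assigns to each reflecting hyperplane a linear form with that kernel.\<close>

definition defines_hyperplanes ::
  "('a::field ^ 'n ^ 'n) set \<Rightarrow> (('a ^ 'n) set \<Rightarrow> 'a ^ 'n) \<Rightarrow> bool" where
  "defines_hyperplanes G \<l> \<longleftrightarrow> (\<forall>H\<in>refl_hyperplanes G. {v. dual_apply (\<l> H) v = 0} = H)"

definition Q_poly ::
  "('a::field ^ 'n ^ 'n) set \<Rightarrow> (('a ^ 'n) set \<Rightarrow> 'a ^ 'n) \<Rightarrow> ('a, 'n) poly_ring"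
  where "Q_poly G \<l> = (\<Prod>H\<in>refl_hyperplanes G. lin_form (\<l> H))"

definition Q_det ::
  "('a::field ^ 'n ^ 'n) set \<Rightarrow> (('a ^ 'n) set \<Rightarrow> 'a ^ 'n) \<Rightarrow> ('a, 'n) poly_ring"
  where "Q_det G \<l> = (\<Prod>H\<in>refl_hyperplanes G. lin_form (\<l> H) ^ (e_num G H - 1))"

definition Q_tilde ::
  "('a::field ^ 'n ^ 'n) set \<Rightarrow> (('a ^ 'n) set \<Rightarrow> 'a ^ 'n) \<Rightarrow> ('a, 'n) poly_ring"
  where "Q_tilde G \<l> = (\<Prod>H\<in>refl_hyperplanes G. lin_form (\<l> H) ^ (e_num G H * b_num G H (\<l> H)))"

end

theory Submission
  imports Defs
    "HOL-Algebra.Algebraic_Closure_Type"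
    "HOL-Analysis.Determinants"
begin

text \<open>
  In coordinates \<open>\<theta>\<^sub>1 \<and> \<dots> \<and> \<theta>\<^sub>n = det (\<theta>\<^sub>i\<^sub>j) vol\<close>, so everything concerns the determinant \<open>D\<close> of the
  coefficient matrix. Let \<open>\<ell>\<^sub>H\<^sup>m\<close> be the factor at \<open>H\<close> of the claimed determinant \<open>Q\<close>. Invariance under
  the pointwise stabiliser \<open>K\<^sub>H\<close> of \<open>H\<close> forces \<open>\<ell>\<^sub>H\<^sup>m\<close> to divide the determinant of any \<open>n\<close> invariants, and
  linear forms are prime, so \<open>Q\<close> always divides \<open>D\<close>. Cramer's rule then gives (b) \<open>\<Longrightarrow>\<close> (a), and
  comparing degrees gives (b) \<open>\<Longleftrightarrow>\<close> (c).

  For (a) \<open>\<Longrightarrow>\<close> (b) write \<open>D = c Q\<close>. If \<open>c\<close> is not a nonzero constant, it vanishes at a point \<open>P\<close> over the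
  algebraic closure which avoids all subspaces of codimension two that are intersections of
  reflecting hyperplanes or fixed spaces of elements of \<open>G\<close>. The stabiliser of \<open>P\<close> is then trivial or some \<open>K\<^sub>H\<close>, and
  there are explicit \<open>K\<^sub>H\<close>-invariants whose determinant is exactly \<open>\<ell>\<^sub>H\<^sup>m\<close>. Summing them over the orbit of
  \<open>P\<close>, with weights that vanish to high order at the other points of the orbit, produces
  combinations of the \<open>\<theta>\<^sub>i\<close> whose determinant has order \<open>m\<close> along a line through \<open>P\<close>, whereas \<open>D\<close> has
  order at least \<open>m + 1\<close> there.
\<close>

section \<open>Ring homomorphisms and evaluation of polynomials\<close>

text \<open>The characteristic may divide the order of G, so nothing can be averaged: a sum over the
  orbit of a point with representatives of the cosets of its stabiliser is never divided by
  anything, and invariants of point stabilisers supply the vectors to be summed. The exponents m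
  come from contracting invariants with constant elements of the dual space. In S \<otimes> V, one
  reflection about H makes the contraction with \<ell>_H divisible by \<ell>_H, so m = 1. In S
  \<otimes> V^*, the contraction with each vector of the b_H-dimensional span of transvection roots
  is divisible by \<ell>_H^e, and that with an eigenvector of a reflection of order e by \<ell>_H^(e
  - 1), so m = e b + e - 1. The algebraic closure is forced twice: c may have no zero over the base
  field, and a finite field may have too few points to avoid finitely many subspaces. If g fixes P,
  every row of g - 1 is a linear form vanishing at P. Off the excluded subspaces these rows are
  proportional, so g is 1 or a reflection, and P lies on at most one reflecting hyperplane. The case
  D = 0 is not split off: c = 0 vanishes at P as well.\<close>

locale ring_homo =
  fixes h :: "'a::comm_ring_1 \<Rightarrow> 'b::comm_ring_1"
  assumes add: "h (x + y) = h x + h y"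
    and mult: "h (x * y) = h x * h y"
    and one [simp]: "h 1 = 1"
begin

lemma zero [simp]: "h 0 = 0"
  using add[of 0 0] by simp

lemma uminus: "h (- x) = - h x"
  using add[of x "- x"] by (simp add: eq_neg_iff_add_eq_0 add.commute)

lemma diff: "h (x - y) = h x - h y"
  using add[of x "- y"] by (simp add: uminus)

lemma hsum: "h (sum f A) = (\<Sum>x\<in>A. h (f x))"
  by (induction A rule: infinite_finite_induct) (simp_all add: add)

lemma hprod: "h (prod f A) = (\<Prod>x\<in>A. h (f x))"
  by (induction A rule: infinite_finite_induct) (simp_all add: mult)

lemma power: "h (x ^ n) = h x ^ n"
  by (induction n) (simp_all add: mult)

lemma dvd: "x dvd y \<Longrightarrow> h x dvd h y"
  by (auto simp: dvd_def mult)

lemma det: "h (det A) = det (\<chi> i j. h (A $ i $ j))"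
proof -
  have s: "h (of_int (sign p)) = of_int (sign p)" for p :: "'c \<Rightarrow> 'c"
    by (simp add: sign_def uminus)
  show ?thesis
    unfolding det_def by (simp add: hsum hprod mult s)
qed

end

lemma ring_homo_comp: "ring_homo f \<Longrightarrow> ring_homo g \<Longrightarrow> ring_homo (\<lambda>x. f (g x))"
  unfolding ring_homo_def by simp

lemma ring_homo_ident: "ring_homo (\<lambda>x. x)"
  by (simp add: ring_homo_def)

lemma ring_homo_const_poly: "ring_homo h \<Longrightarrow> ring_homo (\<lambda>a. [:h a:])"
  by (simp add: ring_homo_def one_pCons)

lemma ring_homo_to_ac: "ring_homo to_ac"
  by (simp add: ring_homo_def)

lemma ring_homo_PConst: "ring_homo (PConst :: 'a::field \<Rightarrow> ('a, 'n) poly_ring)"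
  by (simp add: ring_homo_def PConst_def single_add mult_single flip: single_one)

lemma ring_homo_poly: "ring_homo (\<lambda>p. poly p (x :: 'a::comm_ring_1))"
  by (simp add: ring_homo_def)

lemma ring_homo_Fract: "ring_homo (\<lambda>x. Fract (x :: 'a::idom) 1)"
  by (simp add: ring_homo_def One_fract_def)

text \<open>One evaluation map serves the action on S, points over the algebraic closure,
  restriction to a line, the grading and Kronecker's substitution; they differ in the coefficient
  map \<open>f\<close> and in the images \<open>\<sigma>\<close> of the variables.\<close>

definition peval ::
  "('a::field \<Rightarrow> 'r::comm_ring_1) \<Rightarrow> ('n::finite \<Rightarrow> 'r) \<Rightarrow> ('a, 'n) poly_ring \<Rightarrow> 'r" where
  "peval f \<sigma> p = (\<Sum>m\<in>Poly_Mapping.keys p. f (Poly_Mapping.lookup p m) *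
     (\<Prod>i\<in>UNIV. \<sigma> i ^ Poly_Mapping.lookup m i))"

lemma poly_mapping_sum_single:
  "p = (\<Sum>m\<in>Poly_Mapping.keys p. Poly_Mapping.single m (Poly_Mapping.lookup p m))"
proof (rule poly_mapping_eqI)
  fix k
  show "Poly_Mapping.lookup p k =
      Poly_Mapping.lookup (\<Sum>m\<in>Poly_Mapping.keys p. Poly_Mapping.single m (Poly_Mapping.lookup p m)) k"
    by (auto simp: lookup_sum lookup_single when_def sum.delta in_keys_iff)
qed

context
  fixes f :: "'a::field \<Rightarrow> 'r::comm_ring_1" and \<sigma> :: "'n::finite \<Rightarrow> 'r"
  assumes f: "ring_homo f"
begin

interpretation f: ring_homo f by (fact f)

lemma peval_superset:
  assumes "finite A" "Poly_Mapping.keys p \<subseteq> A"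
  shows "peval f \<sigma> p =
    (\<Sum>m\<in>A. f (Poly_Mapping.lookup p m) * (\<Prod>i\<in>UNIV. \<sigma> i ^ Poly_Mapping.lookup m i))"
  unfolding peval_def
  by (rule sum.mono_neutral_left) (use assms in \<open>auto simp: in_keys_iff\<close>)

lemma peval_add: "peval f \<sigma> (p + q) = peval f \<sigma> p + peval f \<sigma> q"
proof -
  let ?A = "Poly_Mapping.keys p \<union> Poly_Mapping.keys q"
  have "Poly_Mapping.keys (p + q) \<subseteq> ?A"
    by (rule Poly_Mapping.keys_add)
  then show ?thesis
    by (simp add: peval_superset[of ?A] lookup_add f.add distrib_right sum.distrib)
qed

lemma peval_0: "peval f \<sigma> 0 = 0"
  by (simp add: peval_def)

lemma peval_sum: "peval f \<sigma> (sum g A) = (\<Sum>x\<in>A. peval f \<sigma> (g x))"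
  by (induction A rule: infinite_finite_induct) (simp_all add: peval_add peval_0)

lemma peval_single:
  "peval f \<sigma> (Poly_Mapping.single m a) = f a * (\<Prod>i\<in>UNIV. \<sigma> i ^ Poly_Mapping.lookup m i)"
  by (simp add: peval_def)

lemma peval_PConst [simp]: "peval f \<sigma> (PConst a) = f a"
  by (simp add: PConst_def peval_single)

lemma peval_PVar [simp]: "peval f \<sigma> (PVar i) = \<sigma> i"
proof -
  have "(\<Prod>j\<in>UNIV. \<sigma> j ^ Poly_Mapping.lookup (Poly_Mapping.single i (1::nat)) j) =
      (\<Prod>j\<in>UNIV. if j = i then \<sigma> j else 1)"
    by (rule prod.cong) (auto simp: lookup_single when_def)
  then show ?thesis
    by (simp add: PVar_def peval_single)
qed

lemma peval_eq_sum_single: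
  "peval f \<sigma> p = (\<Sum>m\<in>Poly_Mapping.keys p.
     peval f \<sigma> (Poly_Mapping.single m (Poly_Mapping.lookup p m)))"
  by (subst poly_mapping_sum_single[of p]) (rule peval_sum)

lemma peval_mult: "peval f \<sigma> (p * q) = peval f \<sigma> p * peval f \<sigma> q"
proof -
  let ?s = "\<lambda>p m. Poly_Mapping.single m (Poly_Mapping.lookup p m)"
  have "p * q = (\<Sum>m\<in>Poly_Mapping.keys p. \<Sum>l\<in>Poly_Mapping.keys q. ?s p m * ?s q l)"
    by (subst poly_mapping_sum_single[of p], subst poly_mapping_sum_single[of q])
      (simp add: sum_product)
  then have "peval f \<sigma> (p * q) =
      (\<Sum>m\<in>Poly_Mapping.keys p. \<Sum>l\<in>Poly_Mapping.keys q. peval f \<sigma> (?s p m * ?s q l))"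
    by (simp add: peval_sum)
  also have "\<dots> = (\<Sum>m\<in>Poly_Mapping.keys p. \<Sum>l\<in>Poly_Mapping.keys q.
      peval f \<sigma> (?s p m) * peval f \<sigma> (?s q l))"
    by (simp add: mult_single peval_single f.mult lookup_add power_add prod.distrib mult_ac)
  also have "\<dots> = peval f \<sigma> p * peval f \<sigma> q"
    by (simp only: peval_eq_sum_single[of p] peval_eq_sum_single[of q] sum_product)
  finally show ?thesis .
qed

lemma ring_homo_peval: "ring_homo (peval f \<sigma>)"
  unfolding ring_homo_def
  using peval_PConst[of 1] by (simp add: peval_add peval_mult PConst_def del: peval_PConst)

end

lemma single_eq_PConst_mult:
  "Poly_Mapping.single m a =
    PConst a * (\<Prod>i\<in>UNIV. PVar (i::'n::finite) ^ Poly_Mapping.lookup m i)"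
proof -
  have pw: "PVar i ^ k = Poly_Mapping.single (Poly_Mapping.single i k) (1::'a)" for i :: 'n and k
    by (induction k) (simp_all add: PVar_def mult_single flip: single_add)
  have pr: "(\<Prod>i\<in>A. Poly_Mapping.single (g i) (1::'a)) = Poly_Mapping.single (sum g A) 1"
    for A :: "'n set" and g :: "'n \<Rightarrow> 'n \<Rightarrow>\<^sub>0 nat"
    by (induction A rule: infinite_finite_induct) (simp_all add: mult_single)
  have "(\<Sum>i\<in>UNIV. Poly_Mapping.single i (Poly_Mapping.lookup m i)) = m"
    by (rule poly_mapping_eqI) (simp add: lookup_sum lookup_single when_def)
  then show ?thesis
    by (simp add: pw pr PConst_def mult_single)
qed

lemma peval_ident: "peval PConst PVar p = p"
  by (simp add: peval_def flip: single_eq_PConst_mult poly_mapping_sum_single)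

lemma ring_homo_peval_comp:
  assumes "ring_homo h"
  shows "h (peval f \<sigma> p) = peval (\<lambda>a. h (f a)) (\<lambda>i. h (\<sigma> i)) p"
proof -
  interpret ring_homo h by fact
  show ?thesis
    by (simp add: peval_def hsum hprod mult power)
qed

lemma ring_homo_eq_peval:
  assumes "ring_homo h"
  shows "h p = peval (\<lambda>a. h (PConst a)) (\<lambda>i. h (PVar i)) p"
  using ring_homo_peval_comp[OF assms, of PConst PVar p] by (simp add: peval_ident)

lemma ring_homo_eqI:
  fixes h k :: "('a::field, 'n::finite) poly_ring \<Rightarrow> 'r::comm_ring_1"
  assumes "ring_homo h" "ring_homo k"
    and "\<And>a. h (PConst a) = k (PConst a)" "\<And>i. h (PVar i) = k (PVar i)"
  shows "h p = k p"
  using assms ring_homo_eq_peval[of h p] ring_homo_eq_peval[of k p] by simp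

lemma poly_subst_eq_peval: "poly_subst = peval PConst"
  by (intro ext) (simp add: poly_subst_def peval_def)

lemma peval_lin_form:
  assumes "ring_homo f"
  shows "peval f \<sigma> (lin_form \<phi>) = (\<Sum>i\<in>UNIV. f (\<phi> $ i) * \<sigma> i)"
  using assms by (simp add: lin_form_def peval_sum peval_mult)


section \<open>Determinants and the exterior algebra\<close>

text \<open>Separates the uniqueness of the determinant from the signs of the exterior algebra: the
  top coefficient of a wedge product only has to be shown multilinear and alternating.\<close>

locale alternating_form =
  fixes \<Phi> :: "('n::finite \<Rightarrow> 'r::comm_ring_1 ^ 'n) \<Rightarrow> 'r"
  assumes row_add: "\<Phi> (\<theta>(i := a + b)) = \<Phi> (\<theta>(i := a)) + \<Phi> (\<theta>(i := b))"
    and row_scale: "\<Phi> (\<theta>(i := c *s a)) = c * \<Phi> (\<theta>(i := a))"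
    and alternating: "i \<noteq> j \<Longrightarrow> \<theta> i = \<theta> j \<Longrightarrow> \<Phi> \<theta> = 0"
begin

lemma row_sum:
  "finite A \<Longrightarrow> \<Phi> (\<theta>(i := \<Sum>x\<in>A. c x *s a x)) = (\<Sum>x\<in>A. c x * \<Phi> (\<theta>(i := a x)))"
proof (induction A rule: finite_induct)
  case empty
  show ?case
    using row_scale[of \<theta> i 0 0] by (simp add: fun_upd_def)
qed (simp add: row_add[unfolded fun_upd_def] row_scale[unfolded fun_upd_def] fun_upd_def)

text \<open>Polarisation: the form vanishes when both slots hold a + b, and expanding leaves the two
  mixed terms. Nothing is divided by 2, so characteristic 2 is covered.\<close>

lemma transposition:
  assumes "i \<noteq> j"
  shows "\<Phi> (\<theta> \<circ> Transposition.transpose i j) = - \<Phi> \<theta>"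
proof -
  let ?u = "\<lambda>a b. \<Phi> (\<theta>(i := a, j := b))"
  have al: "?u a a = 0" for a
    using assms by (intro alternating[of i j]) auto
  have l: "?u (a + b) c = ?u a c + ?u b c" for a b c
    using row_add[of "\<theta>(j := c)" i a b] assms by (simp add: fun_upd_twist)
  have "?u (a + b) (a + b) = (?u a a + ?u a b) + (?u b a + ?u b b)" for a b
    by (simp only: l row_add add_ac)
  then have "0 = ?u a b + ?u b a" for a b
    by (simp only: al add_0_left add_0_right)
  then have "?u (\<theta> j) (\<theta> i) = - ?u (\<theta> i) (\<theta> j)"
    by (metis eq_neg_iff_add_eq_0)
  moreover have "\<theta> \<circ> Transposition.transpose i j = \<theta>(i := \<theta> j, j := \<theta> i)"
    by (auto simp: fun_eq_iff transpose_def)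
  ultimately show ?thesis
    by simp
qed

lemma permutation:
  assumes "p permutes UNIV"
  shows "\<Phi> (\<theta> \<circ> p) = of_int (sign p) * \<Phi> \<theta>"
  using finite assms
proof (induction rule: permutes_rev_induct)
  case id
  show ?case
    by simp
next
  case (swap a b p)
  show ?case
  proof (cases "a = b")
    case False
    have "\<Phi> (\<theta> \<circ> (p \<circ> Transposition.transpose a b)) = - \<Phi> (\<theta> \<circ> p)"
      unfolding comp_assoc[symmetric] by (rule transposition) fact
    moreover have "sign (p \<circ> Transposition.transpose a b) = - sign p"
      using False swap by (subst sign_compose) (auto simp: sign_swap_id permutation_swap_id permutes_imp_permutation)
    ultimately show ?thesis
      using swap by (simp del: comp_apply)
  qed (use swap in simp)
qed

text \<open>Rows are expanded one at a time. The arbitrary \<open>\<psi>\<close> carries the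
  induction: the basis vector chosen for the new row is stored in it.\<close>

lemma expand:
  assumes "finite T"
  shows "\<Phi> (\<lambda>i. if i \<in> T then \<theta> i else \<psi> i) =
    (\<Sum>f\<in>PiE T (\<lambda>_. UNIV). (\<Prod>i\<in>T. \<theta> i $ f i) * \<Phi> (\<lambda>i. if i \<in> T then axis (f i) 1 else \<psi> i))"
  using assms
proof (induction T arbitrary: \<psi> rule: finite_induct)
  case (insert x T)
  let ?\<psi> = "\<lambda>k. \<psi>(x := axis k 1)"
  have row: "\<theta> x = (\<Sum>k\<in>UNIV. \<theta> x $ k *s axis k 1)"
    by (simp add: vec_eq_iff axis_def if_distrib sum.delta cong: if_cong)
  have upd: "(\<lambda>i. if i \<in> insert x T then \<xi> i else \<psi> i) =
      (\<lambda>i. if i \<in> T then \<xi> i else \<psi> i)(x := \<xi> x)" for \<xi> :: "'n \<Rightarrow> 'r ^ 'n"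
    using insert by auto
  have upd': "(\<lambda>i. if i \<in> T then \<xi> i else \<psi> i)(x := a) =
      (\<lambda>i. if i \<in> T then \<xi> i else (\<psi>(x := a)) i)" for \<xi> :: "'n \<Rightarrow> 'r ^ 'n" and a
    using insert by auto
  have "\<Phi> (\<lambda>i. if i \<in> insert x T then \<theta> i else \<psi> i) =
      (\<Sum>k\<in>UNIV. \<theta> x $ k * \<Phi> ((\<lambda>i. if i \<in> T then \<theta> i else \<psi> i)(x := axis k 1)))"
    unfolding upd by (subst row) (rule row_sum, simp)
  also have "\<dots> = (\<Sum>k\<in>UNIV. \<Sum>f\<in>PiE T (\<lambda>_. UNIV). \<theta> x $ k * (\<Prod>i\<in>T. \<theta> i $ f i) *
      \<Phi> (\<lambda>i. if i \<in> T then axis (f i) 1 else ?\<psi> k i))"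
    by (simp only: upd' insert.IH sum_distrib_left mult.assoc)
  also have "\<dots> = (\<Sum>k\<in>UNIV. \<Sum>f\<in>PiE T (\<lambda>_. UNIV). (\<Prod>i\<in>insert x T. \<theta> i $ (f(x := k)) i) *
      \<Phi> (\<lambda>i. if i \<in> insert x T then axis ((f(x := k)) i) 1 else \<psi> i))"
  proof (intro sum.cong refl arg_cong2[of _ _ _ _ "(*)"])
    fix k f
    have "(\<Prod>i\<in>T. \<theta> i $ f i) = (\<Prod>i\<in>T. \<theta> i $ (f(x := k)) i)"
      by (rule prod.cong) (use insert in auto)
    then show "\<theta> x $ k * (\<Prod>i\<in>T. \<theta> i $ f i) = (\<Prod>i\<in>insert x T. \<theta> i $ (f(x := k)) i)"
      using insert by simp
    show "\<Phi> (\<lambda>i. if i \<in> T then axis (f i) 1 else ?\<psi> k i) =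
        \<Phi> (\<lambda>i. if i \<in> insert x T then axis ((f(x := k)) i) 1 else \<psi> i)"
      by (rule arg_cong[of _ _ \<Phi>]) (use insert in auto)
  qed
  also have "\<dots> = (\<Sum>f\<in>PiE (insert x T) (\<lambda>_. UNIV). (\<Prod>i\<in>insert x T. \<theta> i $ f i) *
      \<Phi> (\<lambda>i. if i \<in> insert x T then axis (f i) 1 else \<psi> i))"
    unfolding PiE_insert_eq using inj_combinator[OF insert(2), of "\<lambda>_. UNIV"]
    by (subst sum.reindex) (simp_all add: sum.cartesian_product case_prod_unfold)
  finally show ?case .
qed simp

theorem eq_det: "\<Phi> \<theta> = det (\<chi> i. \<theta> i) * \<Phi> (\<lambda>i. axis i 1)"
proof -
  let ?t = "\<lambda>f. (\<Prod>i\<in>UNIV. \<theta> i $ f i) * \<Phi> (\<lambda>i. axis (f i) 1)"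
  have "\<Phi> \<theta> = (\<Sum>f\<in>UNIV. ?t f)"
    using expand[of UNIV \<theta>] by simp
  also have "\<dots> = (\<Sum>p | p permutes UNIV. ?t p)"
  proof (rule sum.mono_neutral_right, simp_all, intro ballI)
    fix f :: "'n \<Rightarrow> 'n"
    assume "f \<in> UNIV - {p. p permutes UNIV}"
    then have "\<not> inj f"
      using bij_imp_permutes[of f UNIV] finite_UNIV_inj_surj[of f] by (auto simp: bij_def)
    then obtain i j where "i \<noteq> j" "f i = f j"
      by (auto simp: inj_def)
    then show "prod (\<lambda>i. \<theta> i $ f i) UNIV * \<Phi> (\<lambda>i. axis (f i) 1) = 0"
      using alternating[of i j "\<lambda>i. axis (f i) 1"] by simp
  qed
  also have "\<dots> = (\<Sum>p | p permutes UNIV. of_int (sign p) * (\<Prod>i\<in>UNIV. \<theta> i $ p i) * \<Phi> (\<lambda>i. axis i 1))"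
  proof (rule sum.cong)
    fix p :: "'n \<Rightarrow> 'n"
    assume "p \<in> {p. p permutes UNIV}"
    then show "?t p = of_int (sign p) * (\<Prod>i\<in>UNIV. \<theta> i $ p i) * \<Phi> (\<lambda>i. axis i 1)"
      using permutation[of p "\<lambda>i. axis i 1"] by (simp add: comp_def mult_ac)
  qed simp
  finally show ?thesis
    by (simp add: det_def sum_distrib_right)
qed

end

section \<open>Wedge products with a vector on the left\<close>

lemma exterior_embed_nth:
  "exterior_embed \<theta> $ K = (if is_singleton K then \<theta> $ the_elem K else 0)"
proof (cases "is_singleton K")
  case True
  then obtain k where "K = {k}"
    by (auto elim: is_singletonE)
  then show ?thesis
    by (simp add: exterior_embed_def axis_def if_distrib sum.delta' cong: if_cong)
next
  case False
  then have "K \<noteq> {i}" for i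
    by auto
  then show ?thesis
    using False by (simp add: exterior_embed_def axis_def)
qed

text \<open>The number of transpositions that move e_i from the front to its place in e_K, that is,
  the exponent of \<open>wedge_sign {i} (K - {i})\<close>.\<close>

definition lower_card :: "'n::{finite,linorder} set \<Rightarrow> 'n \<Rightarrow> nat" where
  "lower_card K i = card {j\<in>K. j < i}"

lemma wedge_exterior_embed:
  "wedge (exterior_embed a) b $ K = (\<Sum>i\<in>K. (-1) ^ lower_card K i * a $ i * b $ (K - {i}))"
proof -
  have sign: "wedge_sign {i} (K - {i}) = (-1) ^ lower_card K i" for i
  proof -
    have "{(i', j). i' \<in> {i} \<and> j \<in> K - {i} \<and> j < i'} = Pair i ` {j\<in>K. j < i}"
      by auto
    then show ?thesis
      by (simp add: wedge_sign_def lower_card_def card_image inj_on_def)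
  qed
  have "wedge (exterior_embed a) b $ K =
      (\<Sum>I\<in>Pow K. wedge_sign I (K - I) * exterior_embed a $ I * b $ (K - I))"
    by (simp add: wedge_def)
  also have "\<dots> = (\<Sum>I\<in>(\<lambda>i. {i}) ` K. wedge_sign I (K - I) * exterior_embed a $ I * b $ (K - I))"
    by (rule sum.mono_neutral_right) (auto simp: exterior_embed_nth is_singleton_def)
  also have "\<dots> = (\<Sum>i\<in>K. (-1) ^ lower_card K i * a $ i * b $ (K - {i}))"
    by (subst sum.reindex) (simp_all add: sign exterior_embed_nth)
  finally show ?thesis .
qed

lemma wedge_exterior_embed_add_left:
  "wedge (exterior_embed (a + b)) x = wedge (exterior_embed a) x + wedge (exterior_embed b) x"
  by (simp add: vec_eq_iff wedge_exterior_embed algebra_simps sum.distrib)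

lemma wedge_exterior_embed_scale_left:
  "wedge (exterior_embed (c *s a)) x = c *s wedge (exterior_embed a) x"
  by (simp add: vec_eq_iff wedge_exterior_embed sum_distrib_left mult_ac)

lemma wedge_exterior_embed_add_right:
  "wedge (exterior_embed a) (x + y) = wedge (exterior_embed a) x + wedge (exterior_embed a) y"
  by (simp add: vec_eq_iff wedge_exterior_embed algebra_simps sum.distrib)

lemma wedge_exterior_embed_scale_right:
  "wedge (exterior_embed a) (c *s x) = c *s wedge (exterior_embed a) x"
  by (simp add: vec_eq_iff wedge_exterior_embed sum_distrib_left mult_ac)

lemma wedge_exterior_embed_0_right [simp]: "wedge (exterior_embed a) 0 = 0"
  using wedge_exterior_embed_scale_right[of a 0 0] by simp

lemma lower_card_remove_less:
  assumes "j \<in> K" "j < i"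
  shows "lower_card K i = Suc (lower_card (K - {j}) i)"
proof -
  have "{k\<in>K. k < i} = insert j {k\<in>K - {j}. k < i}"
    using assms by auto
  then show ?thesis
    by (simp add: lower_card_def)
qed

lemma lower_card_remove_greater: "j < i \<Longrightarrow> lower_card (K - {i}) j = lower_card K j"
  unfolding lower_card_def by (rule arg_cong[of _ _ card]) auto

text \<open>Removing i and j from K in either order leaves the same product of coefficients. The
  larger index counts the smaller one only while it is still present, so the two signs are opposite
  and the terms cancel in pairs.\<close>

lemma wedge_exterior_embed_square: "wedge (exterior_embed a) (wedge (exterior_embed a) x) = 0"
proof (subst vec_eq_iff, rule allI)
  fix K
  let ?t = "\<lambda>i j. (-1) ^ lower_card K i * (-1) ^ lower_card (K - {i}) j * (a $ i * a $ j * x $ (K - {i} - {j}))"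
  let ?A = "{(i, j). i \<in> K \<and> j \<in> K \<and> j < i}" and ?B = "{(i, j). i \<in> K \<and> j \<in> K \<and> i < j}"
  have anti: "?t j i = - ?t i j" if "i \<in> K" "j \<in> K" "j < i" for i j
  proof -
    have "K - {i} - {j} = K - {j} - {i}"
      by auto
    then show ?thesis
      using that lower_card_remove_less[of j K i] lower_card_remove_greater[of j i K]
      by (simp add: mult_ac)
  qed
  have "wedge (exterior_embed a) (wedge (exterior_embed a) x) $ K = (\<Sum>i\<in>K. \<Sum>j\<in>K - {i}. ?t i j)"
    by (simp add: wedge_exterior_embed sum_distrib_left mult_ac)
  also have "\<dots> = (\<Sum>(i, j)\<in>?A \<union> ?B. ?t i j)"
    by (subst sum.Sigma) (auto intro!: sum.cong)
  also have "\<dots> = (\<Sum>(i, j)\<in>?A. ?t i j) + (\<Sum>(i, j)\<in>?B. ?t i j)"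
    by (rule sum.union_disjoint) auto
  also have "(\<Sum>(i, j)\<in>?B. ?t i j) = (\<Sum>(i, j)\<in>?A. ?t j i)"
    by (rule sum.reindex_bij_witness[of _ prod.swap prod.swap]) auto
  also have "\<dots> = - (\<Sum>(i, j)\<in>?A. ?t i j)"
    unfolding sum_negf[symmetric] by (rule sum.cong) (auto simp: anti)
  finally show "wedge (exterior_embed a) (wedge (exterior_embed a) x) $ K = 0 $ K"
    by simp
qed

lemma wedge_exterior_embed_anticommute:
  "wedge (exterior_embed a) (wedge (exterior_embed b) x) =
    - wedge (exterior_embed b) (wedge (exterior_embed a) x)"
  using wedge_exterior_embed_square[of "a + b" x]
  by (simp add: wedge_exterior_embed_add_left wedge_exterior_embed_add_right
      wedge_exterior_embed_square eq_neg_iff_add_eq_0 add.commute)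

text \<open>\<open>wedge_family\<close> is tied to the list of all indices; inductions need
  arbitrary lists.\<close>

definition wedge_list ::
  "'n list \<Rightarrow> ('n::{finite,linorder} \<Rightarrow> ('r::comm_ring_1, 'n) vec) \<Rightarrow> ('r, 'n) exterior" where
  "wedge_list xs \<theta> = foldr wedge (map (\<lambda>i. exterior_embed (\<theta> i)) xs) exterior_one"

lemma wedge_list_simps [simp]:
  "wedge_list [] \<theta> = exterior_one"
  "wedge_list (x # xs) \<theta> = wedge (exterior_embed (\<theta> x)) (wedge_list xs \<theta>)"
  by (simp_all add: wedge_list_def)

lemma wedge_family_eq_wedge_list: "wedge_family \<theta> = wedge_list (sorted_list_of_set UNIV) \<theta>"
  by (simp add: wedge_family_def wedge_list_def)

lemma wedge_list_upd: "i \<notin> set xs \<Longrightarrow> wedge_list xs (\<theta>(i := a)) = wedge_list xs \<theta>"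
  by (induction xs) auto

lemma wedge_list_row_add:
  "distinct xs \<Longrightarrow> i \<in> set xs \<Longrightarrow>
    wedge_list xs (\<theta>(i := a + b)) = wedge_list xs (\<theta>(i := a)) + wedge_list xs (\<theta>(i := b))"
  by (induction xs)
    (auto simp: wedge_list_upd wedge_exterior_embed_add_left wedge_exterior_embed_add_right)

lemma wedge_list_row_scale:
  "distinct xs \<Longrightarrow> i \<in> set xs \<Longrightarrow>
    wedge_list xs (\<theta>(i := c *s a)) = c *s wedge_list xs (\<theta>(i := a))"
  by (induction xs)
    (auto simp: wedge_list_upd wedge_exterior_embed_scale_left wedge_exterior_embed_scale_right)

lemma wedge_wedge_list_mem:
  "i \<in> set xs \<Longrightarrow> wedge (exterior_embed (\<theta> i)) (wedge_list xs \<theta>) = 0"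
proof (induction xs)
  case (Cons y ys)
  then show ?case
    by (cases "y = i")
      (simp_all add: wedge_exterior_embed_square wedge_exterior_embed_anticommute[of "\<theta> i" "\<theta> y"])
qed simp

lemma wedge_list_alternating:
  "distinct xs \<Longrightarrow> i \<in> set xs \<Longrightarrow> j \<in> set xs \<Longrightarrow> i \<noteq> j \<Longrightarrow> \<theta> i = \<theta> j \<Longrightarrow> wedge_list xs \<theta> = 0"
proof (induction xs)
  case (Cons x xs)
  show ?case
    using Cons wedge_wedge_list_mem[of i xs \<theta>] wedge_wedge_list_mem[of j xs \<theta>] by auto
qed simp

lemma wedge_list_support: "card K \<noteq> length xs \<Longrightarrow> wedge_list xs \<theta> $ K = 0"
proof (induction xs arbitrary: K)
  case Nil
  then show ?case
    by (auto simp: exterior_one_def axis_def)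
next
  case (Cons x xs)
  then have "wedge_list xs \<theta> $ (K - {i}) = 0" if "i \<in> K" for i
    using that by (intro Cons.IH) (auto simp: card_Diff_singleton card_gt_0_iff dest: card_Suc_Diff1[OF finite])
  then show ?case
    by (simp add: wedge_exterior_embed)
qed

text \<open>In a sorted list the index at the head is the smallest, so prepending it creates no
  inversion and no sign.\<close>

lemma wedge_list_axis:
  "sorted xs \<Longrightarrow> distinct xs \<Longrightarrow> wedge_list xs (\<lambda>i. axis i 1) = axis (set xs) 1"
proof (induction xs)
  case (Cons x xs)
  have "wedge (exterior_embed (axis x 1)) (axis (set xs) 1) $ K = axis (insert x (set xs)) (1::'b) $ K" for K
  proof (cases "K = insert x (set xs)")
    case True
    have "{j\<in>K. j < x} = {}"
      using Cons(2,3) True by auto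
    then have l: "lower_card K x = 0"
      unfolding lower_card_def by (metis card.empty)
    have "K - {x} = set xs"
      using Cons(3) True by auto
    moreover have "wedge (exterior_embed (axis x 1)) (axis (set xs) 1) $ K =
        (\<Sum>i\<in>K. if i = x then (-1) ^ lower_card K x * axis (set xs) (1::'b) $ (K - {x}) else 0)"
      unfolding wedge_exterior_embed by (rule sum.cong) (auto simp: axis_def)
    ultimately show ?thesis
      using True l by (simp add: axis_def)
  next
    case False
    then have "x \<in> K \<Longrightarrow> K - {x} \<noteq> set xs"
      by auto
    then show ?thesis
      using False unfolding wedge_exterior_embed by (intro trans[OF sum.neutral]) (auto simp: axis_def)
  qed
  then show ?case
    using Cons by (simp add: vec_eq_iff[of "wedge _ _"])
qed (simp add: exterior_one_def)

lemma vol_eq_axis: "vol = axis UNIV 1"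
  by (simp add: vol_def wedge_family_eq_wedge_list wedge_list_axis)

theorem wedge_family_eq_det:
  fixes \<theta> :: "'n::{finite,linorder} \<Rightarrow> ('r::comm_ring_1, 'n) vec"
  shows "wedge_family \<theta> = det (\<chi> i. \<theta> i) *s vol"
proof -
  interpret alternating_form "\<lambda>\<theta>::'n \<Rightarrow> ('r, 'n) vec. wedge_family \<theta> $ UNIV"
    by unfold_locales
      (simp_all add: wedge_family_eq_wedge_list wedge_list_row_add wedge_list_row_scale
        wedge_list_alternating)
  have "wedge_family (\<lambda>i::'n. axis i (1::'r)) $ UNIV = 1"
    by (simp only: vol_def[symmetric] vol_eq_axis) (simp add: axis_def)
  then have "wedge_family \<theta> $ UNIV = det (\<chi> i. \<theta> i)"
    using eq_det[of \<theta>] by simp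
  moreover have "wedge_family \<theta> $ K = 0" if "K \<noteq> UNIV" for K
    using that unfolding wedge_family_eq_wedge_list
    by (intro wedge_list_support) (auto dest: card_subset_eq[OF finite subset_UNIV])
  ultimately show ?thesis
    by (auto simp: vec_eq_iff vol_eq_axis axis_def)
qed


section \<open>Homogeneous polynomials\<close>

text \<open>The substitution x_i \<mapsto> x_i t records the homogeneous components of p as
  coefficients of a polynomial in t. Homogeneity of degree d becomes the equation p \<mapsto> p t^d,
  which a ring homomorphism carries through products.\<close>

definition grading_hom :: "('a::field, 'n::finite) poly_ring \<Rightarrow> ('a, 'n) poly_ring poly" where
  "grading_hom = peval (\<lambda>a. [:PConst a:]) (\<lambda>i. monom (PVar i) 1)"

lemma ring_homo_grading_hom: "ring_homo grading_hom"
  unfolding grading_hom_def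
  by (intro ring_homo_peval ring_homo_const_poly ring_homo_PConst)

lemma prod_monom: "(\<Prod>i\<in>A. monom (c i) (k i)) = monom (prod c A) (sum k A)"
  by (induction A rule: infinite_finite_induct) (simp_all add: mult_monom monom_0 one_pCons)

lemma grading_hom_single:
  "grading_hom (Poly_Mapping.single m a) = monom (Poly_Mapping.single m a) (monom_deg m)"
proof -
  have "grading_hom (Poly_Mapping.single m a) =
      monom (PConst a) 0 * monom (\<Prod>i\<in>UNIV. PVar i ^ Poly_Mapping.lookup m i) (monom_deg m)"
    unfolding grading_hom_def
    by (subst peval_single)
      (simp_all add: monom_power prod_monom monom_deg_def monom_0
        ring_homo_const_poly[OF ring_homo_PConst])
  then show ?thesis
    by (simp add: mult_monom single_eq_PConst_mult[of m a])
qed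

lemma grading_hom_eq:
  "grading_hom p =
    (\<Sum>m\<in>Poly_Mapping.keys p. monom (Poly_Mapping.single m (Poly_Mapping.lookup p m)) (monom_deg m))"
  unfolding grading_hom_single[symmetric] ring_homo.hsum[OF ring_homo_grading_hom, symmetric]
  by (simp flip: poly_mapping_sum_single)

lemma poly_homogeneous_iff: "poly_homogeneous d p \<longleftrightarrow> grading_hom p = monom p d"
proof
  assume "poly_homogeneous d p"
  then have "grading_hom p =
      (\<Sum>m\<in>Poly_Mapping.keys p. monom (Poly_Mapping.single m (Poly_Mapping.lookup p m)) d)"
    unfolding grading_hom_eq poly_homogeneous_def by (intro sum.cong) auto
  also have "\<dots> = monom p d"
    by (subst (3) poly_mapping_sum_single) (rule poly_eqI, simp add: coeff_sum sum.If_cases)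
  finally show "grading_hom p = monom p d" .
next
  assume eq: "grading_hom p = monom p d"
  show "poly_homogeneous d p"
    unfolding poly_homogeneous_def
  proof (rule ballI, rule ccontr)
    fix m
    assume m: "m \<in> Poly_Mapping.keys p" "monom_deg m \<noteq> d"
    have "Poly_Mapping.lookup (coeff (grading_hom p) (monom_deg m)) m = Poly_Mapping.lookup p m"
      unfolding grading_hom_eq
      using m by (simp add: coeff_sum lookup_sum lookup_single when_def if_distrib[of "\<lambda>q. Poly_Mapping.lookup q _"]
        cong: if_cong) (subst sum.remove[of _ m], auto intro!: sum.neutral split: if_splits)
    then show False
      using m by (simp add: eq in_keys_iff)
  qed
qed

lemma poly_homogeneous_0 [simp]: "poly_homogeneous d 0"
  by (simp add: poly_homogeneous_def)

lemma poly_homogeneous_mult: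
  assumes "poly_homogeneous d p" "poly_homogeneous e q"
  shows "poly_homogeneous (d + e) (p * q)"
  using assms by (simp add: poly_homogeneous_iff ring_homo.mult[OF ring_homo_grading_hom] mult_monom)

lemma poly_homogeneous_sum:
  "(\<And>x. x \<in> A \<Longrightarrow> poly_homogeneous d (f x)) \<Longrightarrow> poly_homogeneous d (sum f A)"
proof (induction A rule: infinite_finite_induct)
  case (insert x A)
  then show ?case
    by (simp add: poly_homogeneous_iff ring_homo.add[OF ring_homo_grading_hom] add_monom)
qed auto

lemma poly_homogeneous_PConst: "poly_homogeneous 0 (PConst a)"
  by (simp add: poly_homogeneous_def PConst_def monom_deg_def)

lemma poly_homogeneous_PVar: "poly_homogeneous 1 (PVar i)"
  by (simp add: poly_homogeneous_def PVar_def monom_deg_def lookup_single when_def)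

lemma poly_homogeneous_1: "poly_homogeneous 0 1"
  using poly_homogeneous_PConst[of 1] by (simp add: ring_homo.one[OF ring_homo_PConst])

lemma poly_homogeneous_prod:
  "(\<And>x. x \<in> A \<Longrightarrow> poly_homogeneous (d x) (f x)) \<Longrightarrow> poly_homogeneous (sum d A) (prod f A)"
  by (induction A rule: infinite_finite_induct) (auto intro: poly_homogeneous_mult poly_homogeneous_1)

lemma poly_homogeneous_power: "poly_homogeneous d p \<Longrightarrow> poly_homogeneous (k * d) (p ^ k)"
  by (induction k) (auto intro: poly_homogeneous_mult poly_homogeneous_1)

lemma poly_homogeneous_lin_form: "poly_homogeneous 1 (lin_form \<phi>)"
  unfolding lin_form_def
  using poly_homogeneous_mult[OF poly_homogeneous_PConst poly_homogeneous_PVar]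
  by (intro poly_homogeneous_sum) simp

lemma poly_homogeneous_det:
  fixes A :: "(('a::field, 'n::finite) poly_ring, 'n) vec ^ 'n"
  assumes "\<And>i. homogeneous (d i) (A $ i)"
  shows "poly_homogeneous (\<Sum>i\<in>UNIV. d i) (det A)"
  unfolding det_def
proof (rule poly_homogeneous_sum)
  fix p :: "'n \<Rightarrow> 'n"
  have "(of_int (sign p) :: ('a, 'n) poly_ring) = PConst (of_int (sign p))"
    by (simp add: PConst_def)
  then have "poly_homogeneous 0 (of_int (sign p) :: ('a, 'n) poly_ring)"
    by (simp only: poly_homogeneous_PConst)
  moreover have "poly_homogeneous (\<Sum>i\<in>UNIV. d i) (\<Prod>i\<in>UNIV. A $ i $ p i)"
    using assms by (intro poly_homogeneous_prod) (simp add: homogeneous_def)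
  ultimately show "poly_homogeneous (\<Sum>i\<in>UNIV. d i) (of_int (sign p) * (\<Prod>i\<in>UNIV. A $ i $ p i))"
    using poly_homogeneous_mult by fastforce
qed

text \<open>In the domain S[t] the image of p times q t^e equals p q t^d; comparing coefficients of
  t^d bounds e, and cancelling q t^e leaves p t^(d - e).\<close>

lemma poly_homogeneous_factor:
  fixes p q :: "('a::field, 'n::{finite,linorder}) poly_ring"
  assumes "poly_homogeneous d (p * q)" "poly_homogeneous e q" "q \<noteq> 0" "p \<noteq> 0"
  shows "e \<le> d" and "poly_homogeneous (d - e) p"
proof -
  have eq: "grading_hom p * monom q e = monom (p * q) d"
    using assms(1,2) by (simp add: poly_homogeneous_iff ring_homo.mult[OF ring_homo_grading_hom])
  show le: "e \<le> d"
  proof (rule ccontr)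
    assume "\<not> e \<le> d"
    then have "coeff (monom q e * grading_hom p) d = 0"
      by (simp add: coeff_monom_mult)
    then show False
      using assms by (simp add: mult.commute[of "monom q e"] eq)
  qed
  have "grading_hom p * monom q e = monom p (d - e) * monom q e"
    using le by (simp add: eq mult_monom)
  then show "poly_homogeneous (d - e) p"
    using assms by (simp add: poly_homogeneous_iff)
qed

lemma monom_deg_eq_0: "monom_deg m = 0 \<longleftrightarrow> m = 0"
  by (auto simp: monom_deg_def poly_mapping_eq_iff fun_eq_iff)

lemma poly_homogeneous_0_const:
  assumes "poly_homogeneous 0 p"
  obtains c where "p = PConst c"
proof
  have "Poly_Mapping.keys p \<subseteq> {0}"
    using assms by (auto simp: poly_homogeneous_def monom_deg_eq_0)
  then show "p = PConst (Poly_Mapping.lookup p 0)"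
    unfolding PConst_def by (intro poly_mapping_eqI) (auto simp: lookup_single when_def in_keys_iff)
qed

lemma poly_deg_homogeneous:
  assumes "poly_homogeneous d p" "p \<noteq> 0"
  shows "poly_deg p = d"
proof -
  have "Poly_Mapping.keys p \<noteq> {}"
    using assms(2) by (auto simp: poly_mapping_eq_iff fun_eq_iff in_keys_iff)
  then have "monom_deg ` Poly_Mapping.keys p = {d}"
    using assms(1) by (auto simp: poly_homogeneous_def simp del: keys_eq_empty)
  then show ?thesis
    by (simp add: poly_deg_def)
qed


section \<open>Linear forms\<close>

lemma PConst_eq_0_iff [simp]: "PConst c = 0 \<longleftrightarrow> c = 0"
  by (metis PConst_def lookup_single_eq lookup_zero single_zero)

lemma PConst_0 [simp]: "PConst 0 = 0" and PConst_1 [simp]: "PConst 1 = 1"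
  by (simp_all add: PConst_def)

lemma lookup_lin_form: "Poly_Mapping.lookup (lin_form \<phi>) (Poly_Mapping.single i 1) = \<phi> $ i"
proof -
  have "PConst (\<phi> $ j) * PVar j = Poly_Mapping.single (Poly_Mapping.single j 1) (\<phi> $ j)" for j
    by (simp add: PConst_def PVar_def mult_single)
  moreover have "Poly_Mapping.single j (1::nat) = Poly_Mapping.single i 1 \<longleftrightarrow> j = i" for j
    by (metis lookup_single_eq lookup_single_not_eq one_neq_zero)
  ultimately show ?thesis
    by (simp add: lin_form_def lookup_sum lookup_single when_def)
qed

lemma lin_form_eq_iff [simp]: "lin_form \<phi> = lin_form \<psi> \<longleftrightarrow> \<phi> = \<psi>"
  by (metis lookup_lin_form vec_eq_iff)

lemma lin_form_0 [simp]: "lin_form 0 = 0"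
  by (simp add: lin_form_def)

lemma lin_form_eq_0_iff [simp]: "lin_form \<phi> = 0 \<longleftrightarrow> \<phi> = 0"
  using lin_form_eq_iff[of \<phi> 0] by (simp del: lin_form_eq_iff)

lemma lin_form_add: "lin_form (\<phi> + \<psi>) = lin_form \<phi> + lin_form \<psi>"
  by (simp add: lin_form_def ring_homo.add[OF ring_homo_PConst] distrib_right sum.distrib)

lemma lin_form_scale: "lin_form (c *s \<phi>) = PConst c * lin_form \<phi>"
  by (simp add: lin_form_def ring_homo.mult[OF ring_homo_PConst] sum_distrib_left mult.assoc)

lemma lin_form_axis: "lin_form (axis i 1 :: 'a::field ^ 'n) = PVar i"
proof -
  have "PConst ((axis i 1 :: 'a ^ 'n) $ j) * PVar j = (if j = i then PVar j else 0)" for j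
    by (simp add: axis_def ring_homo.one[OF ring_homo_PConst])
  then show ?thesis
    by (simp add: lin_form_def)
qed

section \<open>Congruences, and linear forms as prime elements\<close>

lemma dvd_diff_mult:
  fixes q :: "'r::comm_ring_1"
  assumes "q dvd a - a'" "q dvd b - b'"
  shows "q dvd a * b - a' * b'"
proof -
  have "a * b - a' * b' = (a - a') * b + a' * (b - b')"
    by (simp add: algebra_simps)
  then show ?thesis
    using assms by simp
qed

lemma dvd_diff_prod:
  fixes q :: "'r::comm_ring_1"
  shows "(\<And>x. x \<in> A \<Longrightarrow> q dvd f x - g x) \<Longrightarrow> q dvd prod f A - prod g A"
  by (induction A rule: infinite_finite_induct) (auto intro: dvd_diff_mult)

lemma dvd_diff_power:
  fixes q :: "'r::comm_ring_1"
  shows "q dvd a - b \<Longrightarrow> q dvd a ^ k - b ^ k"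
  by (induction k) (auto intro: dvd_diff_mult)

lemma dvd_diff_sum:
  fixes q :: "'r::comm_ring_1"
  shows "(\<And>x. x \<in> A \<Longrightarrow> q dvd f x - g x) \<Longrightarrow> q dvd sum f A - sum g A"
  by (auto simp flip: sum_subtractf intro: dvd_sum)

lemma dvd_diff_det:
  fixes q :: "'r::comm_ring_1" and A B :: "'r ^ 'n ^ 'n"
  assumes "\<And>i j. q dvd A $ i $ j - B $ i $ j"
  shows "q dvd det A - det B"
  unfolding det_def using assms by (intro dvd_diff_sum dvd_diff_mult dvd_diff_prod) auto

text \<open>Congruence modulo q respects sums and products, so the variables decide. It is applied
  to two maps that move each variable by a multiple of a linear form: elimination of a variable, and
  an element fixing a hyperplane pointwise.\<close>

lemma ring_homo_dvd_diff:
  fixes h k :: "('a::field, 'n::finite) poly_ring \<Rightarrow> 'r::comm_ring_1"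
  assumes hk: "ring_homo h" "ring_homo k" "\<And>a. h (PConst a) = k (PConst a)"
    and q: "\<And>i. q dvd h (PVar i) - k (PVar i)"
  shows "q dvd h p - k p"
  unfolding ring_homo_eq_peval[OF hk(1), of p] ring_homo_eq_peval[OF hk(2), of p] peval_def
  using q by (intro dvd_diff_sum dvd_diff_mult dvd_diff_prod dvd_diff_power) (auto simp: hk(3))

text \<open>Solving \<phi> = 0 for a variable x_k with nonzero coefficient realises reduction modulo
  \<phi> as an endomorphism of S. Since S is a domain, primality of linear forms follows at
  once.\<close>

lemma lin_form_kernel_hom:
  fixes \<phi> :: "('a::field, 'n::{finite,linorder}) vec"
  assumes "\<phi> \<noteq> 0"
  obtains \<sigma> :: "('a, 'n) poly_ring \<Rightarrow> ('a, 'n) poly_ring"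
  where "ring_homo \<sigma>" "\<And>p. \<sigma> p = 0 \<longleftrightarrow> lin_form \<phi> dvd p"
proof -
  obtain k where k: "\<phi> $ k \<noteq> 0"
    using assms by (auto simp: vec_eq_iff)
  define \<sigma> where "\<sigma> = peval PConst (\<lambda>i. PVar i - (if i = k then PConst (1 / \<phi> $ k) * lin_form \<phi> else 0))"
  have hom: "ring_homo \<sigma>"
    unfolding \<sigma>_def by (rule ring_homo_peval[OF ring_homo_PConst])
  interpret \<sigma>: ring_homo \<sigma>
    by (rule hom)
  have "\<sigma> (lin_form \<phi>) =
      (\<Sum>i\<in>UNIV. PConst (\<phi> $ i) * PVar i -
        (if i = k then PConst (\<phi> $ i) * (PConst (1 / \<phi> $ k) * lin_form \<phi>) else 0))"
    unfolding \<sigma>_def by (simp add: peval_lin_form[OF ring_homo_PConst] right_diff_distrib if_distrib cong: if_cong)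
  also have "\<dots> = lin_form \<phi> - PConst (\<phi> $ k * (1 / \<phi> $ k)) * lin_form \<phi>"
    by (simp only: sum_subtractf lin_form_def[symmetric] ring_homo.mult[OF ring_homo_PConst] mult.assoc) simp
  also have "\<dots> = 0"
    using k by (simp add: ring_homo.one[OF ring_homo_PConst])
  finally have zero: "\<sigma> (lin_form \<phi>) = 0" .
  have "lin_form \<phi> dvd p - \<sigma> p" for p
  proof (rule ring_homo_dvd_diff[OF ring_homo_ident hom])
    show "PConst a = \<sigma> (PConst a)" for a
      by (simp add: \<sigma>_def peval_PConst[OF ring_homo_PConst])
    show "lin_form \<phi> dvd PVar i - \<sigma> (PVar i)" for i
      by (simp add: \<sigma>_def peval_PVar[OF ring_homo_PConst])
  qed
  then have "\<sigma> p = 0 \<longleftrightarrow> lin_form \<phi> dvd p" for p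
    using \<sigma>.dvd[of "lin_form \<phi>" p] zero by (metis diff_zero dvd_0_left)
  with hom that show ?thesis
    by blast
qed

lemma prime_elem_lin_form:
  fixes \<phi> :: "('a::field, 'n::{finite,linorder}) vec"
  assumes "\<phi> \<noteq> 0"
  shows "prime_elem (lin_form \<phi>)"
proof -
  obtain \<sigma> :: "('a, 'n) poly_ring \<Rightarrow> ('a, 'n) poly_ring"
    where \<sigma>: "ring_homo \<sigma>" "\<And>p. \<sigma> p = 0 \<longleftrightarrow> lin_form \<phi> dvd p"
    using lin_form_kernel_hom[OF assms] by blast
  show ?thesis
  proof (rule prime_elemI)
    show "lin_form \<phi> \<noteq> 0"
      using assms by simp
    show "\<not> lin_form \<phi> dvd 1"
      using \<sigma>(2)[of 1] by (simp add: ring_homo.one[OF \<sigma>(1)])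
    show "lin_form \<phi> dvd a \<or> lin_form \<phi> dvd b" if "lin_form \<phi> dvd a * b" for a b
      using that by (simp add: ring_homo.mult[OF \<sigma>(1)] flip: \<sigma>(2))
  qed
qed

lemma lin_form_dvd_lin_form:
  fixes \<phi> :: "('a::field, 'n::{finite,linorder}) vec"
  assumes "lin_form \<phi> dvd lin_form \<psi>"
  obtains c where "\<psi> = c *s \<phi>"
proof (cases "\<psi> = 0")
  case True
  then show ?thesis
    using that[of 0] by simp
next
  case False
  obtain p where p: "lin_form \<psi> = p * lin_form \<phi>"
    using assms by (auto simp: dvd_def mult.commute)
  then have "poly_homogeneous 1 (p * lin_form \<phi>)"
    using poly_homogeneous_lin_form[of \<psi>] by simp
  moreover have "p \<noteq> 0" "lin_form \<phi> \<noteq> 0"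
    using p False lin_form_eq_0_iff[of \<psi>] by auto
  ultimately have "poly_homogeneous (1 - 1) p"
    by (intro poly_homogeneous_factor(2)[OF _ poly_homogeneous_lin_form])
  then obtain c where "p = PConst c"
    by (auto elim: poly_homogeneous_0_const)
  then have "lin_form \<psi> = lin_form (c *s \<phi>)"
    using p by (simp add: lin_form_scale)
  then show ?thesis
    using that[of c] by simp
qed

lemma prime_elem_power_dvd_mult:
  fixes p :: "'r::idom"
  assumes "prime_elem p" "\<not> p dvd a"
  shows "p ^ m dvd a * c \<Longrightarrow> p ^ m dvd c"
proof (induction m arbitrary: c)
  case (Suc m)
  then have "p dvd a * c"
    by (metis dvd_mult_left power_Suc)
  then obtain c' where c: "c = p * c'"
    using assms by (auto simp: prime_elem_dvd_mult_iff)
  then have "p * p ^ m dvd p * (a * c')"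
    using Suc.prems by (simp add: mult_ac)
  then show ?case
    using Suc.IH[of c'] assms c by (simp add: prime_elem_not_zeroI)
qed simp

lemma prime_elem_dvd_prod:
  fixes f :: "'b \<Rightarrow> 'r::idom"
  assumes "prime_elem p"
  shows "p dvd prod f A \<Longrightarrow> \<exists>x\<in>A. p dvd f x"
  by (induction A rule: infinite_finite_induct)
    (use assms in \<open>auto simp: prime_elem_dvd_mult_iff prime_elem_not_unit\<close>)

text \<open>A prime that divides none of the other factors must have its whole power in the
  cofactor. This works in any integral domain, so unique factorisation in S is never
  invoked.\<close>

lemma prod_prime_elem_powers_dvd:
  fixes f :: "'b \<Rightarrow> 'r::idom"
  assumes "finite A"
    and "\<And>x. x \<in> A \<Longrightarrow> prime_elem (f x)"
    and "\<And>x y. x \<in> A \<Longrightarrow> y \<in> A \<Longrightarrow> x \<noteq> y \<Longrightarrow> \<not> f x dvd f y"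
    and "\<And>x. x \<in> A \<Longrightarrow> f x ^ m x dvd D"
  shows "(\<Prod>x\<in>A. f x ^ m x) dvd D"
  using assms
proof (induction A rule: finite_induct)
  case (insert x A)
  then have "(\<Prod>x\<in>A. f x ^ m x) dvd D"
    by auto
  then obtain c where c: "D = (\<Prod>x\<in>A. f x ^ m x) * c" ..
  have "\<not> f x dvd (\<Prod>x\<in>A. f x ^ m x)"
  proof
    assume "f x dvd (\<Prod>x\<in>A. f x ^ m x)"
    then obtain y where "y \<in> A" "f x dvd f y ^ m y"
      using insert.prems(1)[of x] prime_elem_dvd_prod by blast
    then show False
      using insert.prems(1,2)[of x] insert.hyps prime_elem_dvd_power[of "f x" "f y"] by auto
  qed
  then have "f x ^ m x dvd c"
    using insert.prems(1,3)[of x] c by (auto intro: prime_elem_power_dvd_mult)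
  then show ?case
    using insert c by (simp add: mult_dvd_mono mult.commute)
qed simp


section \<open>The action on polynomials and covariants\<close>

lemma if_zero_mult:
  "(if P then a else 0) * c = (if P then a * c else (0 :: 'r::comm_ring_1))"
  "c * (if P then a else 0) = (if P then c * a else (0 :: 'r))"
  by simp_all

lemma matrix_inv:
  assumes "invertible A"
  shows "A ** matrix_inv A = mat 1" "matrix_inv A ** A = mat 1"
  using someI_ex[OF assms[unfolded invertible_def]] by (auto simp: matrix_inv_def)

lemma matrix_inv_eqI:
  assumes "A ** B = mat 1" "B ** A = mat 1"
  shows "matrix_inv A = B"
proof -
  have "invertible A"
    using assms by (auto simp: invertible_def)
  then have "matrix_inv A ** (A ** B) = B"
    by (simp add: matrix_mul_assoc matrix_inv)
  then show ?thesis
    by (simp add: assms)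
qed

lemma matrix_inv_1 [simp]: "matrix_inv (mat 1) = mat 1"
  by (rule matrix_inv_eqI) simp_all

lemma invertible_matrix_inv: "invertible A \<Longrightarrow> invertible (matrix_inv A)"
  using matrix_inv[of A] by (auto simp: invertible_def)

lemma matrix_inv_mult:
  assumes "invertible A" "invertible B"
  shows "matrix_inv (A ** B) = matrix_inv B ** matrix_inv A"
proof (rule matrix_inv_eqI)
  have "A ** B ** (matrix_inv B ** matrix_inv A) = A ** (B ** matrix_inv B) ** matrix_inv A"
    by (simp add: matrix_mul_assoc)
  then show "A ** B ** (matrix_inv B ** matrix_inv A) = mat 1"
    using assms by (simp add: matrix_inv)
  have "matrix_inv B ** matrix_inv A ** (A ** B) = matrix_inv B ** (matrix_inv A ** A) ** B"
    by (simp add: matrix_mul_assoc)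
  then show "matrix_inv B ** matrix_inv A ** (A ** B) = mat 1"
    using assms by (simp add: matrix_inv)
qed

declare transpose_matrix_vector [simp del]

lemma dual_act_eq: "dual_act g \<phi> = transpose (matrix_inv g) *v \<phi>"
  by (simp add: dual_act_def transpose_matrix_vector)

lemma dual_act_add: "dual_act g (\<phi> + \<psi>) = dual_act g \<phi> + dual_act g \<psi>"
  by (simp add: dual_act_eq matrix_vector_right_distrib)

lemma dual_act_scale: "dual_act g (c *s \<phi>) = c *s dual_act g \<phi>"
  by (simp add: dual_act_eq vector_scalar_commute)

lemma dual_act_sum: "dual_act g (sum f A) = (\<Sum>x\<in>A. dual_act g (f x))"
  by (induction A rule: infinite_finite_induct) (simp_all add: dual_act_add, simp_all add: dual_act_eq)

lemma dual_act_mult: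
  "invertible g \<Longrightarrow> invertible h \<Longrightarrow> dual_act (g ** h) \<phi> = dual_act g (dual_act h \<phi>)"
  by (simp add: dual_act_eq matrix_inv_mult matrix_transpose_mul flip: matrix_vector_mul_assoc)

lemma dual_act_1 [simp]: "dual_act (mat 1) \<phi> = \<phi>"
  by (simp add: dual_act_eq transpose_mat)

lemma lin_form_sum: "lin_form (sum f A) = (\<Sum>x\<in>A. lin_form (f x))"
  by (induction A rule: infinite_finite_induct) (simp_all add: lin_form_add)

lemma ring_homo_poly_act: "ring_homo (poly_act g)"
  unfolding poly_act_def poly_subst_eq_peval by (rule ring_homo_peval[OF ring_homo_PConst])

lemma poly_act_PConst [simp]: "poly_act g (PConst a) = PConst a"
  by (simp add: poly_act_def poly_subst_eq_peval peval_PConst[OF ring_homo_PConst])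

lemma poly_act_lin_form: "poly_act g (lin_form \<phi>) = lin_form (dual_act g \<phi>)"
proof -
  have "dual_act g \<phi> = (\<Sum>i\<in>UNIV. \<phi> $ i *s dual_act g (axis i 1))"
    by (subst (1) basis_expansion[of \<phi>, symmetric]) (simp only: dual_act_sum dual_act_scale)
  then show ?thesis
    by (simp add: poly_act_def poly_subst_eq_peval peval_lin_form[OF ring_homo_PConst] lin_form_sum
        lin_form_scale)
qed

lemma poly_act_PVar: "poly_act g (PVar i) = lin_form (dual_act g (axis i 1))"
  by (simp add: poly_act_lin_form flip: lin_form_axis)

lemma poly_act_mult:
  "invertible g \<Longrightarrow> invertible h \<Longrightarrow> poly_act (g ** h) p = poly_act g (poly_act h p)"
  by (rule ring_homo_eqI[OF ring_homo_poly_act ring_homo_comp[OF ring_homo_poly_act ring_homo_poly_act]])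
    (simp_all add: poly_act_PVar poly_act_lin_form dual_act_mult)

lemma poly_act_1 [simp]: "poly_act (mat 1) p = p"
  by (rule ring_homo_eqI[OF ring_homo_poly_act ring_homo_ident])
    (simp_all add: poly_act_PVar lin_form_axis)

definition map_mat :: "('a \<Rightarrow> 'b) \<Rightarrow> 'a ^ 'n ^ 'm \<Rightarrow> 'b ^ 'n ^ 'm" where
  "map_mat f A = (\<chi> i j. f (A $ i $ j))"

lemma peval_poly_act:
  assumes "ring_homo f"
  shows "peval f (($) P) (poly_act g p) = peval f (($) (map_mat f (matrix_inv g) *v P)) p"
proof (rule ring_homo_eqI[OF ring_homo_comp[OF ring_homo_peval ring_homo_poly_act] ring_homo_peval])
  show "peval f (($) P) (poly_act g (PVar i)) = peval f (($) (map_mat f (matrix_inv g) *v P)) (PVar i)" for i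
  proof -
    have "dual_act g (axis i 1) $ j = matrix_inv g $ i $ j" for j
      by (simp add: dual_act_def vector_matrix_mult_def axis_def if_zero_mult)
    then show ?thesis
      using assms
      by (simp add: poly_act_PVar peval_lin_form peval_PVar matrix_vector_mult_def map_mat_def)
  qed
qed (simp_all add: assms peval_PConst)

text \<open>The common interface of both modules: \<open>R\<close> is the identity for S \<otimes> V
  and the inverse transpose for S \<otimes> V^*. Multiplicativity is asked for invertible matrices,
  where \<open>matrix_inv\<close> is a genuine inverse.\<close>

locale covariant_action =
  fixes R :: "(('a::field, 'n::{finite,linorder}) vec, 'n) vec \<Rightarrow> (('a, 'n) vec, 'n) vec"
    and \<rho> :: "(('a, 'n) vec, 'n) vec \<Rightarrow> ('a, 'n) vec \<Rightarrow> ('a, 'n) vec"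
  assumes \<rho>_eq: "\<rho> g v = R g *v v"
    and R_1: "R (mat 1) = mat 1"
    and R_mult: "invertible g \<Longrightarrow> invertible h \<Longrightarrow> R (g ** h) = R g ** R h"
begin

lemma act_nth: "tensor_act \<rho> g \<theta> $ j = (\<Sum>i\<in>UNIV. poly_act g (\<theta> $ i) * PConst (R g $ j $ i))"
proof -
  have "(\<rho> g (axis i 1)) $ j = R g $ j $ i" for i
    by (simp add: \<rho>_eq matrix_vector_mult_def axis_def if_zero_mult)
  then show ?thesis
    by (simp add: tensor_act_def tensor_one_def)
qed

lemma act_add: "tensor_act \<rho> g (\<theta> + \<eta>) = tensor_act \<rho> g \<theta> + tensor_act \<rho> g \<eta>"
  by (simp add: vec_eq_iff act_nth ring_homo.add[OF ring_homo_poly_act] distrib_right sum.distrib)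

lemma act_scale: "tensor_act \<rho> g (p *s \<theta>) = poly_act g p *s tensor_act \<rho> g \<theta>"
  by (simp add: vec_eq_iff act_nth ring_homo.mult[OF ring_homo_poly_act] sum_distrib_left mult.assoc)

lemma act_0 [simp]: "tensor_act \<rho> g 0 = 0"
  by (simp add: vec_eq_iff act_nth ring_homo.zero[OF ring_homo_poly_act])

lemma act_sum: "tensor_act \<rho> g (sum f A) = (\<Sum>x\<in>A. tensor_act \<rho> g (f x))"
  by (induction A rule: infinite_finite_induct) (simp_all add: act_add)

lemma act_1 [simp]: "tensor_act \<rho> (mat 1) \<theta> = \<theta>"
proof -
  have "R (mat 1) $ j $ i = (if j = i then 1 else 0)" for i j
    unfolding R_1 by (simp add: mat_def)
  then show ?thesis
    by (simp add: vec_eq_iff act_nth if_distrib[of PConst] if_zero_mult cong: if_cong)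
qed

lemma act_mult:
  assumes "invertible g" "invertible h"
  shows "tensor_act \<rho> (g ** h) \<theta> = tensor_act \<rho> g (tensor_act \<rho> h \<theta>)"
proof (subst vec_eq_iff, rule allI)
  fix j
  have R: "R (g ** h) $ j $ i = (\<Sum>k\<in>UNIV. R g $ j $ k * R h $ k $ i)" for i
    unfolding R_mult[OF assms] by (simp add: matrix_matrix_mult_def)
  have "tensor_act \<rho> g (tensor_act \<rho> h \<theta>) $ j =
      (\<Sum>k\<in>UNIV. \<Sum>i\<in>UNIV. poly_act (g ** h) (\<theta> $ i) * PConst (R g $ j $ k * R h $ k $ i))"
    by (simp add: act_nth ring_homo.hsum[OF ring_homo_poly_act] ring_homo.mult[OF ring_homo_poly_act]
        ring_homo.mult[OF ring_homo_PConst] poly_act_mult[OF assms] sum_distrib_right sum_distrib_left mult_ac)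
  also have "\<dots> = (\<Sum>i\<in>UNIV. \<Sum>k\<in>UNIV. poly_act (g ** h) (\<theta> $ i) * PConst (R g $ j $ k * R h $ k $ i))"
    by (rule sum.swap)
  also have "\<dots> = tensor_act \<rho> (g ** h) \<theta> $ j"
    by (simp add: act_nth R ring_homo.hsum[OF ring_homo_PConst] sum_distrib_left)
  finally show "tensor_act \<rho> (g ** h) \<theta> $ j = tensor_act \<rho> g (tensor_act \<rho> h \<theta>) $ j" ..
qed

end

lemma
  assumes "subgroup G GL"
  shows subgroup_GL_invertible: "g \<in> G \<Longrightarrow> invertible g"
    and subgroup_GL_1: "mat 1 \<in> G"
    and subgroup_GL_mult: "g \<in> G \<Longrightarrow> h \<in> G \<Longrightarrow> g ** h \<in> G"
    and subgroup_GL_matrix_inv: "g \<in> G \<Longrightarrow> matrix_inv g \<in> G"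
proof -
  interpret subgroup G GL by fact
  show inv: "invertible g" if "g \<in> G" for g
    using subset that by (auto simp: GL_def)
  show "mat 1 \<in> G"
    using one_closed by (simp add: GL_def)
  show "g ** h \<in> G" if "g \<in> G" "h \<in> G"
    using m_closed[OF that] by (simp add: GL_def)
  show "matrix_inv g \<in> G" if "g \<in> G"
  proof -
    have "inv\<^bsub>GL\<^esub> g = matrix_inv g"
      by (rule group.inv_equality[OF group_GL])
        (use that inv in \<open>auto simp: GL_def matrix_inv invertible_matrix_inv\<close>)
    then show ?thesis
      using m_inv_closed[OF that] by simp
  qed
qed


section \<open>Independence over the fraction field\<close>

lemma Fract_1_eq_0_iff: "Fract x 1 = 0 \<longleftrightarrow> (x :: 'r::idom) = 0"
  by (subst Zero_fract_def, subst eq_fract) simp_all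

lemma det_neq_0_iff:
  fixes \<theta> :: "'n::finite \<Rightarrow> 'r::idom ^ 'n"
  shows "det (\<chi> i. \<theta> i) \<noteq> 0 \<longleftrightarrow>
    (\<forall>c. (\<Sum>i\<in>UNIV. c i *s to_fract_vec (\<theta> i)) = 0 \<longrightarrow> (\<forall>i. c i = 0))"
proof -
  let ?v = "\<lambda>i. to_fract_vec (\<theta> i)"
  let ?M = "\<chi> i. ?v i"
  have "(\<chi> i j. Fract ((\<chi> i. \<theta> i) $ i $ j) 1) = ?M"
    by (simp add: vec_eq_iff to_fract_vec_def)
  then have "det ?M = Fract (det (\<chi> i. \<theta> i)) 1"
    using ring_homo.det[OF ring_homo_Fract, of "\<chi> i. \<theta> i"] by simp
  then have "det (\<chi> i. \<theta> i) \<noteq> 0 \<longleftrightarrow> invertible ?M"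
    by (simp add: invertible_det_nz Fract_1_eq_0_iff)
  also have "\<dots> \<longleftrightarrow> (\<forall>c. (\<Sum>i\<in>UNIV. c i *s ?v i) = 0 \<longrightarrow> (\<forall>i. c i = 0))"
    by (simp add: invertible_right_inverse matrix_right_invertible_independent_rows row_def vec_lambda_eta)
  finally show ?thesis .
qed

lemma fract_independent_iff_det:
  fixes \<theta> :: "'n::finite \<Rightarrow> 'r::idom ^ 'n"
  shows "fract_independent \<theta> \<longleftrightarrow> det (\<chi> i. \<theta> i) \<noteq> 0"
proof -
  let ?v = "\<lambda>i. to_fract_vec (\<theta> i)"
  have "(\<forall>c. (\<Sum>i\<in>UNIV. c i *s ?v i) = 0 \<longrightarrow> (\<forall>i. c i = 0)) \<longleftrightarrow> fract_independent \<theta>"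
  proof
    assume *: "\<forall>c. (\<Sum>i\<in>UNIV. c i *s ?v i) = 0 \<longrightarrow> (\<forall>i. c i = 0)"
    have inj: "inj ?v"
    proof (rule injI, rule ccontr)
      fix i j
      assume ij: "?v i = ?v j" "i \<noteq> j"
      have "(\<Sum>k\<in>UNIV. ((if k = i then 1 else 0) - (if k = j then 1 else 0)) *s ?v k) = ?v i - ?v j"
        by (simp add: vec_eq_iff left_diff_distrib sum_subtractf if_zero_mult)
      then have "(if i = i then 1 else 0) - (if i = j then 1 else 0) = (0 :: 'r fract)"
        using *[rule_format, of "\<lambda>k. (if k = i then 1 else 0) - (if k = j then 1 else 0)" i] ij by simp
      then show False
        using ij by simp
    qed
    moreover have "vec.independent (range ?v)"
    proof
      assume "vec.dependent (range ?v)"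
      then obtain u i where u: "u (?v i) \<noteq> 0" "(\<Sum>w\<in>range ?v. u w *s w) = 0"
        by (auto simp: vec.dependent_finite)
      then have "(\<Sum>i\<in>UNIV. u (?v i) *s ?v i) = 0"
        by (simp add: sum.reindex[OF inj])
      then show False
        using *[rule_format, of "\<lambda>i. u (?v i)" i] u by simp
    qed
    ultimately show "fract_independent \<theta>"
      by (simp add: fract_independent_def)
  next
    assume ind: "fract_independent \<theta>"
    then have inj: "inj ?v" and ind: "vec.independent (range ?v)"
      by (auto simp: fract_independent_def)
    show "\<forall>c. (\<Sum>i\<in>UNIV. c i *s ?v i) = 0 \<longrightarrow> (\<forall>i. c i = 0)"
    proof (intro allI impI)
      fix c i
      assume "(\<Sum>i\<in>UNIV. c i *s ?v i) = 0"
      then have "(\<Sum>w\<in>range ?v. c (inv_into UNIV ?v w) *s w) = 0"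
        using inv_into_f_f[OF inj] by (simp add: sum.reindex[OF inj])
      then have "c (inv_into UNIV ?v (?v i)) = 0"
        using ind by (auto simp: vec.dependent_finite)
      then show "c i = 0"
        using inv_into_f_f[OF inj] by simp
    qed
  qed
  then show ?thesis
    by (simp add: det_neq_0_iff)
qed

text \<open>Cramer's rule is applied over the fraction field. By hypothesis its quotients of
  determinants are elements of the domain, so the identity descends along the injection into the
  fractions.\<close>

lemma cramer_idom:
  fixes \<theta> :: "'n::finite \<Rightarrow> 'r::idom ^ 'n" and c :: "'n \<Rightarrow> 'r"
  assumes D: "det (\<chi> i. \<theta> i) \<noteq> 0"
    and c: "\<And>i. det (\<chi> k. (\<theta>(i := \<eta>)) k) = c i * det (\<chi> i. \<theta> i)"
  shows "\<eta> = (\<Sum>i\<in>UNIV. c i *s \<theta> i)"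
proof -
  let ?F = "\<lambda>x :: 'r. Fract x 1"
  interpret F: ring_homo ?F by (rule ring_homo_Fract)
  let ?A = "\<chi> i j. ?F (\<theta> j $ i)" and ?b = "\<chi> i. ?F (\<eta> $ i)"
  have det_F: "det (\<chi> i j. ?F (\<xi> j $ i)) = ?F (det (\<chi> i. \<xi> i))" for \<xi> :: "'n \<Rightarrow> 'r ^ 'n"
  proof -
    have "(\<chi> i j. ?F (\<xi> j $ i)) = transpose (\<chi> i j. ?F ((\<chi> i. \<xi> i) $ i $ j))"
      by (simp add: transpose_def vec_eq_iff)
    then show ?thesis
      by (simp only: det_transpose F.det)
  qed
  have D': "det ?A \<noteq> 0"
    using D by (simp add: det_F Fract_1_eq_0_iff)
  have "det (\<chi> i j. if j = k then ?b $ i else ?A $ i $ j) = ?F (c k) * det ?A" for k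
  proof -
    have "(\<chi> i j. if j = k then ?b $ i else ?A $ i $ j) = (\<chi> i j. ?F ((\<theta>(k := \<eta>)) j $ i))"
      by (simp add: vec_eq_iff)
    then show ?thesis
      by (simp only: det_F c F.mult)
  qed
  then have "?A *v (\<chi> k. ?F (c k)) = ?b"
    using D' by (subst cramer) (simp_all add: vec_eq_iff)
  then have "?F (\<eta> $ i) = ?F (\<Sum>k\<in>UNIV. c k * \<theta> k $ i)" for i
    by (simp add: vec_eq_iff matrix_vector_mult_def F.hsum mult.commute)
  then show ?thesis
    by (simp add: vec_eq_iff eq_fract)
qed

lemma sum_scale_eq_0_imp:
  fixes \<theta> :: "'n::finite \<Rightarrow> 'r::idom ^ 'n"
  assumes "det (\<chi> i. \<theta> i) \<noteq> 0" "(\<Sum>i\<in>UNIV. c i *s \<theta> i) = 0"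
  shows "c i = 0"
proof -
  interpret F: ring_homo "\<lambda>x :: 'r. Fract x 1"
    by (rule ring_homo_Fract)
  have "(\<Sum>i\<in>UNIV. c i *s \<theta> i) $ j = 0" for j
    by (simp add: assms(2))
  then have "(\<Sum>i\<in>UNIV. Fract (c i * \<theta> i $ j) 1) = 0" for j
    by (simp flip: F.hsum)
  then have "(\<Sum>i\<in>UNIV. Fract (c i) 1 *s to_fract_vec (\<theta> i)) = 0"
    by (simp add: vec_eq_iff to_fract_vec_def)
  then have "Fract (c i) 1 = 0"
    using assms(1) unfolding det_neq_0_iff by (elim allE[of _ "\<lambda>i. Fract (c i) 1"]) auto
  then show ?thesis
    by (simp add: Fract_1_eq_0_iff)
qed


section \<open>Points in general position\<close>

lemma digits_unique:
  fixes a b :: "nat \<Rightarrow> nat"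
  assumes "\<And>k. k < n \<Longrightarrow> a k < N" "\<And>k. k < n \<Longrightarrow> b k < N"
    and "(\<Sum>k<n. a k * N ^ k) = (\<Sum>k<n. b k * N ^ k)"
  shows "k < n \<Longrightarrow> a k = b k"
  using assms
proof (induction n arbitrary: a b k)
  case (Suc n)
  have split: "(\<Sum>k<Suc n. a k * N ^ k) = a 0 + N * (\<Sum>k<n. a (Suc k) * N ^ k)" for a :: "nat \<Rightarrow> nat"
    by (subst sum.lessThan_Suc_shift) (simp add: sum_distrib_left mult_ac)
  have eq: "a 0 + N * (\<Sum>k<n. a (Suc k) * N ^ k) = b 0 + N * (\<Sum>k<n. b (Suc k) * N ^ k)"
    using Suc.prems(4) by (simp only: split)
  have lt: "a 0 < N" "b 0 < N"
    using Suc.prems(2,3) by auto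
  have "(a 0 + N * (\<Sum>k<n. a (Suc k) * N ^ k)) mod N = (b 0 + N * (\<Sum>k<n. b (Suc k) * N ^ k)) mod N"
    by (simp only: eq)
  then have z: "a 0 = b 0"
    using lt by simp
  then have "(\<Sum>k<n. a (Suc k) * N ^ k) = (\<Sum>k<n. b (Suc k) * N ^ k)"
    using eq lt by simp
  then have "a (Suc l) = b (Suc l)" if "l < n" for l
    using Suc.IH[of l "\<lambda>k. a (Suc k)" "\<lambda>k. b (Suc k)"] that Suc.prems(2,3) by auto
  then show ?case
    using z Suc.prems(1) by (cases k) auto
qed simp

lemma ring_homo_field_eq_0_iff:
  fixes f :: "'a::field \<Rightarrow> 'e::field"
  assumes "ring_homo f"
  shows "f a = 0 \<longleftrightarrow> a = 0"
proof
  interpret ring_homo f by fact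
  show "a = 0" if "f a = 0"
  proof (rule ccontr)
    assume "a \<noteq> 0"
    then have "f a * f (1 / a) = 1"
      by (simp flip: mult)
    then show False
      using that by simp
  qed
qed (simp add: ring_homo.zero[OF assms])

text \<open>
  Kronecker's substitution \<open>x\<^sub>k \<mapsto> t\<^bsup>N ^ k\<^esup>\<close> is injective on the monomials with exponents below \<open>N\<close>.
\<close>

lemma nth_vec_lambda: "($) (\<chi> i. g i) = g"
  by (simp add: fun_eq_iff)

lemma exists_peval_neq_0:
  fixes f :: "'a::field \<Rightarrow> 'e::field" and p :: "('a, 'n::finite) poly_ring"
  assumes f: "ring_homo f" and inf: "infinite (UNIV :: 'e set)" and p: "p \<noteq> 0"
  obtains P :: "'e ^ 'n" where "peval f (($) P) p \<noteq> 0"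
proof -
  obtain idx where idx: "bij_betw idx (UNIV :: 'n set) {..<CARD('n)}"
    using ex_bij_betw_finite_nat[of "UNIV :: 'n set"] by (auto simp: atLeast0LessThan)
  let ?E = "(\<lambda>(m, i). Poly_Mapping.lookup m i) ` (Poly_Mapping.keys p \<times> (UNIV :: 'n set))"
  define N where "N = Suc (Max ?E)"
  define w where "w m = (\<Sum>i\<in>UNIV. Poly_Mapping.lookup m i * N ^ idx i)" for m
  have N: "Poly_Mapping.lookup m i < N" if "m \<in> Poly_Mapping.keys p" for m i
    unfolding N_def less_Suc_eq_le by (rule Max_ge) (use that in auto)
  have inj: "inj_on w (Poly_Mapping.keys p)"
  proof (rule inj_onI)
    fix m m'
    assume m: "m \<in> Poly_Mapping.keys p" "m' \<in> Poly_Mapping.keys p" and eq: "w m = w m'"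
    let ?i = "inv_into UNIV idx"
    have w: "w m = (\<Sum>k<CARD('n). Poly_Mapping.lookup m (?i k) * N ^ k)" for m
      unfolding w_def
      by (rule sum.reindex_bij_witness[of _ ?i idx])
        (use idx in \<open>auto simp: bij_betw_def f_inv_into_f[of _ idx UNIV]\<close>)
    have "Poly_Mapping.lookup m (?i k) = Poly_Mapping.lookup m' (?i k)" if "k < CARD('n)" for k
      by (rule digits_unique[of "CARD('n)" _ N]) (use that m N eq in \<open>simp_all flip: w\<close>)
    then have "Poly_Mapping.lookup m i = Poly_Mapping.lookup m' i" for i
      using idx by (metis UNIV_I bij_betwE bij_betw_def inv_into_f_f lessThan_iff)
    then show "m = m'"
      by (intro poly_mapping_eqI) simp
  qed
  define q where "q = peval (\<lambda>a. [:f a:]) (\<lambda>i. monom 1 (N ^ idx i)) p"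
  have q: "q = (\<Sum>m\<in>Poly_Mapping.keys p. monom (f (Poly_Mapping.lookup p m)) (w m))"
    unfolding q_def peval_def
    by (rule sum.cong)
      (simp_all add: monom_power prod_monom w_def mult.commute smult_monom)
  obtain m where m: "m \<in> Poly_Mapping.keys p"
    using p by (metis keys_eq_empty equals0I)
  have "coeff q (w m) = (\<Sum>l\<in>Poly_Mapping.keys p. if l = m then f (Poly_Mapping.lookup p l) else 0)"
    unfolding q coeff_sum by (rule sum.cong) (use m inj in \<open>auto dest: inj_onD\<close>)
  then have "coeff q (w m) \<noteq> 0"
    using m by (simp add: ring_homo_field_eq_0_iff[OF f] in_keys_iff)
  then have "finite {t. poly q t = 0}"
    by (intro poly_roots_finite) auto
  then obtain t where "poly q t \<noteq> 0"
    using inf by (metis (mono_tags) UNIV_eq_I mem_Collect_eq)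
  moreover have "poly q t = peval f (($) (\<chi> i. t ^ N ^ idx i)) p"
    unfolding q_def ring_homo_peval_comp[OF ring_homo_poly] nth_vec_lambda by (simp add: poly_monom)
  ultimately show ?thesis
    using that by metis
qed

section \<open>Restriction of polynomials to a line\<close>

lemma coeff_mult_degree_bound:
  fixes p q :: "'a::comm_semiring_1 poly"
  assumes "Polynomial.degree p \<le> m" "Polynomial.degree q \<le> n"
  shows "coeff (p * q) (m + n) = coeff p m * coeff q n"
proof (cases "Polynomial.degree p = m \<and> Polynomial.degree q = n")
  case True
  then show ?thesis
    using coeff_mult_degree_sum[of p q] by simp
next
  case False
  then have "Polynomial.degree (p * q) < m + n"
    using assms degree_mult_le[of p q] by linarith
  then show ?thesis
    using False assms by (auto simp: coeff_eq_0 le_neq_implies_less)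
qed

text \<open>u may be zero, so the degree is only bounded, and the coefficient is taken at position k
  instead of at the actual degree.\<close>

lemma linear_power_lead_coeff:
  fixes x u :: "'a::comm_semiring_1"
  shows "Polynomial.degree ([:x, u:] ^ k) \<le> k \<and> coeff ([:x, u:] ^ k) k = u ^ k"
proof (induction k)
  case (Suc k)
  have "Polynomial.degree [:x, u:] \<le> 1"
    by simp
  then show ?case
    using Suc coeff_mult_degree_bound[of "[:x, u:]" 1 "[:x, u:] ^ k" k]
      degree_mult_le[of "[:x, u:]" "[:x, u:] ^ k"] by (simp del: mult_pCons_left)
qed simp

lemma linear_prod_lead_coeff:
  fixes x u :: "'b \<Rightarrow> 'a::comm_semiring_1"
  shows "Polynomial.degree (\<Prod>i\<in>A. [:x i, u i:] ^ k i) \<le> sum k A \<and>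
    coeff (\<Prod>i\<in>A. [:x i, u i:] ^ k i) (sum k A) = (\<Prod>i\<in>A. u i ^ k i)"
proof (induction A rule: infinite_finite_induct)
  case (insert i A)
  let ?p = "[:x i, u i:] ^ k i" and ?q = "\<Prod>i\<in>A. [:x i, u i:] ^ k i"
  have "coeff (?p * ?q) (k i + sum k A) = u i ^ k i * (\<Prod>i\<in>A. u i ^ k i)"
    using insert linear_power_lead_coeff[of "x i" "u i" "k i"]
    by (subst coeff_mult_degree_bound) auto
  moreover have "Polynomial.degree (?p * ?q) \<le> k i + sum k A"
    using insert linear_power_lead_coeff[of "x i" "u i" "k i"] degree_mult_le[of ?p ?q] by linarith
  ultimately show ?case
    using insert by simp
qed simp_all

text \<open>The restriction to the line x + t u as a polynomial in t. Its order of vanishing at t =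
  0 stands in for a local order at the point x.\<close>

definition eval_line :: "'a alg_closure ^ 'n \<Rightarrow> 'a alg_closure ^ 'n \<Rightarrow>
    ('a::field, 'n::finite) poly_ring \<Rightarrow> 'a alg_closure poly" where
  "eval_line x u = peval (\<lambda>a. [:to_ac a:]) (\<lambda>i. [:x $ i, u $ i:])"

lemma ring_homo_eval_line: "ring_homo (eval_line x u)"
  unfolding eval_line_def by (intro ring_homo_peval ring_homo_const_poly ring_homo_to_ac)

lemma poly_eval_line: "poly (eval_line x u p) t = peval to_ac (($) (x + t *s u)) p"
proof -
  have "($) (x + t *s u) = (\<lambda>i. x $ i + t * u $ i)"
    by (simp add: fun_eq_iff)
  then show ?thesis
    unfolding eval_line_def ring_homo_peval_comp[OF ring_homo_poly] by simp
qed

text \<open>The terms of degree d in t come from choosing the direction in every factor. If p does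
  not vanish at u and d > 0, the restriction is nonconstant and has a root.\<close>

lemma coeff_eval_line_homogeneous:
  assumes "poly_homogeneous d p"
  shows "coeff (eval_line x u p) d = peval to_ac (($) u) p"
proof -
  have "coeff (\<Prod>i\<in>UNIV. [:x $ i, u $ i:] ^ Poly_Mapping.lookup m i) d =
      (\<Prod>i\<in>UNIV. u $ i ^ Poly_Mapping.lookup m i)" if "m \<in> Poly_Mapping.keys p" for m
    using linear_prod_lead_coeff[where A = UNIV and x = "($) x" and u = "($) u" and k = "Poly_Mapping.lookup m"] assms that
    by (auto simp: poly_homogeneous_def monom_deg_def)
  then show ?thesis
    by (simp add: eval_line_def peval_def coeff_sum)
qed

lemma eval_line_lin_form:
  "eval_line x u (lin_form \<phi>) =
    [:peval to_ac (($) x) (lin_form \<phi>), peval to_ac (($) u) (lin_form \<phi>):]"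
  unfolding eval_line_def
  by (simp add: peval_lin_form ring_homo_const_poly ring_homo_to_ac poly_eq_iff coeff_sum coeff_pCons
      split: nat.split) (simp add: mult.commute)

text \<open>Over a finite field the product of all t - a, plus 1, has positive degree but takes only
  the value 1.\<close>

lemma infinite_alg_closure: "infinite (UNIV :: 'a::field alg_closure set)"
proof
  assume fin: "finite (UNIV :: 'a alg_closure set)"
  define q where "q = (\<Prod>a\<in>(UNIV :: 'a alg_closure set). [:- a, 1:])"
  have "Polynomial.degree q = card (UNIV :: 'a alg_closure set)"
    unfolding q_def by (subst degree_prod_eq_sum_degree) auto
  then have "Polynomial.degree (q + 1) > 0"
    using fin by (subst degree_add_eq_left) (auto simp: card_gt_0_iff)
  then obtain x where "poly (q + 1) x = 0"
    using alg_closed_imp_poly_has_root by blast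
  moreover have "poly q x = 0"
    using fin by (auto simp: q_def poly_prod)
  ultimately show False
    by simp
qed

text \<open>
  Choosing the direction \<open>u\<close> off the zeros of \<open>c\<close> and of all \<open>\<phi>\<close> leaves the line through a point
  \<open>x\<close> a chance to avoid all the subspaces \<open>\<phi> = \<psi> = 0\<close> of codimension two: the linear form
  \<open>\<phi>(u) \<psi> - \<psi>(u) \<phi>\<close> is constant on the line.
\<close>

lemma exists_zero_in_general_position:
  fixes c :: "('a::field, 'n::{finite,linorder}) poly_ring"
    and Y :: "(('a, 'n) vec \<times> ('a, 'n) vec) set"
  assumes c: "poly_homogeneous d c" "d > 0" and fin: "finite Y"
    and Y: "\<And>y. y \<in> Y \<Longrightarrow> fst y \<noteq> 0 \<and> (\<forall>a. snd y \<noteq> a *s fst y)"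
  obtains P :: "('a alg_closure, 'n) vec" where "peval to_ac (($) P) c = 0"
    and "\<And>y. y \<in> Y \<Longrightarrow>
      peval to_ac (($) P) (lin_form (fst y)) \<noteq> 0 \<or> peval to_ac (($) P) (lin_form (snd y)) \<noteq> 0"
proof -
  define ev :: "('a alg_closure, 'n) vec \<Rightarrow> ('a, 'n) poly_ring \<Rightarrow> 'a alg_closure"
    where "ev P = peval to_ac (($) P)" for P
  have ev_lin: "ev P (lin_form f) = (\<Sum>i\<in>UNIV. to_ac (f $ i) * P $ i)" for P f
    by (simp add: ev_def peval_lin_form ring_homo_to_ac)
  have hom: "ring_homo (ev P)" for P
    unfolding ev_def by (rule ring_homo_peval[OF ring_homo_to_ac])
  \<comment> \<open>For c = 0 the direction need not avoid the zeros of c, and the factor 1 keeps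
    \<open>r\<close> nonzero; every point of the line is then a zero of c.\<close>
  define r where "r = (if c = 0 then 1 else c) * (\<Prod>x\<in>Y. lin_form (fst x))"
  have "(\<Prod>x\<in>Y. lin_form (fst x)) \<noteq> 0"
    using Y fin by auto
  then have "r \<noteq> 0"
    by (simp add: r_def)
  then obtain u where "ev u r \<noteq> 0"
    unfolding ev_def by (rule exists_peval_neq_0[OF ring_homo_to_ac infinite_alg_closure])
  then have u: "c \<noteq> 0 \<Longrightarrow> ev u c \<noteq> 0" "\<And>y. y \<in> Y \<Longrightarrow> ev u (lin_form (fst y)) \<noteq> 0"
    using fin by (force simp: r_def ring_homo.mult[OF hom] ring_homo.hprod[OF hom])+
  define \<chi>' :: "('a, 'n) vec \<times> ('a, 'n) vec \<Rightarrow> ('a alg_closure, 'n) vec"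
    where "\<chi>' y = (\<chi> i. ev u (lin_form (fst y)) * to_ac (snd y $ i) - ev u (lin_form (snd y)) * to_ac (fst y $ i))" for y
  have \<chi>_nz: "\<chi>' y \<noteq> 0" if "y \<in> Y" for y
  proof
    define f g where "f = fst y" and "g = snd y"
    note y = Y[OF that, folded f_def g_def] u(2)[OF that, folded f_def g_def]
    assume "\<chi>' y = 0"
    then have eq: "ev u (lin_form f) * to_ac (g $ i) = ev u (lin_form g) * to_ac (f $ i)" for i
      by (simp add: \<chi>'_def vec_eq_iff f_def g_def)
    obtain k where k: "f $ k \<noteq> 0"
      using y(1) by (auto simp: vec_eq_iff)
    \<comment> \<open>Proportionality holds over the algebraic closure. The 2 by 2 minors have
      entries in the base field and \<open>to_ac\<close> is injective, so the ratio can be taken in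
      the base field, contradicting the choice of \<open>Y\<close>.\<close>
    have "g $ i = g $ k / f $ k * f $ i" for i
    proof -
      have "ev u (lin_form f) * to_ac (g $ i * f $ k) = (ev u (lin_form f) * to_ac (g $ i)) * to_ac (f $ k)"
        by simp
      also have "\<dots> = (ev u (lin_form g) * to_ac (f $ k)) * to_ac (f $ i)"
        unfolding eq[of i] by (simp only: mult_ac)
      also have "\<dots> = ev u (lin_form f) * to_ac (g $ k * f $ i)"
        unfolding eq[of k, symmetric] by simp
      finally have "to_ac (g $ i * f $ k) = to_ac (g $ k * f $ i)"
        using y(2) by (simp del: to_ac_mult)
      then have "g $ i * f $ k = g $ k * f $ i"
        by (simp only: to_ac_eq_iff)
      then show ?thesis
        using k by (simp add: field_simps)
    qed
    then have "g = (g $ k / f $ k) *s f"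
      unfolding vec_eq_iff vector_smult_component by blast
    then show False
      using y(1) by blast
  qed
  have "(\<Prod>x\<in>Y. lin_form (\<chi>' x)) \<noteq> 0"
    using \<chi>_nz fin by auto
  then obtain x where "peval (\<lambda>a. a) (($) x) (\<Prod>x\<in>Y. lin_form (\<chi>' x)) \<noteq> 0"
    by (rule exists_peval_neq_0[OF ring_homo_ident infinite_alg_closure])
  then have x: "(\<Sum>i\<in>UNIV. \<chi>' y $ i * x $ i) \<noteq> 0" if "y \<in> Y" for y
    using fin that
    by (auto simp: ring_homo.hprod[OF ring_homo_peval[OF ring_homo_ident]] peval_lin_form[OF ring_homo_ident])
  obtain t where t: "poly (eval_line x u c) t = 0"
  proof (cases "c = 0")
    case True
    then show ?thesis
      using that[of 0] by (simp add: ring_homo.zero[OF ring_homo_eval_line])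
  next
    case False
    then have "coeff (eval_line x u c) d \<noteq> 0"
      using u(1) c(1) by (simp add: coeff_eval_line_homogeneous ev_def)
    then have "Polynomial.degree (eval_line x u c) > 0"
      using c(2) le_degree by fastforce
    then show ?thesis
      using that alg_closed_imp_poly_has_root by blast
  qed
  let ?P = "x + t *s u"
  show ?thesis
  proof
    show "peval to_ac (($) ?P) c = 0"
      using t by (simp add: poly_eval_line)
    fix y
    assume Y': "y \<in> Y"
    define f g where "f = fst y" and "g = snd y"
    have lin: "ev ?P (lin_form \<xi>) = ev x (lin_form \<xi>) + t * ev u (lin_form \<xi>)" for \<xi>
      by (simp add: ev_lin distrib_left sum.distrib sum_distrib_left mult_ac)
    have "(\<Sum>i\<in>UNIV. \<chi>' y $ i * x $ i) =
        ev u (lin_form f) * ev x (lin_form g) - ev u (lin_form g) * ev x (lin_form f)"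
      by (simp add: \<chi>'_def f_def g_def left_diff_distrib sum_subtractf sum_distrib_left mult.assoc
          ev_lin[of x])
    also have "\<dots> = ev u (lin_form f) * ev ?P (lin_form g) - ev u (lin_form g) * ev ?P (lin_form f)"
      unfolding lin by (simp add: algebra_simps)
    finally have "ev ?P (lin_form f) \<noteq> 0 \<or> ev ?P (lin_form g) \<noteq> 0"
      using x[OF Y'] by auto
    then show "peval to_ac (($) ?P) (lin_form (fst y)) \<noteq> 0 \<or> peval to_ac (($) ?P) (lin_form (snd y)) \<noteq> 0"
      by (simp add: ev_def f_def g_def)
  qed
qed


section \<open>Reflections and root vectors\<close>

lemma dual_apply_add [simp]: "dual_apply \<phi> (v + w) = dual_apply \<phi> v + dual_apply \<phi> w"
  by (simp add: dual_apply_def distrib_left sum.distrib)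

lemma dual_apply_diff [simp]: "dual_apply \<phi> (v - w) = dual_apply \<phi> v - dual_apply \<phi> w"
  by (simp add: dual_apply_def right_diff_distrib sum_subtractf)

lemma dual_apply_scale [simp]: "dual_apply \<phi> (c *s v) = c * dual_apply \<phi> v"
  by (simp add: dual_apply_def sum_distrib_left mult_ac)

lemma dual_apply_0 [simp]: "dual_apply \<phi> 0 = 0"
  by (simp add: dual_apply_def)

lemma dual_apply_axis [simp]: "dual_apply \<phi> (axis i 1) = \<phi> $ i"
  by (simp add: dual_apply_def axis_def if_zero_mult)

lemma dual_apply_scale_left: "dual_apply (c *s \<phi>) v = c * dual_apply \<phi> v"
  by (simp add: dual_apply_def sum_distrib_left mult_ac)

lemma dual_apply_eqI: "(\<And>v. dual_apply \<phi> v = dual_apply \<psi> v) \<Longrightarrow> \<phi> = \<psi>"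
  by (metis dual_apply_axis vec_eq_iff)

lemma dual_apply_eq_1:
  assumes "\<phi> \<noteq> 0"
  obtains v where "dual_apply \<phi> v = 1"
proof -
  obtain i where "\<phi> $ i \<noteq> 0"
    using assms by (auto simp: vec_eq_iff)
  then show ?thesis
    using that[of "(1 / \<phi> $ i) *s axis i 1"] by simp
qed

lemma matrix_eqI: "(\<And>v. A *v v = B *v v) \<Longrightarrow> A = (B :: 'a::comm_ring_1 ^ 'n ^ 'm)"
  by (simp add: matrix_eq)

lemma subspace_kernel: "vec.subspace {v. dual_apply \<phi> v = 0}"
  by (rule vec.subspaceI) auto

lemma hyperplane_kernel:
  fixes \<phi> :: "'a::field ^ 'n"
  assumes "\<phi> \<noteq> 0"
  shows "hyperplane {v. dual_apply \<phi> v = 0}"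
proof -
  let ?K = "{v. dual_apply \<phi> v = 0}"
  obtain v where v: "dual_apply \<phi> v = 1"
    using dual_apply_eq_1[OF assms] .
  have span: "vec.span ?K = ?K"
    using subspace_kernel by (simp add: vec.span_eq_iff)
  have "w \<in> vec.span (insert v ?K)" for w
    unfolding vec.span_breakdown_eq span by (rule exI[of _ "dual_apply \<phi> w"]) (simp add: v)
  then have "vec.dim (insert v ?K) = CARD('n)"
    by (metis UNIV_eq_I vec.dim_span vec_dim_card)
  then have "vec.dim ?K = CARD('n) - 1"
    using v by (simp add: vec.dim_insert span split: if_splits)
  then show ?thesis
    by (simp add: hyperplane_def subspace_kernel)
qed

text \<open>If \<phi>(v0) = 1, every v is \<phi>(v) v0 plus an element of the kernel, so s is
  determined by s v0 and the root vector is s v0 - v0.\<close>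

lemma root_vector_exists:
  assumes "\<phi> \<noteq> 0" "\<And>v. dual_apply \<phi> v = 0 \<Longrightarrow> s *v v = v"
  obtains w where "root_vector \<phi> s w"
proof -
  obtain v0 where v0: "dual_apply \<phi> v0 = 1"
    using dual_apply_eq_1[OF assms(1)] .
  have "s *v v = v + dual_apply \<phi> v *s (s *v v0 - v0)" for v
  proof -
    have "s *v (v - dual_apply \<phi> v *s v0) = v - dual_apply \<phi> v *s v0"
      using v0 by (intro assms(2)) simp
    then have "s *v v - dual_apply \<phi> v *s (s *v v0) = v - dual_apply \<phi> v *s v0"
      by (simp only: matrix_vector_mult_diff_distrib vector_scalar_commute)
    then have "(s *v v - dual_apply \<phi> v *s (s *v v0)) + dual_apply \<phi> v *s (s *v v0) =
        (v - dual_apply \<phi> v *s v0) + dual_apply \<phi> v *s (s *v v0)"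
      by (simp only:)
    then show ?thesis
      by (simp add: vector_ssub_ldistrib)
  qed
  then show ?thesis
    using that unfolding root_vector_def by blast
qed

lemma root_vector_eq_0_iff:
  assumes "\<phi> \<noteq> 0" "root_vector \<phi> s w"
  shows "w = 0 \<longleftrightarrow> s = mat 1"
proof -
  obtain v0 where v0: "dual_apply \<phi> v0 = 1"
    using dual_apply_eq_1[OF assms(1)] .
  show ?thesis
  proof
    assume "w = 0"
    then show "s = mat 1"
      using assms(2) by (intro matrix_eqI) (simp add: root_vector_def)
  next
    assume "s = mat 1"
    then show "w = 0"
      using assms(2) v0 by (auto simp: root_vector_def dest: spec[of _ v0])
  qed
qed

lemma root_vector_row: "root_vector \<phi> s w \<Longrightarrow> (s - mat 1) $ i = w $ i *s \<phi>"
proof -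
  assume s: "root_vector \<phi> s w"
  have "(s - mat 1) $ i $ j = w $ i * \<phi> $ j" for j
  proof -
    have "(s *v axis j 1) $ i = axis j 1 $ i + \<phi> $ j * w $ i"
      using s by (simp add: root_vector_def)
    moreover have "(s *v axis j 1) $ i = s $ i $ j"
      by (simp add: matrix_vector_mult_def axis_def if_zero_mult)
    ultimately have "s $ i $ j = axis j 1 $ i + \<phi> $ j * w $ i"
      by (simp only:)
    then have "s $ i $ j - axis j 1 $ i = w $ i * \<phi> $ j"
      by (simp only: mult.commute add_diff_cancel_left')
    then show ?thesis
      by (simp add: axis_def mat_def)
  qed
  then show ?thesis
    by (simp add: vec_eq_iff)
qed

text \<open>Since s v - v = \<phi>(v) w with w nonzero, a reflection determines its hyperplane; a
  finite group thus has finitely many reflecting hyperplanes.\<close>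

lemma
  assumes "reflection_about H s" "{v. dual_apply \<phi> v = 0} = H"
  shows reflection_about_form_neq_0: "\<phi> \<noteq> 0"
    and reflection_about_fixed_space: "H = {v. s *v v = v}"
proof -
  show nz: "\<phi> \<noteq> 0"
  proof
    assume "\<phi> = 0"
    then have "s = mat 1"
      using assms by (intro matrix_eqI) (auto simp: reflection_about_def dual_apply_def)
    then show False
      using assms by (simp add: reflection_about_def)
  qed
  obtain w where w: "root_vector \<phi> s w"
    using root_vector_exists[OF nz, of s] assms by (auto simp: reflection_about_def)
  moreover have "w \<noteq> 0"
    using root_vector_eq_0_iff[OF nz w] assms by (simp add: reflection_about_def)
  ultimately show "H = {v. s *v v = v}"
    using assms(2) by (auto simp: root_vector_def)
qed

text \<open>If all rows of g - 1 were multiples of one nonzero row, g would fix the kernel of that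
  row pointwise and be a reflection. The two rows obtained confine the fixed points of g to
  codimension two.\<close>

lemma not_reflection_rows:
  fixes g :: "'a::field ^ 'n ^ 'n"
  assumes "invertible g" "g \<noteq> mat 1" "\<And>H. \<not> reflection_about H g"
  obtains i j where "(g - mat 1) $ i \<noteq> 0" "\<And>a. (g - mat 1) $ j \<noteq> a *s (g - mat 1) $ i"
proof -
  obtain i where i: "(g - mat 1) $ i \<noteq> 0"
    using assms(2) by (metis vec_eq_iff right_minus_eq zero_index)
  have "\<exists>j. \<forall>a. (g - mat 1) $ j \<noteq> a *s (g - mat 1) $ i"
  proof (rule ccontr)
    assume "\<not> ?thesis"
    then have "\<forall>j. \<exists>a. (g - mat 1) $ j = a *s (g - mat 1) $ i"
      by blast
    then obtain a where a: "\<And>j. (g - mat 1) $ j = a j *s (g - mat 1) $ i"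
      by metis
    have "g *v v = v" if "dual_apply ((g - mat 1) $ i) v = 0" for v
    proof -
      have "((g - mat 1) *v v) $ j = dual_apply ((g - mat 1) $ j) v" for j
        by (simp add: matrix_vector_mult_def dual_apply_def)
      then have "(g - mat 1) *v v = 0"
        by (subst vec_eq_iff) (metis a dual_apply_scale_left that mult_zero_right zero_index)
      then show ?thesis
        by (simp add: matrix_vector_mult_diff_rdistrib)
    qed
    then have "reflection_about {v. dual_apply ((g - mat 1) $ i) v = 0} g"
      using assms(1,2) hyperplane_kernel[OF i] by (auto simp: reflection_about_def)
    then show False
      using assms(3) by blast
  qed
  then show ?thesis
    using that i by blast
qed


section \<open>An abstract form of Saito's criterion\<close>

text \<open>The exponent \<open>m H\<close> is pinned from both sides by conditions local at H:
  \<open>lower\<close> bounds the order of every determinant of G-invariants, while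
  \<open>upper\<close> attains it with vectors required to be invariant only under the pointwise
  stabiliser of H.\<close>

locale saito_data = covariant_action +
  fixes G :: "(('a::field, 'n::{finite,linorder}) vec, 'n) vec set"
    and l :: "('a, 'n) vec set \<Rightarrow> ('a, 'n) vec"
    and m :: "('a, 'n) vec set \<Rightarrow> nat"
  assumes subgroup: "subgroup G GL" and finite_G: "finite G"
    and forms: "defines_hyperplanes G l"
    and lower: "H \<in> refl_hyperplanes G \<Longrightarrow> (\<And>i g. g \<in> G \<Longrightarrow> tensor_act \<rho> g (\<eta> i) = \<eta> i) \<Longrightarrow>
      lin_form (l H) ^ m H dvd det (\<chi> i. \<eta> i)"
    and upper: "H \<in> refl_hyperplanes G \<Longrightarrow>
      \<exists>\<eta> c. c \<noteq> 0 \<and> det (\<chi> i. \<eta> i) = PConst c * lin_form (l H) ^ m H \<and>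
        (\<forall>g\<in>G. (\<forall>v\<in>H. g *v v = v) \<longrightarrow> (\<forall>i. tensor_act \<rho> g (\<eta> i) = \<eta> i))"
begin

definition "Inv = {\<theta>. \<forall>g\<in>G. tensor_act \<rho> g \<theta> = \<theta>}"
definition "Q = (\<Prod>H\<in>refl_hyperplanes G. lin_form (l H) ^ m H)"

lemma kernel: "H \<in> refl_hyperplanes G \<Longrightarrow> {v. dual_apply (l H) v = 0} = H"
  using forms by (simp add: defines_hyperplanes_def)

lemma l_neq_0: "H \<in> refl_hyperplanes G \<Longrightarrow> l H \<noteq> 0"
  using reflection_about_form_neq_0[OF _ kernel] by (auto simp: refl_hyperplanes_def)

lemma l_not_multiple:
  assumes "H \<in> refl_hyperplanes G" "H' \<in> refl_hyperplanes G" "H \<noteq> H'"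
  shows "l H' \<noteq> a *s l H"
proof
  assume eq: "l H' = a *s l H"
  then have "a \<noteq> 0"
    using l_neq_0[OF assms(2)] by auto
  then have "{v. dual_apply (l H') v = 0} = {v. dual_apply (l H) v = 0}"
    by (simp add: eq dual_apply_scale_left)
  then show False
    using assms kernel by metis
qed

lemma finite_refl_hyperplanes: "finite (refl_hyperplanes G)"
proof (rule finite_subset)
  show "refl_hyperplanes G \<subseteq> (\<lambda>s. {v. s *v v = v}) ` G"
  proof
    fix H
    assume H: "H \<in> refl_hyperplanes G"
    then obtain s where "s \<in> G" "reflection_about H s"
      by (auto simp: refl_hyperplanes_def)
    then show "H \<in> (\<lambda>s. {v. s *v v = v}) ` G"
      using reflection_about_fixed_space[OF _ kernel[OF H]] by blast
  qed
qed (simp add: finite_G)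

lemma Q_neq_0: "Q \<noteq> 0"
  using l_neq_0 finite_refl_hyperplanes by (simp add: Q_def)

lemma Q_homogeneous: "poly_homogeneous (\<Sum>H\<in>refl_hyperplanes G. m H) Q"
  unfolding Q_def
  using poly_homogeneous_power[OF poly_homogeneous_lin_form] by (intro poly_homogeneous_prod) simp

lemma Q_dvd_det:
  assumes "\<And>i. \<eta> i \<in> Inv"
  shows "Q dvd det (\<chi> i. \<eta> i)"
  unfolding Q_def
proof (rule prod_prime_elem_powers_dvd[OF finite_refl_hyperplanes])
  show "\<not> lin_form (l H) dvd lin_form (l H')"
    if "H \<in> refl_hyperplanes G" "H' \<in> refl_hyperplanes G" "H \<noteq> H'" for H H'
    using l_not_multiple[OF that] by (metis lin_form_dvd_lin_form)
  show "lin_form (l H) ^ m H dvd det (\<chi> i. \<eta> i)" if "H \<in> refl_hyperplanes G" for H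
    using assms that by (intro lower) (simp_all add: Inv_def)
qed (simp add: prime_elem_lin_form l_neq_0)

lemma Inv_sum:
  assumes "\<And>i. c i \<in> poly_invariants G" "\<And>i. \<theta> i \<in> Inv"
  shows "(\<Sum>i\<in>A. c i *s \<theta> i) \<in> Inv"
  using assms by (simp add: Inv_def poly_invariants_def act_sum act_scale)

theorem free_basis_if_det:
  assumes \<theta>: "\<And>i. \<theta> i \<in> Inv" and D: "det (\<chi> i. \<theta> i) = PConst a * Q" "a \<noteq> 0"
  shows "free_basis (poly_invariants G) Inv \<theta>"
proof -
  have D0: "det (\<chi> i. \<theta> i) \<noteq> 0"
    using D Q_neq_0 by simp
  have "\<exists>c. (\<forall>i. c i \<in> poly_invariants G) \<and> \<eta> = (\<Sum>i\<in>UNIV. c i *s \<theta> i)" if \<eta>: "\<eta> \<in> Inv" for \<eta>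
  proof -
    have "\<exists>c. det (\<chi> k. (\<theta>(i := \<eta>)) k) = c * det (\<chi> i. \<theta> i)" for i
    proof -
      \<comment> \<open>Replacing one \<theta>_i by \<eta> leaves a family of invariants, so the new
        determinant is a multiple of \<open>Q\<close> and hence of the old one, \<open>a\<close>
        being a unit.\<close>
      have "Q dvd det (\<chi> k. (\<theta>(i := \<eta>)) k)"
        using \<theta> \<eta> by (intro Q_dvd_det) auto
      then obtain q where "det (\<chi> k. (\<theta>(i := \<eta>)) k) = Q * q" ..
      moreover have "PConst (1 / a) * PConst a = (1 :: ('a, 'n) poly_ring)"
        using D(2) by (simp flip: ring_homo.mult[OF ring_homo_PConst])
      ultimately have "det (\<chi> k. (\<theta>(i := \<eta>)) k) = (PConst (1 / a) * PConst a) * (Q * q)"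
        by (simp only: mult_1_left)
      then have "det (\<chi> k. (\<theta>(i := \<eta>)) k) = (PConst (1 / a) * q) * det (\<chi> i. \<theta> i)"
        unfolding D(1) by (simp only: mult_ac)
      then show ?thesis ..
    qed
    then obtain c where "\<And>i. det (\<chi> k. (\<theta>(i := \<eta>)) k) = c i * det (\<chi> i. \<theta> i)"
      by metis
    then have eq: "\<eta> = (\<Sum>i\<in>UNIV. c i *s \<theta> i)"
      by (rule cramer_idom[OF D0])
    \<comment> \<open>Applying g to the expansion of \<eta> gives another expansion of \<eta>;
      independence makes the coefficients agree.\<close>
    have "poly_act g (c i) = c i" if g: "g \<in> G" for g i
    proof -
      have "tensor_act \<rho> g \<eta> = (\<Sum>i\<in>UNIV. poly_act g (c i) *s \<theta> i)"
        using g \<theta> unfolding eq by (simp add: act_sum act_scale Inv_def)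
      then have "(\<Sum>i\<in>UNIV. (poly_act g (c i) - c i) *s \<theta> i) = 0"
        using g \<eta> eq by (simp add: Inv_def vector_sub_rdistrib sum_subtractf)
      then have "poly_act g (c i) - c i = 0"
        by (rule sum_scale_eq_0_imp[OF D0])
      then show ?thesis
        by simp
    qed
    then show ?thesis
      using eq by (intro exI[of _ c]) (simp add: poly_invariants_def)
  qed
  then have "Inv = {\<Sum>i\<in>UNIV. c i *s \<theta> i | c. \<forall>i. c i \<in> poly_invariants G}"
    using Inv_sum \<theta> by blast
  then show ?thesis
    using sum_scale_eq_0_imp[OF D0] unfolding free_basis_def by blast
qed

theorem det_iff_degree:
  assumes \<theta>: "\<And>i. \<theta> i \<in> Inv" "\<And>i. homogeneous (d i) (\<theta> i)"
  shows "(\<exists>a. a \<noteq> 0 \<and> det (\<chi> i. \<theta> i) = PConst a * Q) \<longleftrightarrow>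
    fract_independent \<theta> \<and> (\<Sum>i\<in>UNIV. d i) = (\<Sum>H\<in>refl_hyperplanes G. m H)"
proof -
  let ?D = "det (\<chi> i. \<theta> i)"
  have hom: "poly_homogeneous (\<Sum>i\<in>UNIV. d i) ?D"
    using \<theta>(2) by (intro poly_homogeneous_det) simp
  show ?thesis
  proof safe
    fix a
    assume a: "a \<noteq> 0" "?D = PConst a * Q"
    then have nz: "?D \<noteq> 0"
      using Q_neq_0 by simp
    then show "fract_independent \<theta>"
      by (simp add: fract_independent_iff_det)
    have "poly_homogeneous (\<Sum>H\<in>refl_hyperplanes G. m H) ?D"
      unfolding a(2) using poly_homogeneous_mult[OF poly_homogeneous_PConst Q_homogeneous] by simp
    then show "(\<Sum>i\<in>UNIV. d i) = (\<Sum>H\<in>refl_hyperplanes G. m H)"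
      using poly_deg_homogeneous[OF hom nz] poly_deg_homogeneous[OF _ nz] by simp
  next
    assume "fract_independent \<theta>" and deg: "(\<Sum>i\<in>UNIV. d i) = (\<Sum>H\<in>refl_hyperplanes G. m H)"
    then have nz: "?D \<noteq> 0"
      by (simp add: fract_independent_iff_det)
    obtain q where "?D = Q * q"
      using Q_dvd_det[of \<theta>, OF \<theta>(1)] unfolding dvd_def by blast
    then have q: "?D = q * Q"
      by (simp only: mult.commute)
    have "q \<noteq> 0"
      using nz q by auto
    moreover have "poly_homogeneous (\<Sum>H\<in>refl_hyperplanes G. m H) (q * Q)"
      using hom unfolding q deg .
    ultimately have "poly_homogeneous 0 q"
      using poly_homogeneous_factor(2)[OF _ Q_homogeneous Q_neq_0] by (metis diff_self_eq_0)
    then obtain a where "q = PConst a"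
      by (rule poly_homogeneous_0_const)
    then show "\<exists>a. a \<noteq> 0 \<and> ?D = PConst a * Q"
      using q \<open>q \<noteq> 0\<close> by auto
  qed
qed

end


section \<open>Free bases and the Saito determinant\<close>

lemma map_mat_mult: "ring_homo f \<Longrightarrow> map_mat f (A ** B) = map_mat f A ** map_mat f B"
  by (simp add: map_mat_def matrix_matrix_mult_def vec_eq_iff ring_homo.hsum ring_homo.mult)

lemma map_mat_1: "ring_homo f \<Longrightarrow> map_mat f (mat 1) = mat 1"
  by (simp add: map_mat_def mat_def vec_eq_iff ring_homo.one ring_homo.zero)

text \<open>For products over a stabiliser: with h the action it shows that the coefficients are
  invariant, with h an evaluation it computes their values at a point.\<close>

lemma ring_homo_coeff_prod_linear:
  assumes "ring_homo h"
  shows "h (coeff (\<Prod>x\<in>A. [:a x, 1:]) k) = coeff (\<Prod>x\<in>A. [:h (a x), 1:]) k"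
proof (induction A arbitrary: k rule: infinite_finite_induct)
  case (insert x A)
  then show ?case
    by (simp add: coeff_pCons ring_homo.add[OF assms] ring_homo.mult[OF assms] ring_homo.zero[OF assms]
        split: nat.split)
qed (auto simp: coeff_pCons one_pCons ring_homo.zero[OF assms] ring_homo.one[OF assms] split: nat.split)

definition geo_act :: "'a::field ^ 'n ^ 'n \<Rightarrow> 'a alg_closure ^ 'n \<Rightarrow> 'a alg_closure ^ 'n" where
  "geo_act g P = map_mat to_ac g *v P"

lemma geo_act_mult: "geo_act (g ** h) P = geo_act g (geo_act h P)"
  by (simp add: geo_act_def map_mat_mult[OF ring_homo_to_ac] matrix_vector_mul_assoc)

lemma geo_act_1 [simp]: "geo_act (mat 1) P = P"
  by (simp add: geo_act_def map_mat_1[OF ring_homo_to_ac])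

lemma peval_poly_act_to_ac:
  "peval to_ac (($) P) (poly_act g p) = peval to_ac (($) (geo_act (matrix_inv g) P)) p"
  by (simp add: peval_poly_act[OF ring_homo_to_ac] geo_act_def)

text \<open>Row i of g - 1, evaluated at P, is coordinate i of g P - P.\<close>

lemma rows_vanish_at_fixed_point:
  assumes "geo_act g P = P"
  shows "peval to_ac (($) P) (lin_form ((g - mat 1) $ i)) = 0"
proof -
  have "geo_act g P $ i = (\<Sum>j\<in>UNIV. to_ac (g $ i $ j) * P $ j)"
    by (simp add: geo_act_def map_mat_def matrix_vector_mult_def)
  moreover have "P $ i = (\<Sum>j\<in>UNIV. to_ac ((mat 1 :: 'a ^ 'b ^ 'b) $ i $ j) * P $ j)"
    by (simp add: mat_def if_distrib[of to_ac] if_zero_mult cong: if_cong)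
  ultimately show ?thesis
    using assms
    by (simp add: peval_lin_form ring_homo_to_ac left_diff_distrib sum_subtractf)
qed

context saito_data
begin

lemma G_invertible: "g \<in> G \<Longrightarrow> invertible g"
  and G_1: "mat 1 \<in> G"
  and G_mult: "g \<in> G \<Longrightarrow> h \<in> G \<Longrightarrow> g ** h \<in> G"
  and G_inv: "g \<in> G \<Longrightarrow> matrix_inv g \<in> G"
  using subgroup_GL_invertible[OF subgroup] subgroup_GL_1[OF subgroup]
    subgroup_GL_mult[OF subgroup] subgroup_GL_matrix_inv[OF subgroup] by auto

section \<open>Stabilisers and orbits of points over the algebraic closure\<close>

definition "stab P = {g\<in>G. geo_act g P = P}"
definition "orbit P = (\<lambda>g. geo_act g P) ` G"
definition "rep P Z = (SOME g. g \<in> G \<and> geo_act g P = Z)"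

lemma finite_stab: "finite (stab P)"
  using finite_G by (simp add: stab_def)

lemma finite_orbit: "finite (orbit P)"
  using finite_G by (simp add: orbit_def)

lemma P_in_orbit: "P \<in> orbit P"
  unfolding orbit_def using G_1 by (rule image_eqI[rotated]) simp

lemma rep:
  assumes "Z \<in> orbit P"
  shows "rep P Z \<in> G" "geo_act (rep P Z) P = Z"
proof -
  have "\<exists>g. g \<in> G \<and> geo_act g P = Z"
    using assms by (auto simp: orbit_def)
  from someI_ex[OF this] show "rep P Z \<in> G" "geo_act (rep P Z) P = Z"
    by (simp_all add: rep_def)
qed

lemma geo_act_inv [simp]:
  "g \<in> G \<Longrightarrow> geo_act (matrix_inv g) (geo_act g Z) = Z"
  "g \<in> G \<Longrightarrow> geo_act g (geo_act (matrix_inv g) Z) = Z"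
  by (simp_all add: matrix_inv G_invertible flip: geo_act_mult)

lemma stab_G: "g \<in> stab P \<Longrightarrow> g \<in> G"
  by (simp add: stab_def)

text \<open>The representative chosen for P itself need not be the identity, but it acts trivially
  on everything the stabiliser fixes.\<close>

lemma rep_self: "rep P P \<in> stab P"
  using rep[OF P_in_orbit] by (simp add: stab_def)

lemma stab_inv: "g \<in> stab P \<Longrightarrow> matrix_inv g \<in> stab P"
  using geo_act_inv(1)[of g P] by (simp add: stab_def G_inv)

lemma stab_mult: "g \<in> stab P \<Longrightarrow> h \<in> stab P \<Longrightarrow> g ** h \<in> stab P"
  by (simp add: stab_def G_mult geo_act_mult)

text \<open>
  Summing a vector fixed by the stabiliser over the orbit gives a relative transfer.
\<close>

lemma orbit_sum_Inv:
  assumes x: "\<And>g. g \<in> stab P \<Longrightarrow> tensor_act \<rho> g x = x"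
  shows "(\<Sum>Z\<in>orbit P. tensor_act \<rho> (rep P Z) x) \<in> Inv"
  unfolding Inv_def
proof safe
  fix h
  assume h: "h \<in> G"
  have move: "geo_act h Z \<in> orbit P" if "Z \<in> orbit P" "h \<in> G" for Z h
    using that by (auto simp: orbit_def G_mult simp flip: geo_act_mult)
  have step: "tensor_act \<rho> h (tensor_act \<rho> (rep P Z) x) = tensor_act \<rho> (rep P (geo_act h Z)) x"
    if Z: "Z \<in> orbit P" for Z
  proof -
    let ?r = "rep P (geo_act h Z)" and ?s = "h ** rep P Z"
    have r: "?r \<in> G" "geo_act ?r P = geo_act h Z"
      using rep[OF move[OF Z h]] by auto
    have s: "?s \<in> G" "geo_act ?s P = geo_act h Z"
      using rep[OF Z] h by (simp_all add: G_mult geo_act_mult)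
    \<comment> \<open>Both \<open>?r\<close> and \<open>?s\<close> carry P to h Z, so they differ by
      an element of the stabiliser, which fixes x.\<close>
    let ?k = "matrix_inv ?r ** ?s"
    have "?k \<in> stab P"
      using r s by (simp add: stab_def G_mult G_inv geo_act_mult[of "matrix_inv ?r"])
        (metis geo_act_inv(1))
    moreover have "?r ** ?k = ?s"
      by (simp only: matrix_mul_assoc matrix_inv[OF G_invertible[OF r(1)]] matrix_mul_lid)
    ultimately have "tensor_act \<rho> ?s x = tensor_act \<rho> ?r x"
      using x[of ?k] act_mult[of ?r ?k x] r s by (simp add: G_invertible G_mult G_inv)
    then show ?thesis
      using act_mult[of h "rep P Z" x] h rep[OF Z] by (simp add: G_invertible)
  qed
  have "tensor_act \<rho> h (\<Sum>Z\<in>orbit P. tensor_act \<rho> (rep P Z) x) =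
      (\<Sum>Z\<in>orbit P. tensor_act \<rho> (rep P (geo_act h Z)) x)"
    by (simp add: act_sum step)
  also have "\<dots> = (\<Sum>Z\<in>orbit P. tensor_act \<rho> (rep P Z) x)"
    by (rule sum.reindex_bij_witness[of _ "geo_act (matrix_inv h)" "geo_act h"])
      (use h move G_inv in auto)
  finally show "tensor_act \<rho> h (\<Sum>Z\<in>orbit P. tensor_act \<rho> (rep P Z) x) =
      (\<Sum>Z\<in>orbit P. tensor_act \<rho> (rep P Z) x)" .
qed

text \<open>
  The coefficients of \<open>\<Prod>s\<in>stab P. (t - s x\<^sub>i)\<close> are invariants which separate \<open>P\<close> from every other
  point: at \<open>P\<close> the polynomial is a power of \<open>t - P\<^sub>i\<close>, at \<open>P'\<close> it has the root \<open>P'\<^sub>i\<close>.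
\<close>

lemma stab_invariant_separates:
  assumes "P' \<noteq> P"
  obtains a where "\<And>g. g \<in> stab P \<Longrightarrow> poly_act g a = a"
    and "peval to_ac (($) P') a \<noteq> peval to_ac (($) P) a"
proof -
  obtain i where i: "P' $ i \<noteq> P $ i"
    using assms by (auto simp: vec_eq_iff)
  let ?f = "\<Prod>s\<in>stab P. [:- poly_act s (PVar i), 1:]"
  have inv: "poly_act g (coeff ?f k) = coeff ?f k" if g: "g \<in> stab P" for g k
  proof -
    have "poly_act g (coeff ?f k) = coeff (\<Prod>s\<in>stab P. [:poly_act g (- poly_act s (PVar i)), 1:]) k"
      by (rule ring_homo_coeff_prod_linear[OF ring_homo_poly_act])
    also have "\<dots> = coeff (\<Prod>s\<in>stab P. [:- poly_act (g ** s) (PVar i), 1:]) k"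
      using g by (simp add: ring_homo.uminus[OF ring_homo_poly_act] poly_act_mult G_invertible stab_G)
    also have "(\<Prod>s\<in>stab P. [:- poly_act (g ** s) (PVar i), 1:]) = ?f"
    proof (rule prod.reindex_bij_witness[of _ "\<lambda>s. matrix_inv g ** s" "\<lambda>s. g ** s"])
      fix s
      show "matrix_inv g ** (g ** s) = s" "g ** (matrix_inv g ** s) = s"
        using g by (simp_all only: matrix_mul_assoc matrix_inv[OF G_invertible[OF stab_G]] matrix_mul_lid)
    qed (use g stab_mult stab_inv in auto)
    finally show ?thesis .
  qed
  have "\<exists>k. peval to_ac (($) P') (coeff ?f k) \<noteq> peval to_ac (($) P) (coeff ?f k)"
  proof (rule ccontr)
    assume "\<not> ?thesis"
    then have eq: "peval to_ac (($) P') (coeff ?f k) = peval to_ac (($) P) (coeff ?f k)" for k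
      by simp
    have pe: "peval to_ac (($) Z) (coeff ?f k) =
        coeff (\<Prod>s\<in>stab P. [:- (geo_act (matrix_inv s) Z) $ i, 1:]) k" for Z k
      by (subst ring_homo_coeff_prod_linear[OF ring_homo_peval[OF ring_homo_to_ac]])
        (simp add: ring_homo.uminus[OF ring_homo_peval[OF ring_homo_to_ac]] peval_poly_act_to_ac
          peval_PVar[OF ring_homo_to_ac])
    have "(\<Prod>s\<in>stab P. [:- (geo_act (matrix_inv s) P') $ i, 1:]) =
        (\<Prod>s\<in>stab P. [:- (geo_act (matrix_inv s) P) $ i, 1:])"
      using eq unfolding pe by (intro poly_eqI) simp
    then have "poly (\<Prod>s\<in>stab P. [:- (geo_act (matrix_inv s) P') $ i, 1:]) (P' $ i) =
        poly (\<Prod>s\<in>stab P. [:- (geo_act (matrix_inv s) P) $ i, 1:]) (P' $ i)"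
      by simp
    moreover have "poly (\<Prod>s\<in>stab P. [:- (geo_act (matrix_inv s) P') $ i, 1:]) (P' $ i) = 0"
      using finite_stab G_1 by (auto simp: poly_prod stab_def intro!: bexI[of _ "mat 1"])
    moreover have "geo_act (matrix_inv s) P = P" if "s \<in> stab P" for s
      using stab_inv[OF that] by (simp add: stab_def)
    then have "poly (\<Prod>s\<in>stab P. [:- (geo_act (matrix_inv s) P) $ i, 1:]) (P' $ i) \<noteq> 0"
      using finite_stab i by (simp add: poly_prod)
    ultimately show False
      by simp
  qed
  then show ?thesis
    using that inv by blast
qed

text \<open>
  The weights \<open>\<alpha>\<close> on the orbit for which the weighted orbit sums of stabiliser-invariant vectors,
  restricted to the line, stay in the span of the \<open>\<theta> i\<close>. Stabiliser invariants \<open>a\<close> have coefficients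
  in the base field, but products of factors \<open>a - c\<close> with \<open>c\<close> in the algebraic closure are admitted too,
  so no descent of fields is needed.
\<close>

definition "span_weight \<theta> P u \<alpha> \<longleftrightarrow>
  (\<forall>x. (\<forall>g\<in>stab P. tensor_act \<rho> g x = x) \<longrightarrow>
    (\<exists>\<gamma>. \<forall>i. (\<Sum>Z\<in>orbit P. \<alpha> Z * eval_line P u (tensor_act \<rho> (rep P Z) x $ i)) =
      (\<Sum>k\<in>UNIV. \<gamma> k * eval_line P u (\<theta> k $ i))))"

text \<open>With constant weight the sum is the relative transfer, an element of \<open>Inv\<close>,
  which the basis expands.\<close>

lemma span_weight_1:
  assumes "free_basis (poly_invariants G) Inv \<theta>"
  shows "span_weight \<theta> P u (\<lambda>Z. 1)"
  unfolding span_weight_def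
proof (intro allI impI)
  fix x
  assume "\<forall>g\<in>stab P. tensor_act \<rho> g x = x"
  then have "(\<Sum>Z\<in>orbit P. tensor_act \<rho> (rep P Z) x) \<in> Inv"
    by (intro orbit_sum_Inv) auto
  then obtain c where c: "(\<Sum>Z\<in>orbit P. tensor_act \<rho> (rep P Z) x) = (\<Sum>k\<in>UNIV. c k *s \<theta> k)"
    using assms by (auto simp: free_basis_def)
  have "(\<Sum>Z\<in>orbit P. 1 * eval_line P u (tensor_act \<rho> (rep P Z) x $ i)) =
      (\<Sum>k\<in>UNIV. eval_line P u (c k) * eval_line P u (\<theta> k $ i))" for i
    using arg_cong[OF c, of "\<lambda>y. eval_line P u (y $ i)"]
    by (simp add: ring_homo.hsum[OF ring_homo_eval_line] ring_homo.mult[OF ring_homo_eval_line])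
  then show "\<exists>\<gamma>. \<forall>i. (\<Sum>Z\<in>orbit P. 1 * eval_line P u (tensor_act \<rho> (rep P Z) x $ i)) =
      (\<Sum>k\<in>UNIV. \<gamma> k * eval_line P u (\<theta> k $ i))"
    by (intro exI[of _ "\<lambda>k. eval_line P u (c k)"]) blast
qed

text \<open>With x also a x is fixed by the stabiliser, and its translate by \<open>rep P Z\<close>
  is that of x times that of a. Subtracting c times the relation for x multiplies the weight by the
  translate of a minus c.\<close>

lemma span_weight_mult:
  assumes \<alpha>: "span_weight \<theta> P u \<alpha>" and a: "\<And>g. g \<in> stab P \<Longrightarrow> poly_act g a = a"
  shows "span_weight \<theta> P u (\<lambda>Z. \<alpha> Z * (eval_line P u (poly_act (rep P Z) a) - c))"
  unfolding span_weight_def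
proof (intro allI impI)
  fix x
  assume x: "\<forall>g\<in>stab P. tensor_act \<rho> g x = x"
  let ?e = "eval_line P u"
  let ?S = "\<lambda>x i. \<Sum>Z\<in>orbit P. \<alpha> Z * ?e (tensor_act \<rho> (rep P Z) x $ i)"
  obtain \<gamma> where \<gamma>: "\<And>i. ?S x i = (\<Sum>k\<in>UNIV. \<gamma> k * ?e (\<theta> k $ i))"
    using \<alpha> x unfolding span_weight_def by blast
  have "\<forall>g\<in>stab P. tensor_act \<rho> g (a *s x) = a *s x"
    using x a by (simp add: act_scale)
  then obtain \<gamma>' where \<gamma>': "\<And>i. ?S (a *s x) i = (\<Sum>k\<in>UNIV. \<gamma>' k * ?e (\<theta> k $ i))"
    using \<alpha> unfolding span_weight_def by blast
  have "(\<Sum>Z\<in>orbit P. \<alpha> Z * (?e (poly_act (rep P Z) a) - c) * ?e (tensor_act \<rho> (rep P Z) x $ i)) =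
      (\<Sum>k\<in>UNIV. (\<gamma>' k - c * \<gamma> k) * ?e (\<theta> k $ i))" for i
  proof -
    have "(\<Sum>Z\<in>orbit P. \<alpha> Z * (?e (poly_act (rep P Z) a) - c) * ?e (tensor_act \<rho> (rep P Z) x $ i)) =
        ?S (a *s x) i - c * ?S x i"
      by (simp add: act_scale ring_homo.mult[OF ring_homo_eval_line] sum_distrib_left algebra_simps
          flip: sum_subtractf)
    also have "\<dots> = (\<Sum>k\<in>UNIV. (\<gamma>' k - c * \<gamma> k) * ?e (\<theta> k $ i))"
      unfolding \<gamma> \<gamma>' by (simp add: sum_distrib_left sum_subtractf left_diff_distrib mult.assoc)
    finally show ?thesis .
  qed
  then show "\<exists>\<gamma>. \<forall>i. (\<Sum>Z\<in>orbit P. \<alpha> Z * (?e (poly_act (rep P Z) a) - c) * ?e (tensor_act \<rho> (rep P Z) x $ i)) =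
      (\<Sum>k\<in>UNIV. \<gamma> k * ?e (\<theta> k $ i))"
    by (intro exI[of _ "\<lambda>k. \<gamma>' k - c * \<gamma> k"]) blast
qed

text \<open>One factor for each other point of the orbit, vanishing there but not at P; the k-th
  power gives the order.\<close>

lemma span_weight_concentrated:
  assumes "free_basis (poly_invariants G) Inv \<theta>"
  obtains \<alpha> where "span_weight \<theta> P u \<alpha>" "poly (\<alpha> P) 0 \<noteq> 0"
    "\<And>Z. Z \<in> orbit P \<Longrightarrow> Z \<noteq> P \<Longrightarrow> [:0, 1:] ^ k dvd \<alpha> Z"
proof -
  let ?e = "eval_line P u"
  have "\<exists>a. (\<forall>g\<in>stab P. poly_act g a = a) \<and>
      peval to_ac (($) (geo_act (matrix_inv (rep P Y)) P)) a \<noteq> peval to_ac (($) P) a"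
    if Y: "Y \<in> orbit P - {P}" for Y
  proof -
    have "geo_act (matrix_inv (rep P Y)) P \<noteq> P"
      using rep[of Y P] Y geo_act_inv(2)[of "rep P Y" P] by (metis Diff_iff singletonI)
    from stab_invariant_separates[OF this] show ?thesis
      by metis
  qed
  then obtain a where a: "\<And>Y g. Y \<in> orbit P - {P} \<Longrightarrow> g \<in> stab P \<Longrightarrow> poly_act g (a Y) = a Y"
    and neq: "\<And>Y. Y \<in> orbit P - {P} \<Longrightarrow>
      peval to_ac (($) (geo_act (matrix_inv (rep P Y)) P)) (a Y) \<noteq> peval to_ac (($) P) (a Y)"
    by metis
  \<comment> \<open>At t = 0 the translate of \<open>a Y\<close> by \<open>rep P Z\<close> takes the
    value of \<open>a Y\<close> at the point \<open>rep P Z\<close> inverse applied to P. For Z = Y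
    this is \<open>b Y\<close>; for Z = P it is the value at P, which differs.\<close>
  define b where "b Y = peval to_ac (($) (geo_act (matrix_inv (rep P Y)) P)) (a Y)" for Y
  define \<beta> where "\<beta> Y Z = ?e (poly_act (rep P Z) (a Y)) - [:b Y:]" for Y Z
  define \<alpha> where "\<alpha> Z = (\<Prod>Y\<in>orbit P - {P}. \<beta> Y Z ^ k)" for Z
  have pow: "span_weight \<theta> P u (\<lambda>Z. \<alpha> Z * \<beta> Y Z ^ j)"
    if "span_weight \<theta> P u \<alpha>" "Y \<in> orbit P - {P}" for \<alpha> Y j
  proof (induction j)
    case (Suc j)
    have "span_weight \<theta> P u (\<lambda>Z. (\<alpha> Z * \<beta> Y Z ^ j) * \<beta> Y Z)"
      unfolding \<beta>_def by (rule span_weight_mult) (use Suc a that in \<open>auto simp: \<beta>_def\<close>)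
    then show ?case
      by (simp add: mult_ac)
  qed (use that in simp)
  have "span_weight \<theta> P u (\<lambda>Z. \<Prod>Y\<in>A. \<beta> Y Z ^ k)" if "finite A" "A \<subseteq> orbit P - {P}" for A
    using that
  proof (induction A rule: finite_induct)
    case empty
    then show ?case
      using span_weight_1[OF assms] by simp
  next
    case (insert Y A)
    then have "span_weight \<theta> P u (\<lambda>Z. (\<Prod>Y\<in>A. \<beta> Y Z ^ k) * \<beta> Y Z ^ k)"
      by (intro pow) auto
    then show ?case
      using insert by (simp add: mult.commute)
  qed
  from this[of "orbit P - {P}"] have "span_weight \<theta> P u \<alpha>"
    unfolding \<alpha>_def using finite_orbit by simp
  moreover have "poly (\<alpha> P) 0 \<noteq> 0"
  proof -
    have "poly (\<beta> Y P) 0 \<noteq> 0" if Y: "Y \<in> orbit P - {P}" for Y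
      using neq[OF Y] a[OF Y rep_self] by (simp add: \<beta>_def b_def poly_eval_line)
    then show ?thesis
      using finite_orbit by (simp add: \<alpha>_def poly_prod)
  qed
  moreover have "[:0, 1:] ^ k dvd \<alpha> Z" if Z: "Z \<in> orbit P" "Z \<noteq> P" for Z
  proof -
    have "poly (\<beta> Z Z) 0 = 0"
      by (simp add: \<beta>_def b_def poly_eval_line peval_poly_act_to_ac)
    then have "[:0, 1:] ^ k dvd \<beta> Z Z ^ k"
      by (intro dvd_power_same) (simp add: poly_eq_0_iff_dvd)
    also have "\<dots> dvd \<alpha> Z"
      unfolding \<alpha>_def using Z finite_orbit by (intro dvd_prodI) auto
    finally show ?thesis .
  qed
  ultimately show ?thesis
    by (rule that)
qed

text \<open>The weighted sums \<open>N\<close> are combinations of the \<theta>_k on the line, so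
  det \<theta> divides det N there. Modulo t^(r + 1) only the term at P survives, and its weight is
  nonzero at t = 0; thus det N has order exactly r, as det \<eta> does.\<close>

lemma order_det_eval_line:
  assumes basis: "free_basis (poly_invariants G) Inv \<theta>"
    and \<eta>: "\<And>g i. g \<in> stab P \<Longrightarrow> tensor_act \<rho> g (\<eta> i) = \<eta> i"
    and det: "eval_line P u (det (\<chi> i. \<eta> i)) = [:c:] * [:0, 1:] ^ r" "c \<noteq> 0"
  shows "\<not> [:0, 1:] ^ Suc r dvd eval_line P u (det (\<chi> i. \<theta> i))"
proof
  let ?e = "eval_line P u" and ?X = "[:0, 1 :: 'a alg_closure:]"
  assume dvd: "?X ^ Suc r dvd ?e (det (\<chi> i. \<theta> i))"
  obtain \<alpha> where \<alpha>: "span_weight \<theta> P u \<alpha>" "poly (\<alpha> P) 0 \<noteq> 0"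
    "\<And>Z. Z \<in> orbit P \<Longrightarrow> Z \<noteq> P \<Longrightarrow> ?X ^ Suc r dvd \<alpha> Z"
    using span_weight_concentrated[OF basis, of P u "Suc r"] by blast
  define N where "N j i = (\<Sum>Z\<in>orbit P. \<alpha> Z * ?e (tensor_act \<rho> (rep P Z) (\<eta> j) $ i))" for j i
  have "\<forall>j. \<exists>\<gamma>. \<forall>i. N j i = (\<Sum>k\<in>UNIV. \<gamma> k * ?e (\<theta> k $ i))"
    using \<alpha>(1) \<eta> unfolding span_weight_def N_def by blast
  from choice[OF this] obtain \<gamma> where "\<forall>j i. N j i = (\<Sum>k\<in>UNIV. \<gamma> j k * ?e (\<theta> k $ i))" ..
  then have \<gamma>: "N j i = (\<Sum>k\<in>UNIV. \<gamma> j k * ?e (\<theta> k $ i))" for j i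
    by blast
  have "(\<chi> j i. N j i) = (\<chi> j k. \<gamma> j k) ** (\<chi> k i. ?e (\<theta> k $ i))"
    by (simp add: \<gamma> matrix_matrix_mult_def vec_eq_iff)
  then have "det (\<chi> j i. N j i) = det (\<chi> j k. \<gamma> j k) * ?e (det (\<chi> i. \<theta> i))"
    by (simp add: det_mul ring_homo.det[OF ring_homo_eval_line])
  then have N: "?X ^ Suc r dvd det (\<chi> j i. N j i)"
    using dvd by simp
  have "?X ^ Suc r dvd N j i - \<alpha> P * ?e (\<eta> j $ i)" for j i
  proof -
    have "N j i = \<alpha> P * ?e (\<eta> j $ i) +
        (\<Sum>Z\<in>orbit P - {P}. \<alpha> Z * ?e (tensor_act \<rho> (rep P Z) (\<eta> j) $ i))"
      unfolding N_def by (subst sum.remove[OF finite_orbit P_in_orbit]) (simp add: \<eta> rep_self)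
    moreover have "?X ^ Suc r dvd (\<Sum>Z\<in>orbit P - {P}. \<alpha> Z * ?e (tensor_act \<rho> (rep P Z) (\<eta> j) $ i))"
      using \<alpha>(3) by (intro dvd_sum dvd_mult2) auto
    ultimately show ?thesis
      by simp
  qed
  then have "?X ^ Suc r dvd det (\<chi> j i. N j i) - det (\<chi> j i. \<alpha> P * ?e (\<eta> j $ i))"
    by (intro dvd_diff_det) simp
  moreover have "det (\<chi> j i. \<alpha> P * ?e (\<eta> j $ i)) = \<alpha> P ^ CARD('n) * ?e (det (\<chi> i. \<eta> i))"
  proof -
    have "(\<chi> j i. \<alpha> P * ?e (\<eta> j $ i)) = (\<chi> j. \<alpha> P *s (\<chi> i. ?e (\<eta> j $ i)))"
      by (simp add: vec_eq_iff)
    then show ?thesis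
      by (simp add: det_rows_mul ring_homo.det[OF ring_homo_eval_line])
  qed
  ultimately have "?X ^ Suc r dvd \<alpha> P ^ CARD('n) * ([:c:] * ?X ^ r)"
    using N det(1) dvd_diffD by (metis dvd_diff_right_iff)
  then have "?X ^ r * ?X dvd ?X ^ r * (\<alpha> P ^ CARD('n) * [:c:])"
    by (simp only: mult_ac power_Suc)
  then have "?X dvd \<alpha> P ^ CARD('n) * [:c:]"
    by (simp only: dvd_mult_cancel_left) simp
  then have "poly (\<alpha> P ^ CARD('n) * [:c:]) 0 = 0"
    by (subst poly_eq_0_iff_dvd) (simp only: minus_zero)
  then show False
    using \<alpha>(2) det(2) by simp
qed

text \<open>The rows of g - 1 are the multiples w_i l_H for the root vector w, and some w_i is
  nonzero.\<close>

lemma reflection_fixing_point: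
  assumes g: "g \<in> G" "reflection_about H g" "geo_act g P = P"
  shows "peval to_ac (($) P) (lin_form (l H)) = 0"
proof -
  have H: "H \<in> refl_hyperplanes G"
    using g by (auto simp: refl_hyperplanes_def)
  obtain w where w: "root_vector (l H) g w"
    using root_vector_exists[OF l_neq_0[OF H], of g] kernel[OF H] g by (auto simp: reflection_about_def)
  have "w \<noteq> 0"
    using root_vector_eq_0_iff[OF l_neq_0[OF H] w] g by (simp add: reflection_about_def)
  then obtain i where i: "w $ i \<noteq> 0"
    by (auto simp: vec_eq_iff)
  have "peval to_ac (($) P) (lin_form ((g - mat 1) $ i)) = 0"
    using rows_vanish_at_fixed_point[OF g(3)] .
  then show ?thesis
    unfolding root_vector_row[OF w]
    using i by (simp add: lin_form_scale peval_mult[OF ring_homo_to_ac] peval_PConst[OF ring_homo_to_ac])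
qed

theorem det_if_free_basis:
  assumes \<theta>: "\<And>i. \<theta> i \<in> Inv" "\<And>i. homogeneous (d i) (\<theta> i)"
    and basis: "free_basis (poly_invariants G) Inv \<theta>"
  shows "\<exists>a. a \<noteq> 0 \<and> det (\<chi> i. \<theta> i) = PConst a * Q"
proof (rule ccontr)
  assume contra: "\<not> ?thesis"
  let ?D = "det (\<chi> i. \<theta> i)"
  obtain c where "?D = Q * c"
    using Q_dvd_det[of \<theta>, OF \<theta>(1)] unfolding dvd_def by blast
  then have c: "?D = c * Q"
    by (simp only: mult.commute)
  \<comment> \<open>A positive degree is what produces a zero. The zero polynomial is homogeneous of
    every degree, so 1 is a valid choice for c = 0.\<close>
  have "\<exists>k>0. poly_homogeneous k c"
  proof (cases "c = 0")
    case True
    then show ?thesis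
      by (intro exI[of _ 1]) simp
  next
    case False
    have "poly_homogeneous (\<Sum>i\<in>UNIV. d i) (c * Q)"
      unfolding c[symmetric] using \<theta>(2) by (intro poly_homogeneous_det) simp
    then obtain k where k: "poly_homogeneous k c"
      using poly_homogeneous_factor(2)[OF _ Q_homogeneous Q_neq_0 False] by blast
    moreover have "k \<noteq> 0"
    proof
      assume "k = 0"
      then obtain a where "c = PConst a"
        using k poly_homogeneous_0_const by blast
      then show False
        using contra c False by auto
    qed
    ultimately show ?thesis
      by blast
  qed
  then obtain k where k: "k > 0" "poly_homogeneous k c"
    by blast
  \<comment> \<open>\<open>Y1\<close> makes the reflecting hyperplane through P unique.
    \<open>Y2\<close> collects pairs of nonproportional rows of g - 1; both would vanish at P if g
    fixed P.\<close>
  define Y1 where "Y1 = (\<lambda>(H, H'). (l H, l H')) `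
    {(H, H'). H \<in> refl_hyperplanes G \<and> H' \<in> refl_hyperplanes G \<and> H \<noteq> H'}"
  define Y2 where "Y2 = {y \<in> (\<lambda>(g, i, j). ((g - mat 1) $ i, (g - mat 1) $ j)) ` (G \<times> UNIV).
    fst y \<noteq> 0 \<and> (\<forall>a. snd y \<noteq> a *s fst y)}"
  have "finite Y1"
    unfolding Y1_def
    by (rule finite_imageI, rule finite_subset[of _ "refl_hyperplanes G \<times> refl_hyperplanes G"])
      (auto simp: finite_refl_hyperplanes)
  moreover have "finite Y2"
    unfolding Y2_def using finite_G by auto
  ultimately have "finite (Y1 \<union> Y2)"
    by simp
  moreover have "fst y \<noteq> 0 \<and> (\<forall>a. snd y \<noteq> a *s fst y)" if "y \<in> Y1 \<union> Y2" for y
  proof (cases "y \<in> Y1")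
    case True
    then obtain H H' where H: "y = (l H, l H')" "H \<in> refl_hyperplanes G" "H' \<in> refl_hyperplanes G" "H \<noteq> H'"
      by (auto simp: Y1_def)
    show ?thesis
      unfolding H(1) fst_conv snd_conv using l_neq_0[OF H(2)] l_not_multiple[OF H(2-4)] by blast
  qed (use that in \<open>auto simp: Y2_def\<close>)
  ultimately obtain P where P: "peval to_ac (($) P) c = 0"
    and general: "\<And>y. y \<in> Y1 \<union> Y2 \<Longrightarrow>
      peval to_ac (($) P) (lin_form (fst y)) \<noteq> 0 \<or> peval to_ac (($) P) (lin_form (snd y)) \<noteq> 0"
    using exists_zero_in_general_position[OF k(2,1), of "Y1 \<union> Y2"] by metis
  have unique: "H = H'"
    if "H \<in> refl_hyperplanes G" "H' \<in> refl_hyperplanes G"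
      "peval to_ac (($) P) (lin_form (l H)) = 0" "peval to_ac (($) P) (lin_form (l H')) = 0" for H H'
    using general[of "(l H, l H')"] that by (force simp: Y1_def)
  have reflection: "\<exists>H. reflection_about H g" if g: "g \<in> stab P" "g \<noteq> mat 1" for g
  proof (rule ccontr)
    assume "\<nexists>H. reflection_about H g"
    then obtain i j where ij: "(g - mat 1) $ i \<noteq> 0" "\<And>a. (g - mat 1) $ j \<noteq> a *s (g - mat 1) $ i"
      using not_reflection_rows[of g] g(2) G_invertible[OF stab_G[OF g(1)]] by blast
    have "((g - mat 1) $ i, (g - mat 1) $ j) \<in> Y2"
      unfolding Y2_def using ij stab_G[OF g(1)]
      by (auto intro!: image_eqI[of _ _ "(g, i, j)"] simp del: vector_minus_component)
    then show False
      using general rows_vanish_at_fixed_point[of g P] g(1) unfolding stab_def by fastforce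
  qed
  have "\<exists>u \<eta> b r. b \<noteq> 0 \<and> (\<forall>g\<in>stab P. \<forall>i. tensor_act \<rho> g (\<eta> i) = \<eta> i) \<and>
      eval_line P u (det (\<chi> i. \<eta> i)) = [:b:] * [:0, 1:] ^ r \<and> [:0, 1:] ^ r dvd eval_line P u Q"
  proof (cases "\<exists>H\<in>refl_hyperplanes G. peval to_ac (($) P) (lin_form (l H)) = 0")
    case True
    then obtain H where H: "H \<in> refl_hyperplanes G" "peval to_ac (($) P) (lin_form (l H)) = 0"
      by blast
    have "lin_form (l H) \<noteq> 0"
      using l_neq_0[OF H(1)] by simp
    \<comment> \<open>The line must be transverse to H, so that l_H restricts to a nonzero multiple
      of t.\<close>
    then obtain u where u: "peval to_ac (($) u) (lin_form (l H)) \<noteq> 0"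
      by (rule exists_peval_neq_0[OF ring_homo_to_ac infinite_alg_closure])
    let ?t = "peval to_ac (($) u) (lin_form (l H))"
    have line: "eval_line P u (lin_form (l H)) = [:?t:] * [:0, 1:]"
      by (simp add: eval_line_lin_form H(2))
    obtain \<eta> a where \<eta>: "a \<noteq> 0" "det (\<chi> i. \<eta> i) = PConst a * lin_form (l H) ^ m H"
      "\<And>g i. g \<in> G \<Longrightarrow> \<forall>v\<in>H. g *v v = v \<Longrightarrow> tensor_act \<rho> g (\<eta> i) = \<eta> i"
      using upper[OF H(1)] by blast
    have "tensor_act \<rho> g (\<eta> i) = \<eta> i" if g: "g \<in> stab P" for g i
    proof (rule \<eta>(3)[OF stab_G[OF g]])
      show "\<forall>v\<in>H. g *v v = v"
      proof (cases "g = mat 1")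
        case False
        then obtain H' where H': "reflection_about H' g"
          using reflection g by blast
        then have "H' \<in> refl_hyperplanes G"
          using stab_G[OF g] by (auto simp: refl_hyperplanes_def)
        moreover have "peval to_ac (($) P) (lin_form (l H')) = 0"
          using g H' by (intro reflection_fixing_point[of g]) (auto simp: stab_def)
        ultimately have "H' = H"
          using unique H by blast
        then show ?thesis
          using H' by (simp add: reflection_about_def)
      qed simp
    qed
    moreover have "eval_line P u (det (\<chi> i. \<eta> i)) = [:to_ac a * ?t ^ m H:] * [:0, 1:] ^ m H"
    proof -
      have "eval_line P u (PConst a) = [:to_ac a:]"
        by (simp add: eval_line_def peval_PConst ring_homo_const_poly ring_homo_to_ac)
      then have "eval_line P u (det (\<chi> i. \<eta> i)) = [:to_ac a:] * [:?t:] ^ m H * [:0, 1:] ^ m H"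
        unfolding \<eta>(2) ring_homo.mult[OF ring_homo_eval_line] ring_homo.power[OF ring_homo_eval_line] line
        by (simp only: power_mult_distrib mult.assoc)
      then show ?thesis
        by (simp add: poly_const_pow mult.commute)
    qed
    moreover have "[:0, 1:] ^ m H dvd eval_line P u Q"
    proof -
      have "[:0, 1:] ^ m H dvd eval_line P u (lin_form (l H)) ^ m H"
        unfolding line by (intro dvd_power_same dvd_triv_right)
      also have "\<dots> dvd eval_line P u Q"
        unfolding Q_def ring_homo.hprod[OF ring_homo_eval_line] ring_homo.power[OF ring_homo_eval_line]
        using H(1) finite_refl_hyperplanes by (intro dvd_prodI) auto
      finally show ?thesis .
    qed
    moreover have "to_ac a * ?t ^ m H \<noteq> 0"
      using u \<eta>(1) by simp
    ultimately show ?thesis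
      by blast
  next
    case False
    \<comment> \<open>A nontrivial element of the stabiliser would be a reflection whose hyperplane
      contains P. With trivial stabiliser the constant basis vectors are admissible; their
      determinant is 1, so r = 0 and even the degenerate direction 0 suffices.\<close>
    then have "g = mat 1" if "g \<in> stab P" for g
      using that reflection[OF that] reflection_fixing_point[of g _ P]
      by (fastforce simp: stab_def refl_hyperplanes_def)
    then have "\<forall>g\<in>stab P. \<forall>i. tensor_act \<rho> g (axis i 1) = axis i 1"
      using act_1 by metis
    moreover have "(\<chi> i. axis i 1) = (mat 1 :: ((('a, 'n) poly_ring, 'n) vec, 'n) vec)"
      by (simp add: vec_eq_iff mat_def axis_def eq_commute)
    then have "eval_line P 0 (det (\<chi> i::'n. axis i 1)) = [:1:] * [:0, 1:] ^ 0"
      by (simp add: ring_homo.one[OF ring_homo_eval_line])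
    moreover have "[:0, 1:] ^ 0 dvd eval_line P 0 Q"
      by simp
    ultimately show ?thesis
      by (metis zero_neq_one)
  qed
  then obtain u \<eta> b r where *: "b \<noteq> 0" "\<And>g i. g \<in> stab P \<Longrightarrow> tensor_act \<rho> g (\<eta> i) = \<eta> i"
    "eval_line P u (det (\<chi> i. \<eta> i)) = [:b:] * [:0, 1:] ^ r" "[:0, 1:] ^ r dvd eval_line P u Q"
    by blast
  have "poly (eval_line P u c) 0 = 0"
    using P by (simp add: poly_eval_line)
  then have "[:0, 1:] dvd eval_line P u c"
    by (simp add: poly_eq_0_iff_dvd)
  then have "[:0, 1:] ^ Suc r dvd eval_line P u ?D"
    unfolding c ring_homo.mult[OF ring_homo_eval_line] power_Suc using *(4) by (rule mult_dvd_mono)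
  then show False
    using order_det_eval_line[OF basis *(2,3,1)] by blast
qed

end

lemma root_vector_unique:
  assumes "\<phi> \<noteq> 0" "root_vector \<phi> s w" "root_vector \<phi> s w'"
  shows "w = w'"
proof -
  obtain v where v: "dual_apply \<phi> v = 1"
    using dual_apply_eq_1[OF assms(1)] .
  have "v + 1 *s w = v + 1 *s w'"
    using assms(2,3) v unfolding root_vector_def by metis
  then show ?thesis
    by simp
qed

section \<open>The pointwise stabiliser of a reflecting hyperplane\<close>

text \<open>A basis of W is extended to one of the kernel of \<phi> and completed by v0;
  \<open>Y\<close> is the dual basis. The index set \<open>J\<close> marks the vectors from W, and
  \<phi> is the dual vector of v0.\<close>

lemma adapted_basis:
  fixes \<phi> v0 :: "'a::field ^ 'n"
  assumes v0: "dual_apply \<phi> v0 = 1" and W: "vec.subspace W" "\<And>w. w \<in> W \<Longrightarrow> dual_apply \<phi> w = 0"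
  obtains B Y :: "'n \<Rightarrow> 'a ^ 'n" and i0 J
  where "\<And>k j. dual_apply (Y k) (B j) = (if k = j then 1 else 0)" "B i0 = v0" "Y i0 = \<phi>"
    "i0 \<notin> J" "card J = vec.dim W" "\<And>j. j \<in> J \<Longrightarrow> B j \<in> W"
    "\<And>k w. k \<notin> J \<Longrightarrow> w \<in> W \<Longrightarrow> dual_apply (Y k) w = 0"
proof -
  let ?K = "{v. dual_apply \<phi> v = 0}"
  obtain C where C: "C \<subseteq> W" "vec.independent C" "W \<subseteq> vec.span C" "card C = vec.dim W"
    using vec.basis_exists .
  have "C \<subseteq> ?K"
    using C(1) W(2) by auto
  then obtain C' where C': "C \<subseteq> C'" "C' \<subseteq> ?K" "vec.independent C'" "?K \<subseteq> vec.span C'"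
    using C(2) by (rule vec.maximal_independent_subset_extend)
  have span: "vec.span C' = ?K"
    using C' vec.span_minimal[OF C'(2) subspace_kernel] by auto
  define D where "D = insert v0 C'"
  have "v0 \<notin> vec.span C'"
    using v0 by (simp add: span)
  then have D: "vec.independent D"
    unfolding D_def using C'(3) by (rule vec.independent_insertI)
  have "w \<in> vec.span D" for w
    unfolding D_def vec.span_breakdown_eq span by (rule exI[of _ "dual_apply \<phi> w"]) (simp add: v0)
  then have D_UNIV: "vec.span D = UNIV"
    by auto
  then have card: "card D = CARD('n)"
    using vec.dim_span_eq_card_independent[OF D] vec_dim_card by metis
  then obtain B where B: "bij_betw B (UNIV :: 'n set) D"
    using vec.finiteI_independent[OF D] by (metis finite finite_same_card_bij)
  have rangeB: "range B = D"
    using B by (simp add: bij_betw_def)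
  define M where "M = (\<chi> i j. B j $ i)"
  have "columns M = D"
    unfolding columns_def rangeB[symmetric] by (auto simp: M_def column_def vec_lambda_eta)
  then obtain N where N: "M ** N = mat 1"
    using D_UNIV matrix_right_invertible_span_columns[of M] by auto
  then have N': "N ** M = mat 1"
    by (simp add: matrix_left_right_inverse)
  define Y where "Y k = N $ k" for k
  have YB: "dual_apply (Y k) (B j) = (if k = j then 1 else 0)" for k j
    using arg_cong[OF N', of "\<lambda>A. A $ k $ j"]
    by (simp add: matrix_matrix_mult_def M_def Y_def dual_apply_def mat_def)
  obtain i0 where i0: "B i0 = v0"
    using rangeB unfolding D_def by (metis insertI1 rangeE)
  have other: "dual_apply \<phi> (B j) = (if j = i0 then 1 else 0)" for j
  proof (cases "j = i0")
    case False
    then have "B j \<noteq> v0"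
      using B i0 by (auto simp: bij_betw_def inj_def)
    then have "B j \<in> C'"
      using rangeB unfolding D_def by (metis insertE rangeI)
    then show ?thesis
      using C'(2) False by auto
  qed (simp add: i0 v0)
  \<comment> \<open>Both forms take the same values on the basis \<open>B\<close>, the columns of
    the invertible matrix \<open>M\<close>.\<close>
  have "\<phi> v* M = Y i0 v* M"
    using other YB[of i0] by (simp add: vec_eq_iff vector_matrix_mult_def M_def dual_apply_def mult.commute)
  then have "\<phi> v* M v* N = Y i0 v* M v* N"
    by simp
  then have Y0: "Y i0 = \<phi>"
    by (simp add: vector_matrix_mul_assoc N)
  define J where "J = {j. B j \<in> C}"
  have "B ` J = C"
    using rangeB C'(1) by (auto simp: J_def D_def image_iff)
  moreover have "inj_on B J"
    using B by (auto simp: bij_betw_def inj_on_def)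
  ultimately have cardJ: "card J = vec.dim W"
    using C(4) card_image by metis
  have "dual_apply (Y k) w = 0" if k: "k \<notin> J" "w \<in> W" for k w
  proof -
    have "C \<subseteq> {w. dual_apply (Y k) w = 0}"
    proof
      fix c
      assume c: "c \<in> C"
      then obtain j where "c = B j"
        using \<open>B ` J = C\<close> by auto
      moreover have "j \<noteq> k"
        using c k calculation by (auto simp: J_def)
      ultimately show "c \<in> {w. dual_apply (Y k) w = 0}"
        by (simp add: YB)
    qed
    then have "vec.span C \<subseteq> {w. dual_apply (Y k) w = 0}"
      by (rule vec.span_minimal) (rule subspace_kernel)
    then show ?thesis
      using C(3) k by auto
  qed
  moreover have "i0 \<notin> J"
    using i0 v0 C(1) W(2) by (auto simp: J_def)
  moreover have "B j \<in> W" if "j \<in> J" for j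
    using that C(1) by (auto simp: J_def)
  ultimately show ?thesis
    using that[of Y B i0 J] YB i0 Y0 cardJ by blast
qed

lemma dual_bases_det:
  fixes B Y :: "'n \<Rightarrow> 'a::field ^ 'n"
  assumes "\<And>k j. dual_apply (Y k) (B j) = (if k = j then 1 else 0)"
  shows "det (\<chi> k. Y k) * det (\<chi> k. B k) = 1"
proof -
  have "(\<chi> k. Y k) ** transpose (\<chi> k. B k) = mat 1"
    using assms by (simp add: vec_eq_iff matrix_matrix_mult_def transpose_def dual_apply_def mat_def)
  then show ?thesis
    by (metis det_I det_mul det_transpose)
qed

text \<open>
  For a prime \<open>p\<close> dividing \<open>c\<close> to a higher power than \<open>a\<close>, multiply the prime-to-\<open>p\<close> part of \<open>\<kappa>\<close> by the
  \<open>p\<close>-part of \<open>\<mu>\<close>.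
\<close>

lemma field_element_of_larger_order:
  fixes \<kappa> \<mu> :: "'a::field"
  assumes ac: "a > 0" "c > 0" "\<not> c dvd a"
    and \<kappa>: "\<And>k. \<kappa> ^ k = 1 \<longleftrightarrow> a dvd k" and \<mu>: "\<And>k. \<mu> ^ k = 1 \<longleftrightarrow> c dvd k"
  shows "\<exists>i j N. N > a \<and> (\<forall>k. (\<kappa> ^ i * \<mu> ^ j) ^ k = 1 \<longrightarrow> N dvd k)"
proof -
  have "\<exists>p::nat. prime p \<and> multiplicity p a < multiplicity p c"
  proof (rule ccontr)
    assume "\<not> ?thesis"
    then have "multiplicity p c \<le> multiplicity p a" if "prime p" for p :: nat
      using that by (auto simp: not_less)
    then show False
      using ac multiplicity_le_imp_dvd[of c a] by auto
  qed
  then obtain p :: nat where p: "prime p" "multiplicity p a < multiplicity p c"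
    by blast
  let ?x = "multiplicity p c" and ?y = "multiplicity p a"
  obtain a' where a': "a = p ^ ?y * a'" "\<not> p dvd a'"
    using multiplicity_decompose'[of a p] ac p by (metis neq0_conv not_prime_unit)
  obtain c' where c': "c = p ^ ?x * c'"
    using multiplicity_dvd[of p c] by (auto simp: dvd_def)
  have cop: "coprime a' (p ^ e)" for e
    using p(1) a'(2) by (metis coprime_commute coprime_power_right_iff prime_imp_coprime)
  have p0: "p > 0"
    using p(1) prime_gt_0_nat by blast
  \<comment> \<open>The witnesses are i = p^y, j = c' and N = p^x a': the power \<kappa>^(p^y) has
    order a', the power \<mu>^c' has order p^x, and these orders are coprime.\<close>
  show ?thesis
  proof (intro exI conjI allI impI)
    have "?y < ?x" by (rule p)
    then have "p ^ ?y < p ^ ?x"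
      using p(1) prime_gt_1_nat power_strict_increasing by blast
    moreover have "a' > 0"
      using a' ac by (metis gr0I mult_0_right)
    ultimately show "p ^ ?x * a' > a"
      using a'(1) by (metis mult_less_mono1)
  next
    fix k
    assume one: "(\<kappa> ^ (p ^ ?y) * \<mu> ^ c') ^ k = 1"
    have "(\<kappa> ^ (p ^ ?y) * \<mu> ^ c') ^ (k * p ^ ?x) = 1"
      by (simp only: power_mult one power_one)
    moreover have "\<mu> ^ (c' * (k * p ^ ?x)) = 1"
      unfolding \<mu> by (subst c') (simp add: mult_ac)
    ultimately have "\<kappa> ^ (p ^ ?y * (k * p ^ ?x)) = 1"
      by (simp only: power_mult_distrib power_mult[symmetric] mult_1_right)
    then have "p ^ ?y * a' dvd p ^ ?y * (k * p ^ ?x)"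
      using a'(1) by (simp only: \<kappa>)
    then have "a' dvd k * p ^ ?x"
      using p0 by simp
    then have a'k: "a' dvd k"
      using cop coprime_dvd_mult_left_iff by blast
    have "(\<kappa> ^ (p ^ ?y) * \<mu> ^ c') ^ (k * a') = 1"
      by (simp only: power_mult one power_one)
    moreover have "\<kappa> ^ (p ^ ?y * (k * a')) = 1"
      unfolding \<kappa> by (subst a'(1)) (simp add: mult_ac)
    ultimately have "\<mu> ^ (c' * (k * a')) = 1"
      by (simp only: power_mult_distrib power_mult[symmetric] mult_1_left)
    then have "c' * p ^ ?x dvd c' * (k * a')"
      using c' by (simp only: \<mu> mult.commute)
    moreover have "c' \<noteq> 0"
      using c' ac by (metis mult_0_right neq0_conv)
    ultimately have "p ^ ?x dvd k * a'"
      by simp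
    then have "p ^ ?x dvd k"
      using cop by (metis coprime_commute coprime_dvd_mult_left_iff)
    then show "p ^ ?x * a' dvd k"
      using a'k cop divides_mult by (metis coprime_commute)
  qed
qed

locale hyperplane_stabilizer =
  fixes G :: "('a::field ^ 'n ^ 'n) set" and \<phi> :: "'a ^ 'n"
  assumes subgroup: "subgroup G GL" and finite_G: "finite G" and \<phi>: "\<phi> \<noteq> 0"
begin

definition "H = {v. dual_apply \<phi> v = 0}"
definition "K = {g\<in>G. \<forall>v\<in>H. g *v v = v}"

lemma K_root_vector:
  assumes "g \<in> K"
  obtains w where "root_vector \<phi> g w"
  using root_vector_exists[OF \<phi>, of g] assms by (auto simp: K_def H_def)

lemma K_G: "g \<in> K \<Longrightarrow> g \<in> G"
  by (simp add: K_def)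

lemma K_invertible: "g \<in> K \<Longrightarrow> invertible g"
  using subgroup_GL_invertible[OF subgroup] by (simp add: K_def)

lemma K_1: "mat 1 \<in> K"
  using subgroup_GL_1[OF subgroup] by (simp add: K_def)

lemma K_mult: "g \<in> K \<Longrightarrow> h \<in> K \<Longrightarrow> g ** h \<in> K"
  using subgroup_GL_mult[OF subgroup] by (simp add: K_def flip: matrix_vector_mul_assoc)

lemma K_inv:
  assumes "g \<in> K"
  shows "matrix_inv g \<in> K"
proof -
  have "matrix_inv g *v v = v" if "v \<in> H" for v
  proof -
    have "matrix_inv g *v (g *v v) = v"
      by (simp add: matrix_vector_mul_assoc matrix_inv[OF K_invertible[OF assms]])
    then show ?thesis
      using assms that by (simp add: K_def)
  qed
  then show ?thesis
    using assms subgroup_GL_matrix_inv[OF subgroup] by (simp add: K_def)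
qed

lemma K_reflection: "g \<in> K \<Longrightarrow> g \<noteq> mat 1 \<Longrightarrow> reflection_about H g"
  using hyperplane_kernel[OF \<phi>] K_invertible by (simp add: reflection_about_def K_def H_def)

text \<open>The eigenvalue of g on V/H, which for g in \<open>K\<close> is also its determinant. A
  relation avoids choosing a value for matrices that do not preserve H.\<close>

definition "scales g c \<longleftrightarrow> (\<forall>v. dual_apply \<phi> (g *v v) = c * dual_apply \<phi> v)"

lemma scales_root_vector: "root_vector \<phi> g w \<Longrightarrow> scales g (1 + dual_apply \<phi> w)"
  by (simp add: scales_def root_vector_def algebra_simps)

lemma scales_unique:
  assumes "scales g c" "scales g d"
  shows "c = d"
proof -
  obtain v where "dual_apply \<phi> v = 1"
    using dual_apply_eq_1[OF \<phi>] .
  then show ?thesis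
    using assms unfolding scales_def by (metis mult.right_neutral)
qed

lemma scales_mult: "scales g c \<Longrightarrow> scales h d \<Longrightarrow> scales (g ** h) (c * d)"
  by (simp add: scales_def flip: matrix_vector_mul_assoc)

lemma scales_1: "scales (mat 1) 1"
  by (simp add: scales_def)

lemma K_scales:
  assumes "g \<in> K"
  obtains c where "scales g c"
  using K_root_vector[OF assms] scales_root_vector by metis

lemma scales_neq_0:
  assumes "g \<in> K" "scales g c"
  shows "c \<noteq> 0"
proof -
  obtain d where "scales (matrix_inv g) d"
    using K_scales[OF K_inv[OF assms(1)]] .
  then have "scales (g ** matrix_inv g) (c * d)"
    using assms(2) scales_mult by blast
  then have "c * d = 1"
    using scales_unique scales_1 K_invertible[OF assms(1)] by (metis matrix_inv(1))
  then show ?thesis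
    by auto
qed

text \<open>If \<phi>(w) is nonzero, w spans an eigenline complementary to H with eigenvalue 1 +
  \<phi>(w). If \<phi>(w) = 0, an eigenvector q with eigenvalue d satisfies (d - 1) q = \<phi>(q) w;
  applying \<phi> forces d = 1, and a diagonalizable g would be the identity.\<close>

lemma diagonalizable_iff:
  assumes g: "g \<in> K" "g \<noteq> mat 1" and w: "root_vector \<phi> g w"
  shows "diagonalizable g \<longleftrightarrow> dual_apply \<phi> w \<noteq> 0"
proof
  assume "diagonalizable g"
  then obtain P D :: "'a ^ 'n ^ 'n" where PD: "invertible P" "\<And>i j. i \<noteq> j \<Longrightarrow> D $ i $ j = 0"
    "g = P ** D ** matrix_inv P"
    unfolding diagonalizable_def by blast
  show "dual_apply \<phi> w \<noteq> 0"
  proof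
    assume w0: "dual_apply \<phi> w = 0"
    have "D $ i $ i = 1" for i
    proof -
      define q where "q = P *v axis i 1"
      have "q \<noteq> 0"
        unfolding q_def using PD(1)
        by (metis axis_eq_0_iff invertible_def matrix_vector_mul_assoc matrix_vector_mul_lid
            matrix_vector_mult_0_right zero_neq_one)
      have "D *v axis i 1 = D $ i $ i *s axis i 1"
        using PD(2) by (auto simp: vec_eq_iff matrix_vector_mult_def axis_def if_zero_mult)
      moreover have "g *v q = P *v (D *v ((matrix_inv P ** P) *v axis i 1))"
        by (simp add: q_def PD(3) matrix_vector_mul_assoc matrix_mul_assoc)
      ultimately have gq: "g *v q = D $ i $ i *s q"
        by (simp add: matrix_inv[OF PD(1)] vector_scalar_commute q_def)
      then have *: "(D $ i $ i - 1) *s q = dual_apply \<phi> q *s w"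
        using w by (simp add: root_vector_def vector_sub_rdistrib algebra_simps)
      then have "dual_apply \<phi> ((D $ i $ i - 1) *s q) = 0"
        using w0 by simp
      then have "D $ i $ i - 1 = 0 \<or> dual_apply \<phi> q = 0"
        by simp
      then have "(D $ i $ i - 1) *s q = 0"
        using * by auto
      then show ?thesis
        using \<open>q \<noteq> 0\<close> by simp
    qed
    then have "D = mat 1"
      using PD(2) by (simp add: vec_eq_iff mat_def)
    then show False
      using g(2) PD by (simp add: matrix_inv)
  qed
next
  assume w0: "dual_apply \<phi> w \<noteq> 0"
  let ?v = "(1 / dual_apply \<phi> w) *s w"
  have v: "dual_apply \<phi> ?v = 1"
    using w0 by simp
  obtain B Y :: "'n \<Rightarrow> 'a ^ 'n" and i0 J where BY: "B i0 = ?v" "Y i0 = \<phi>"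
    "\<And>k j. dual_apply (Y k) (B j) = (if k = j then 1 else 0)"
    by (rule adapted_basis[OF v vec.subspace_single_0]) auto
  define P where "P = (\<chi> i j. B j $ i)"
  define D where "D = (\<chi> i j. if i = j then if i = i0 then 1 + dual_apply \<phi> w else 1 else 0)"
  have "P = transpose (\<chi> k. B k)"
    by (simp add: P_def transpose_def vec_eq_iff)
  then have P: "invertible P"
    using dual_bases_det[OF BY(3)] by (simp add: invertible_det_nz) (metis mult_zero_right zero_neq_one)
  have gB: "g *v B j = D $ j $ j *s B j" for j
  proof (cases "j = i0")
    case True
    have "g *v ?v = ?v + dual_apply \<phi> ?v *s w"
      using w unfolding root_vector_def by blast
    also have "\<dots> = (1 + dual_apply \<phi> w) *s ?v"
      unfolding v using w0 by (simp add: vec_eq_iff field_simps)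
    finally show ?thesis
      using True BY(1) by (simp add: D_def)
  next
    case False
    then have "dual_apply \<phi> (B j) = 0"
      using BY(2) BY(3)[of i0 j] by auto
    then show ?thesis
      using w False by (simp add: root_vector_def D_def)
  qed
  have "(g ** P) $ i $ j = (g *v B j) $ i" for i j
    by (simp add: matrix_matrix_mult_def matrix_vector_mult_def P_def)
  moreover have "(P ** D) $ i $ j = (D $ j $ j *s B j) $ i" for i j
    by (simp add: matrix_matrix_mult_def P_def D_def if_zero_mult mult.commute)
  ultimately have "g ** P = P ** D"
    by (simp add: vec_eq_iff gB)
  then have "g = P ** D ** matrix_inv P"
    using matrix_inv[OF P] by (metis matrix_mul_assoc matrix_mul_rid)
  then show "diagonalizable g"
    unfolding diagonalizable_def using P
    by (intro exI[of _ P] exI[of _ D]) (auto simp: D_def)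
qed

lemma K_pow: "g \<in> K \<Longrightarrow> g [^]\<^bsub>GL\<^esub> (k::nat) \<in> K"
  by (induction k) (simp_all add: K_1 K_mult nat_pow_def GL_def)

lemma scales_pow: "scales g c \<Longrightarrow> scales (g [^]\<^bsub>GL\<^esub> (k::nat)) (c ^ k)"
proof (induction k)
  case (Suc k)
  then have "scales (g [^]\<^bsub>GL\<^esub> k ** g) (c ^ k * c)"
    by (intro scales_mult) auto
  then show ?case
    by (simp add: nat_pow_def GL_def mult.commute)
qed (simp add: nat_pow_def GL_def scales_1)

text \<open>g multiplies its own root vector by 1 + \<phi>(w), so root vectors of powers are
  geometric sums.\<close>

lemma root_vector_pow:
  assumes "root_vector \<phi> g w"
  shows "root_vector \<phi> (g [^]\<^bsub>GL\<^esub> (k::nat)) ((\<Sum>i<k. (1 + dual_apply \<phi> w) ^ i) *s w)"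
proof (induction k)
  case 0
  show ?case
    by (simp add: nat_pow_def GL_def root_vector_def)
next
  case (Suc k)
  let ?c = "1 + dual_apply \<phi> w" and ?p = "g [^]\<^bsub>GL\<^esub> k"
  have "g [^]\<^bsub>GL\<^esub> Suc k = ?p ** g"
    by (simp add: nat_pow_def GL_def)
  moreover have "(\<Sum>i<Suc k. ?c ^ i) = 1 + ?c * (\<Sum>i<k. ?c ^ i)"
    by (subst sum.lessThan_Suc_shift) (simp add: sum_distrib_left)
  moreover have "(?p ** g) *v v = v + dual_apply \<phi> v *s ((1 + ?c * (\<Sum>i<k. ?c ^ i)) *s w)" for v
  proof -
    have "(?p ** g) *v v = ?p *v (v + dual_apply \<phi> v *s w)"
      using assms by (simp add: root_vector_def flip: matrix_vector_mul_assoc)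
    also have "\<dots> = (v + dual_apply \<phi> v *s w) +
        dual_apply \<phi> (v + dual_apply \<phi> v *s w) *s ((\<Sum>i<k. ?c ^ i) *s w)"
      using Suc by (simp only: root_vector_def)
    also have "\<dots> = v + dual_apply \<phi> v *s ((1 + ?c * (\<Sum>i<k. ?c ^ i)) *s w)"
      by (simp add: vec_eq_iff algebra_simps)
    finally show ?thesis .
  qed
  ultimately show ?case
    by (simp only: root_vector_def) blast
qed

lemma diag_refls_iff:
  "g \<in> diag_refls G H \<longleftrightarrow> g \<in> K \<and> (\<exists>c. c \<noteq> 1 \<and> scales g c)"
proof
  assume g: "g \<in> diag_refls G H"
  then have gK: "g \<in> K" and g1: "g \<noteq> mat 1"
    by (auto simp: diag_refls_def K_def reflection_about_def)
  obtain w where w: "root_vector \<phi> g w"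
    using K_root_vector[OF gK] .
  then have "1 + dual_apply \<phi> w \<noteq> 1"
    using g diagonalizable_iff[OF gK g1 w] by (simp add: diag_refls_def)
  then show "g \<in> K \<and> (\<exists>c. c \<noteq> 1 \<and> scales g c)"
    using gK scales_root_vector[OF w] by blast
next
  assume "g \<in> K \<and> (\<exists>c. c \<noteq> 1 \<and> scales g c)"
  then obtain c where gK: "g \<in> K" and c: "c \<noteq> 1" "scales g c"
    by blast
  then have g1: "g \<noteq> mat 1"
    using scales_unique scales_1 by blast
  obtain w where w: "root_vector \<phi> g w"
    using K_root_vector[OF gK] .
  have "dual_apply \<phi> w \<noteq> 0"
    using scales_unique[OF scales_root_vector[OF w] c(2)] c(1) by auto
  then show "g \<in> diag_refls G H"
    using diagonalizable_iff[OF gK g1 w] K_reflection[OF gK g1] gK by (simp add: diag_refls_def K_def)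
qed

text \<open>For c different from 1 the geometric sum of length k vanishes exactly when c^k = 1. So a
  diagonalizable reflection has the order of its eigenvalue on V/H, and this order is positive as G
  is finite.\<close>

lemma ord_diag_refl:
  assumes g: "g \<in> K" "scales g c" "c \<noteq> 1"
  shows "c ^ k = 1 \<longleftrightarrow> group.ord GL g dvd k" and "group.ord GL g > 0"
proof -
  interpret GL: group GL
    by (rule group_GL)
  have carrier: "g \<in> carrier GL"
    using K_invertible[OF g(1)] by (simp add: GL_def)
  obtain w where w: "root_vector \<phi> g w"
    using K_root_vector[OF g(1)] .
  have c: "c = 1 + dual_apply \<phi> w"
    using scales_unique[OF g(2) scales_root_vector[OF w]] .
  have w0: "w \<noteq> 0"
    using g(3) c by auto
  have pow: "g [^]\<^bsub>GL\<^esub> k = \<one>\<^bsub>GL\<^esub> \<longleftrightarrow> c ^ k = 1" for k :: nat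
  proof -
    have "g [^]\<^bsub>GL\<^esub> k = mat 1 \<longleftrightarrow> (\<Sum>i<k. c ^ i) *s w = 0"
      using root_vector_eq_0_iff[OF \<phi> root_vector_pow[OF w, of k]] c by simp
    also have "\<dots> \<longleftrightarrow> (\<Sum>i<k. c ^ i) = 0"
      using w0 by simp
    also have "\<dots> \<longleftrightarrow> c ^ k = 1"
      using power_diff_1_eq[of c k] g(3) by auto
    finally show ?thesis
      by (simp add: GL_def)
  qed
  then show "c ^ k = 1 \<longleftrightarrow> group.ord GL g dvd k" for k
    using GL.pow_eq_id[OF carrier] by blast
  interpret GG: group "GL\<lparr>carrier := G\<rparr>"
    by (rule GL.subgroup_imp_group[OF subgroup])
  have "g [^]\<^bsub>GL\<^esub> card G = \<one>\<^bsub>GL\<^esub>"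
    using GG.pow_order_eq_1[of g] K_G[OF g(1)]
    by (simp add: Coset.order_def flip: GL.nat_pow_consistent)
  then have "group.ord GL g dvd card G"
    using GL.pow_eq_id[OF carrier] by blast
  then show "group.ord GL g > 0"
    using finite_G K_G[OF g(1)] by (metis card_gt_0_iff dvd_0_left empty_iff neq0_conv)
qed

text \<open>
  The eigenvalues of the elements of \<open>K\<close> on the quotient by \<open>H\<close> form a finite subgroup of the
  multiplicative group, so their orders divide the maximal one.
\<close>

lemma e_num_eigenvector:
  obtains s v0 \<kappa> where "s \<in> K" "dual_apply \<phi> v0 = 1" "s *v v0 = \<kappa> *s v0" "\<kappa> \<noteq> 0"
    "\<And>k. \<kappa> ^ k = 1 \<Longrightarrow> e_num G H dvd k" "e_num G H > 0"
    "\<And>g c. g \<in> K \<Longrightarrow> scales g c \<Longrightarrow> c ^ e_num G H = 1"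
    "diag_refls G H \<noteq> {} \<Longrightarrow> \<kappa> \<noteq> 1"
proof (cases "diag_refls G H = {}")
  \<comment> \<open>Without diagonalizable reflections every eigenvalue on V/H is 1 and e = 1, so
    the identity takes the role of s.\<close>
  case True
  obtain v0 where "dual_apply \<phi> v0 = 1"
    using dual_apply_eq_1[OF \<phi>] .
  moreover have "c = 1" if "g \<in> K" "scales g c" for g c
    using True diag_refls_iff that by blast
  ultimately show ?thesis
    using that[of "mat 1" v0 1] True K_1 by (simp add: e_num_def)
next
  case False
  let ?ords = "group.ord GL ` diag_refls G H"
  have fin: "finite ?ords"
    using finite_G by (simp add: diag_refls_def)
  have e: "e_num G H = Max ?ords"
    using False by (simp add: e_num_def)
  then have "e_num G H \<in> ?ords"
    using fin False by simp
  then obtain s where s: "s \<in> diag_refls G H" "e_num G H = group.ord GL s"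
    by blast
  then obtain \<kappa> where \<kappa>: "\<kappa> \<noteq> 1" "scales s \<kappa>" and sK: "s \<in> K"
    using diag_refls_iff by blast
  note ord = ord_diag_refl[OF sK \<kappa>(2,1), folded s(2)]
  obtain w where w: "root_vector \<phi> s w"
    using K_root_vector[OF sK] .
  have lw: "\<kappa> = 1 + dual_apply \<phi> w"
    using scales_unique[OF \<kappa>(2) scales_root_vector[OF w]] .
  \<comment> \<open>The root vector of s, normalised by \<phi>(v0) = 1, spans the eigenline of s
    outside H.\<close>
  define v0 where "v0 = (1 / dual_apply \<phi> w) *s w"
  have w0: "dual_apply \<phi> w \<noteq> 0"
    using \<kappa>(1) lw by auto
  then have v0: "dual_apply \<phi> v0 = 1"
    by (simp add: v0_def)
  have "w = dual_apply \<phi> w *s v0"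
    using w0 by (simp add: vec_eq_iff v0_def)
  then have "s *v v0 = v0 + dual_apply \<phi> w *s v0"
    using w v0 unfolding root_vector_def by (metis vector_smult_lid)
  then have "s *v v0 = \<kappa> *s v0"
    by (simp add: lw vector_sadd_rdistrib)
  moreover have "c ^ e_num G H = 1" if g: "g \<in> K" "scales g c" for g c
  proof (rule ccontr)
    assume ne: "c ^ e_num G H \<noteq> 1"
    then have c1: "c \<noteq> 1"
      by auto
    note ord' = ord_diag_refl[OF g c1]
    have "\<not> group.ord GL g dvd e_num G H"
      using ne ord'(1) by blast
    from field_element_of_larger_order[OF ord(2) ord'(2) this ord(1) ord'(1)]
    obtain i j N where N: "N > e_num G H" "\<And>k. (\<kappa> ^ i * c ^ j) ^ k = 1 \<Longrightarrow> N dvd k"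
      by auto
    \<comment> \<open>An element of \<open>K\<close> whose eigenvalue order would exceed the maximum
      that defines e.\<close>
    let ?h = "s [^]\<^bsub>GL\<^esub> i ** g [^]\<^bsub>GL\<^esub> j"
    have h: "?h \<in> K" "scales ?h (\<kappa> ^ i * c ^ j)"
      using sK g \<kappa>(2) by (auto intro!: K_mult K_pow scales_mult scales_pow)
    have "\<kappa> ^ i * c ^ j \<noteq> 1"
      using N(1) N(2)[of 1] ord(2) by auto
    note ord_h = ord_diag_refl[OF h this]
    have "N dvd group.ord GL ?h"
      by (rule N(2)) (simp only: ord_h(1) dvd_refl)
    then have "N \<le> group.ord GL ?h"
      using ord_h(2) by (rule dvd_imp_le)
    also have "\<dots> \<le> e_num G H"
      unfolding e using fin h \<open>\<kappa> ^ i * c ^ j \<noteq> 1\<close> diag_refls_iff by (intro Max_ge) auto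
    finally show False
      using N(1) by simp
  qed
  ultimately show ?thesis
    using that[of s v0 \<kappa>] sK v0 scales_neq_0[OF sK \<kappa>(2)] ord \<kappa>(1) by simp
qed

section \<open>Root vectors of transvections\<close>

definition "W = vec.span {w. \<exists>s\<in>G. transvection_about H s \<and> root_vector \<phi> s w}"

lemma dim_W: "vec.dim W = b_num G H \<phi>"
  by (simp add: W_def b_num_def)

lemma transvection_iff:
  assumes "root_vector \<phi> g w" "g \<in> K" "g \<noteq> mat 1"
  shows "transvection_about H g \<longleftrightarrow> dual_apply \<phi> w = 0"
  using diagonalizable_iff[OF assms(2,3,1)] K_reflection[OF assms(2,3)]
  by (simp add: transvection_about_def)

lemma transvection_K: "s \<in> G \<Longrightarrow> transvection_about H s \<Longrightarrow> s \<in> K \<and> s \<noteq> mat 1"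
  by (simp add: transvection_about_def reflection_about_def K_def)

lemma W_kernel: "w \<in> W \<Longrightarrow> dual_apply \<phi> w = 0"
proof -
  have "W \<subseteq> {v. dual_apply \<phi> v = 0}"
    unfolding W_def using transvection_iff transvection_K
    by (intro vec.span_minimal subspace_kernel) blast
  then show "w \<in> W \<Longrightarrow> dual_apply \<phi> w = 0"
    by blast
qed

lemma root_vector_in_W:
  assumes "g \<in> K" "root_vector \<phi> g w" "dual_apply \<phi> w = 0"
  shows "w \<in> W"
proof (cases "g = mat 1")
  case True
  then have "w = 0"
    using root_vector_eq_0_iff[OF \<phi> assms(2)] by simp
  then show ?thesis
    by (simp add: W_def vec.span_zero)
next
  case False
  then show ?thesis
    unfolding W_def using transvection_iff[OF assms(2,1) False] assms K_G
    by (intro vec.span_base) blast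
qed

lemma root_vector_mult:
  assumes "root_vector \<phi> g w" "root_vector \<phi> h w'"
  shows "root_vector \<phi> (g ** h) (w' + (1 + dual_apply \<phi> w') *s w)"
  unfolding root_vector_def
proof
  fix v
  have h: "h *v v = v + dual_apply \<phi> v *s w'"
    using assms(2) by (simp add: root_vector_def)
  have "(g ** h) *v v = h *v v + dual_apply \<phi> (h *v v) *s w"
    using assms(1) by (simp add: root_vector_def flip: matrix_vector_mul_assoc)
  then show "(g ** h) *v v = v + dual_apply \<phi> v *s (w' + (1 + dual_apply \<phi> w') *s w)"
    unfolding h by (simp add: vec_eq_iff algebra_simps)
qed

text \<open>
  The commutator of two diagonalizable reflections about \<open>H\<close> with different eigenlines is a
  transvection along the difference of the normalised eigenvectors.
\<close>

lemma root_vector_mod_W: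
  assumes s: "s \<in> K" "dual_apply \<phi> v0 = 1" "s *v v0 = \<kappa> *s v0" "diag_refls G H \<noteq> {} \<Longrightarrow> \<kappa> \<noteq> 1"
    and g: "g \<in> K" "root_vector \<phi> g w"
  shows "w - dual_apply \<phi> w *s v0 \<in> W"
proof (cases "dual_apply \<phi> w = 0")
  case True
  then show ?thesis
    using root_vector_in_W g by simp
next
  case False
  have "scales g (1 + dual_apply \<phi> w)" "1 + dual_apply \<phi> w \<noteq> 1"
    using False scales_root_vector[OF g(2)] by auto
  then have "g \<in> diag_refls G H"
    using g(1) diag_refls_iff by blast
  then have \<kappa>: "\<kappa> \<noteq> 1"
    using s(4) by blast
  obtain w' where w': "root_vector \<phi> s w'"
    using K_root_vector[OF s(1)] .
  have w'_eq: "w' = (\<kappa> - 1) *s v0"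
    using w' s(2,3) unfolding root_vector_def
    by (metis add_diff_cancel_left' vector_smult_lid vector_sub_rdistrib)
  let ?c = "1 + dual_apply \<phi> w"
  have \<phi>w': "dual_apply \<phi> w' = \<kappa> - 1"
    using s(2) by (simp add: w'_eq)
  have gs: "root_vector \<phi> (g ** s) (w' + \<kappa> *s w)"
    using root_vector_mult[OF g(2) w'] by (simp add: \<phi>w')
  have sg: "root_vector \<phi> (s ** g) (w + ?c *s w')"
    using root_vector_mult[OF w' g(2)] .
  \<comment> \<open>Comparing root vectors in h (s g) = g s expresses the root vector x of the
    commutator: up to nonzero scalars it is w - \<phi>(w) v0.\<close>
  define h where "h = g ** s ** matrix_inv (s ** g)"
  have hK: "h \<in> K"
    unfolding h_def by (intro K_mult K_inv g s)
  obtain x where x: "root_vector \<phi> h x"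
    using K_root_vector[OF hK] .
  have "h ** (s ** g) = g ** s"
    using matrix_inv(2)[OF K_invertible[OF K_mult[OF s(1) g(1)]]]
    by (simp add: h_def flip: matrix_mul_assoc)
  then have "root_vector \<phi> (g ** s) ((w + ?c *s w') + (1 + dual_apply \<phi> (w + ?c *s w')) *s x)"
    using root_vector_mult[OF x sg] by simp
  moreover have "1 + dual_apply \<phi> (w + ?c *s w') = ?c * \<kappa>"
    by (simp add: \<phi>w' algebra_simps)
  ultimately have "root_vector \<phi> (g ** s) ((w + ?c *s w') + (?c * \<kappa>) *s x)"
    by simp
  then have "(w + ?c *s w') + (?c * \<kappa>) *s x = w' + \<kappa> *s w"
    using gs root_vector_unique[OF \<phi>] by blast
  then have "(w $ i + ?c * w' $ i) + (?c * \<kappa>) * x $ i = w' $ i + \<kappa> * w $ i" for i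
    by (metis vector_add_component vector_smult_component)
  then have "(?c * \<kappa>) * x $ i = (\<kappa> - 1) * (w $ i - dual_apply \<phi> w * v0 $ i)" for i
    by (simp add: w'_eq algebra_simps)
  then have eq: "(?c * \<kappa>) *s x = (\<kappa> - 1) *s (w - dual_apply \<phi> w *s v0)"
    by (simp add: vec_eq_iff)
  have c0: "?c \<noteq> 0"
    using scales_neq_0[OF g(1) scales_root_vector[OF g(2)]] .
  have l0: "\<kappa> \<noteq> 0"
    using scales_neq_0[OF s(1) scales_root_vector[OF w']] \<phi>w' by simp
  have "dual_apply \<phi> ((?c * \<kappa>) *s x) = 0"
    unfolding eq using s(2) by simp
  then have "dual_apply \<phi> x = 0"
    using c0 l0 by simp
  then have "x \<in> W"
    using root_vector_in_W[OF hK x] by simp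
  then have "(1 / (\<kappa> - 1)) *s ((?c * \<kappa>) *s x) \<in> W"
    unfolding W_def by (intro vec.span_scale)
  then show ?thesis
    unfolding eq using \<kappa> by simp
qed

end


section \<open>Local order of the determinants along a hyperplane\<close>

text \<open>Contraction of the second tensor factor with a constant vector u, read as a linear form
  when \<eta> lies in S \<otimes> V and as a vector when it lies in S \<otimes> V^*.\<close>

definition pair :: "('a::field, 'n::finite) poly_ring ^ 'n \<Rightarrow> 'a ^ 'n \<Rightarrow> ('a, 'n) poly_ring" where
  "pair \<eta> u = (\<Sum>j\<in>UNIV. \<eta> $ j * PConst (u $ j))"

lemma pair_add [simp]: "pair \<eta> (u + v) = pair \<eta> u + pair \<eta> v"
  by (simp add: pair_def ring_homo.add[OF ring_homo_PConst] distrib_left sum.distrib)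

lemma pair_scale [simp]: "pair \<eta> (c *s u) = PConst c * pair \<eta> u"
  by (simp add: pair_def ring_homo.mult[OF ring_homo_PConst] sum_distrib_left mult_ac)

lemma pair_0 [simp]: "pair \<eta> 0 = 0"
  by (simp add: pair_def)

lemma pair_diff_left [simp]: "pair (\<eta> - \<theta>) u = pair \<eta> u - pair \<theta> u"
  by (simp add: pair_def left_diff_distrib sum_subtractf)

lemma pair_scale_left [simp]: "pair (p *s \<eta>) u = p * pair \<eta> u"
  by (simp add: pair_def sum_distrib_left mult.assoc)

lemma pair_tensor_one [simp]: "pair (tensor_one v) u = PConst (dual_apply v u)"
  by (simp add: pair_def tensor_one_def dual_apply_def ring_homo.hsum[OF ring_homo_PConst]
      ring_homo.mult[OF ring_homo_PConst])

lemma dual_apply_commute: "dual_apply \<phi> v = dual_apply v \<phi>"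
  by (simp add: dual_apply_def mult.commute)

lemma PConst_inverse: "c \<noteq> 0 \<Longrightarrow> PConst (1 / c) * PConst c = 1"
  by (simp flip: ring_homo.mult[OF ring_homo_PConst])

lemma dvd_PConst_mult:
  assumes "c \<noteq> 0" "q dvd PConst c * p"
  shows "q dvd p"
proof -
  have "q dvd PConst (1 / c) * (PConst c * p)"
    using assms(2) by (rule dvd_mult)
  then show ?thesis
    unfolding mult.assoc[symmetric] PConst_inverse[OF assms(1)] by simp
qed

lemma det_pair:
  fixes \<eta> :: "'n::finite \<Rightarrow> ('a::field, 'n) poly_ring ^ 'n"
  shows "det (\<chi> i k. pair (\<eta> i) (Z k)) = det (\<chi> i. \<eta> i) * PConst (det (\<chi> k. Z k))"
proof -
  have "(\<chi> i k. pair (\<eta> i) (Z k)) = (\<chi> i. \<eta> i) ** transpose (\<chi> k j. PConst ((\<chi> k. Z k) $ k $ j))"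
    by (simp add: vec_eq_iff matrix_matrix_mult_def transpose_def pair_def)
  then show ?thesis
    by (simp only: det_mul det_transpose ring_homo.det[OF ring_homo_PConst])
qed

text \<open>A constant change of basis multiplies the determinant by a nonzero scalar, so powers of
  q may be pulled out of the columns in whichever basis exhibits them.\<close>

lemma power_dvd_det_pair:
  fixes \<eta> :: "'n::finite \<Rightarrow> ('a::field, 'n) poly_ring ^ 'n"
  assumes Z: "det (\<chi> k. Z k) \<noteq> 0" and dvd: "\<And>i k. q ^ n k dvd pair (\<eta> i) (Z k)"
  shows "q ^ (\<Sum>k\<in>UNIV. n k) dvd det (\<chi> i. \<eta> i)"
proof -
  have "\<forall>i k. \<exists>c. pair (\<eta> i) (Z k) = q ^ n k * c"
    using dvd unfolding dvd_def by blast
  then obtain c where c: "\<And>i k. pair (\<eta> i) (Z k) = q ^ n k * c i k"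
    by metis
  have "(\<chi> i k. pair (\<eta> i) (Z k)) = transpose (\<chi> k. q ^ n k *s (\<chi> i. c i k))"
    by (simp add: vec_eq_iff transpose_def c)
  then have "det (\<chi> i k. pair (\<eta> i) (Z k)) = (\<Prod>k\<in>UNIV. q ^ n k) * det (\<chi> k i. c i k)"
    by (simp only: det_transpose det_rows_mul)
  then have "q ^ (\<Sum>k\<in>UNIV. n k) dvd PConst (det (\<chi> k. Z k)) * det (\<chi> i. \<eta> i)"
    by (simp add: det_pair power_sum mult.commute)
  then show ?thesis
    by (rule dvd_PConst_mult[OF Z])
qed

text \<open>A permutation with nonzero contribution sends every moved index to i0, and i0 to itself;
  by injectivity it moves nothing.\<close>

lemma det_arrow_column:
  fixes A :: "'r::comm_ring_1 ^ 'n ^ 'n"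
  assumes "\<And>k j. k \<noteq> j \<Longrightarrow> j \<noteq> i0 \<Longrightarrow> A $ k $ j = 0"
  shows "det A = (\<Prod>k\<in>UNIV. A $ k $ k)"
proof -
  have "of_int (sign p) * (\<Prod>k\<in>UNIV. A $ k $ p k) = 0" if p: "p permutes UNIV" "p \<noteq> id" for p
  proof -
    have "\<exists>k. k \<noteq> p k \<and> p k \<noteq> i0"
    proof (rule ccontr)
      assume *: "\<not> ?thesis"
      then have fx: "p k = k \<or> p k = i0" for k
        by metis
      have "p k = k" for k
      proof (rule ccontr)
        assume k: "p k \<noteq> k"
        then have "p k = i0"
          using fx by blast
        moreover have "p i0 = i0"
          using fx[of i0] by blast
        ultimately show False
          using k permutes_inj[OF p(1)] by (metis injD)
      qed
      then show False
        using p(2) by auto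
    qed
    then obtain k where "A $ k $ p k = 0"
      using assms by blast
    then have "(\<Prod>k\<in>UNIV. A $ k $ p k) = 0"
      by (intro prod_zero) auto
    then show ?thesis
      by simp
  qed
  then have "det A = (\<Sum>p\<in>{id}. of_int (sign p) * (\<Prod>k\<in>UNIV. A $ k $ p k))"
    unfolding det_def by (intro sum.mono_neutral_right) (auto simp: permutes_id)
  then show ?thesis
    by simp
qed

text \<open>The root vector is that of the inverse, because the contragredient action precomposes
  with it.\<close>

lemma dual_act_root_vector:
  assumes "root_vector \<phi> (matrix_inv g) w"
  shows "dual_act g \<psi> = \<psi> + dual_apply \<psi> w *s \<phi>"
proof (rule dual_apply_eqI)
  fix v
  have "dual_apply (dual_act g \<psi>) v = dual_apply \<psi> v + dual_apply \<phi> v * dual_apply \<psi> w"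
    using assms by (simp add: dual_apply_dual_act root_vector_def)
  also have "\<dots> = dual_apply (\<psi> + dual_apply \<psi> w *s \<phi>) v"
    by (simp add: dual_apply_commute[of _ v] mult.commute)
  finally show "dual_apply (dual_act g \<psi>) v = dual_apply (\<psi> + dual_apply \<psi> w *s \<phi>) v" .
qed

text \<open>g moves each variable by a multiple of \<phi>: it acts trivially on the coordinate ring
  of H.\<close>

lemma lin_form_dvd_poly_act_diff:
  assumes "root_vector \<phi> (matrix_inv g) w"
  shows "lin_form \<phi> dvd p - poly_act g p"
proof (rule ring_homo_dvd_diff[OF ring_homo_ident ring_homo_poly_act])
  show "lin_form \<phi> dvd PVar i - poly_act g (PVar i)" for i
    by (simp add: poly_act_PVar dual_act_root_vector[OF assms] lin_form_add lin_form_scale lin_form_axis)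
qed simp

lemma (in covariant_action) act_tensor_one: "tensor_act \<rho> g (tensor_one v) = tensor_one (\<rho> g v)"
  unfolding vec_eq_iff act_nth
  by (simp add: tensor_one_def \<rho>_eq matrix_vector_mult_def ring_homo.hsum[OF ring_homo_PConst]
      ring_homo.mult[OF ring_homo_PConst] mult.commute)

interpretation vec_act: covariant_action "\<lambda>g. g" "(*v)"
  by unfold_locales simp_all

interpretation form_act: covariant_action "\<lambda>g. transpose (matrix_inv g)" dual_act
  by unfold_locales (simp_all add: dual_act_eq transpose_mat matrix_inv_mult matrix_transpose_mul)

text \<open>Since s is the identity plus w times the row \<phi>, coordinate i of s \<theta> =
  \<theta> says that w_i times the contraction of the transformed coefficients with \<phi> is a
  difference p - s p. Such differences are divisible by \<phi>, and modulo \<phi> the transformed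
  coefficients are the original ones.\<close>

lemma vec_lower:
  fixes \<phi> :: "('a::field, 'n::{finite,linorder}) vec"
  assumes "hyperplane_stabilizer G \<phi>" and s: "s \<in> hyperplane_stabilizer.K G \<phi>" "s \<noteq> mat 1"
    and \<theta>: "tensor_act (*v) s \<theta> = \<theta>"
  shows "lin_form \<phi> dvd pair \<theta> \<phi>"
proof -
  interpret hyperplane_stabilizer G \<phi> by fact
  obtain w where w: "root_vector \<phi> s w"
    using K_root_vector[OF s(1)] .
  obtain w' where w': "root_vector \<phi> (matrix_inv s) w'"
    using K_root_vector[OF K_inv[OF s(1)]] .
  define s\<theta> where "s\<theta> = (\<chi> k. poly_act s (\<theta> $ k))"
  have cong: "lin_form \<phi> dvd \<theta> $ k - s\<theta> $ k" for k
    using lin_form_dvd_poly_act_diff[OF w'] by (simp add: s\<theta>_def)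
  have "w \<noteq> 0"
    using root_vector_eq_0_iff[OF \<phi> w] s(2) by simp
  then obtain i where i: "w $ i \<noteq> 0"
    by (auto simp: vec_eq_iff)
  have "s $ i $ k = (if i = k then 1 else 0) + w $ i * \<phi> $ k" for k
    using arg_cong[OF root_vector_row[OF w, of i], of "\<lambda>x. x $ k"] by (simp add: mat_def diff_eq_eq add.commute)
  then have "(PConst (s $ i $ k) :: ('a, 'n) poly_ring) = (if i = k then 1 else 0) + PConst (w $ i) * PConst (\<phi> $ k)" for k
    by (simp add: ring_homo.add[OF ring_homo_PConst] ring_homo.mult[OF ring_homo_PConst])
  then have "tensor_act (*v) s \<theta> $ i = s\<theta> $ i + PConst (w $ i) * pair s\<theta> \<phi>"
    by (simp add: vec_act.act_nth s\<theta>_def pair_def distrib_left if_zero_mult sum.distrib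
        sum_distrib_left mult_ac)
  then have "PConst (w $ i) * pair s\<theta> \<phi> = \<theta> $ i - s\<theta> $ i"
    by (simp add: \<theta>)
  then have "lin_form \<phi> dvd pair s\<theta> \<phi>"
    using cong dvd_PConst_mult[OF i] by metis
  moreover have "lin_form \<phi> dvd pair \<theta> \<phi> - pair s\<theta> \<phi>"
    unfolding pair_def using cong by (intro dvd_diff_sum dvd_diff_mult) auto
  ultimately have "lin_form \<phi> dvd pair s\<theta> \<phi> + (pair \<theta> \<phi> - pair s\<theta> \<phi>)"
    by (rule dvd_add)
  then show ?thesis
    by simp
qed

text \<open>Besides the constant vectors in \<open>H\<close> the Euler derivation \<open>\<Sum>j. x\<^sub>j \<otimes> v\<^sub>j\<close> is invariant.\<close>

lemma vec_upper:
  fixes \<phi> :: "('a::field, 'n::{finite,linorder}) vec"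
  assumes "hyperplane_stabilizer G \<phi>"
  shows "\<exists>\<eta> c. c \<noteq> 0 \<and> det (\<chi> i. \<eta> i) = PConst c * lin_form \<phi> \<and>
    (\<forall>g\<in>hyperplane_stabilizer.K G \<phi>. \<forall>i. tensor_act (*v) g (\<eta> i) = \<eta> i)"
proof -
  interpret hyperplane_stabilizer G \<phi> by fact
  obtain v0 where v0: "dual_apply \<phi> v0 = 1"
    using dual_apply_eq_1[OF \<phi>] .
  obtain B Y :: "'n \<Rightarrow> ('a, 'n) vec" and i0 J where Y: "Y i0 = \<phi>"
    and YB: "\<And>k j. dual_apply (Y k) (B j) = (if k = j then 1 else 0)"
    by (rule adapted_basis[OF v0 vec.subspace_single_0]) auto
  define E :: "(('a, 'n) poly_ring, 'n) vec" where "E = (\<chi> j. PVar j)"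
  define \<eta> where "\<eta> k = (if k = i0 then E else tensor_one (B k))" for k
  have E: "tensor_act (*v) g E = E" if g: "g \<in> K" for g
  proof (subst vec_eq_iff, rule allI)
    fix j
    have "tensor_act (*v) g E $ j = lin_form (dual_act g (\<Sum>i\<in>UNIV. g $ j $ i *s axis i 1))"
      unfolding vec_act.act_nth dual_act_sum lin_form_sum dual_act_scale lin_form_scale
      by (simp add: E_def poly_act_PVar mult.commute)
    also have "(\<Sum>i\<in>UNIV. g $ j $ i *s axis i 1) = g $ j"
      by (rule basis_expansion)
    also have "dual_act g (g $ j) $ k = axis j 1 $ k" for k
      using arg_cong[OF matrix_inv(1)[OF K_invertible[OF g]], of "\<lambda>A. A $ j $ k"]
      by (simp add: dual_act_def vector_matrix_mult_def matrix_matrix_mult_def mat_def axis_def mult.commute)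
    then have "dual_act g (g $ j) = axis j 1"
      by (simp add: vec_eq_iff)
    finally show "tensor_act (*v) g E $ j = E $ j"
      by (simp add: lin_form_axis E_def)
  qed
  have "tensor_act (*v) g (\<eta> k) = \<eta> k" if g: "g \<in> K" for g k
  proof (cases "k = i0")
    case False
    then have "B k \<in> H"
      using YB[of i0 k] Y by (simp add: H_def)
    then show ?thesis
      using g False by (simp add: \<eta>_def vec_act.act_tensor_one K_def)
  qed (simp add: \<eta>_def E g)
  moreover have "\<exists>c. c \<noteq> 0 \<and> det (\<chi> i. \<eta> i) = PConst c * lin_form \<phi>"
  proof -
    have pE: "pair E \<psi> = lin_form \<psi>" for \<psi>
      by (simp add: pair_def E_def lin_form_def mult.commute)
    let ?A = "\<chi> i k. pair (\<eta> i) (Y k)"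
    have entry: "?A $ k $ j = (if k = i0 then lin_form (Y j) else if k = j then 1 else 0)" for k j
      using YB[of j k] by (simp add: \<eta>_def pE dual_apply_commute[of "B k"])
    \<comment> \<open>The Euler derivation makes row i0 the only one with off-diagonal entries;
      transposing turns it into a column.\<close>
    have "det ?A = det (transpose ?A)"
      by (simp only: det_transpose)
    also have "\<dots> = (\<Prod>k\<in>UNIV. transpose ?A $ k $ k)"
      by (rule det_arrow_column[of i0]) (simp add: transpose_def entry del: vec_lambda_beta, simp add: transpose_def entry[simplified])
    also have "\<dots> = (\<Prod>k\<in>UNIV. if k = i0 then lin_form \<phi> else 1)"
      by (rule prod.cong) (simp_all add: transpose_def entry[simplified] Y)
    finally have eq: "det (\<chi> i. \<eta> i) * PConst (det (\<chi> k. Y k)) = lin_form \<phi>"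
      by (simp add: det_pair)
    have nz: "det (\<chi> k. Y k) \<noteq> 0"
      using dual_bases_det[OF YB] by auto
    have "PConst (1 / det (\<chi> k. Y k)) * lin_form \<phi> =
        (PConst (1 / det (\<chi> k. Y k)) * PConst (det (\<chi> k. Y k))) * det (\<chi> i. \<eta> i)"
      unfolding eq[symmetric] by (simp only: mult_ac)
    then have "det (\<chi> i. \<eta> i) = PConst (1 / det (\<chi> k. Y k)) * lin_form \<phi>"
      by (simp only: PConst_inverse[OF nz] mult_1_left)
    then show ?thesis
      using nz by (intro exI[of _ "1 / det (\<chi> k. Y k)"]) simp
  qed
  ultimately show ?thesis
    by blast
qed

section \<open>Contractions of invariant forms\<close>

lemma pair_form_act:
  fixes \<omega> :: "(('a::field, 'n::{finite,linorder}) poly_ring, 'n) vec"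
  shows "pair (tensor_act dual_act g \<omega>) v = poly_act g (pair \<omega> (matrix_inv g *v v))"
proof -
  have "pair (tensor_act dual_act g \<omega>) v =
      (\<Sum>j\<in>UNIV. \<Sum>i\<in>UNIV. poly_act g (\<omega> $ i) * PConst (matrix_inv g $ i $ j * v $ j))"
    by (simp add: pair_def form_act.act_nth transpose_def sum_distrib_right mult.assoc
        ring_homo.mult[OF ring_homo_PConst])
  also have "\<dots> = (\<Sum>i\<in>UNIV. \<Sum>j\<in>UNIV. poly_act g (\<omega> $ i) * PConst (matrix_inv g $ i $ j * v $ j))"
    by (rule sum.swap)
  also have "\<dots> = poly_act g (pair \<omega> (matrix_inv g *v v))"
    by (simp add: pair_def matrix_vector_mult_def ring_homo.hsum[OF ring_homo_poly_act]
        ring_homo.mult[OF ring_homo_poly_act] ring_homo.hsum[OF ring_homo_PConst] sum_distrib_left)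
  finally show ?thesis .
qed

lemma power_dvd_exact:
  fixes q :: "'r::comm_semiring_1"
  shows "\<not> q ^ n dvd f \<Longrightarrow> \<exists>k<n. q ^ k dvd f \<and> \<not> q ^ Suc k dvd f"
proof (induction n)
  case (Suc n)
  then show ?case
    by (cases "q ^ n dvd f") (auto intro: less_SucI)
qed simp

text \<open>
  If \<open>s f = \<mu> f\<close> and \<open>f\<close> is divisible exactly by \<open>\<phi>\<^sup>k\<close>, comparing the cofactors modulo \<open>\<phi>\<close> gives
  \<open>\<kappa>\<^sup>k \<mu> = 1\<close>, as \<open>s \<phi> = \<kappa>\<^sup>-\<^sup>1 \<phi>\<close>.
\<close>

lemma exact_power_semi_invariant:
  fixes \<phi> :: "('a::field, 'n::{finite,linorder}) vec"
  assumes \<phi>: "\<phi> \<noteq> 0" and w: "root_vector \<phi> (matrix_inv s) w"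
    and \<kappa>: "\<kappa> * (1 + dual_apply \<phi> w) = 1"
    and f: "poly_act s f = PConst \<mu> * f" "lin_form \<phi> ^ k dvd f" "\<not> lin_form \<phi> ^ Suc k dvd f"
  shows "\<kappa> ^ k * \<mu> = 1"
proof -
  let ?c = "1 + dual_apply \<phi> w"
  obtain u where u: "f = lin_form \<phi> ^ k * u"
    using f(2) ..
  have nd: "\<not> lin_form \<phi> dvd u"
    using f(3) unfolding u by (metis dvd_refl mult_dvd_mono power_Suc2)
  have "dual_act s \<phi> = ?c *s \<phi>"
    by (simp add: dual_act_root_vector[OF w] vector_sadd_rdistrib)
  then have "poly_act s f = lin_form \<phi> ^ k * (PConst (?c ^ k) * poly_act s u)"
    by (simp add: u ring_homo.mult[OF ring_homo_poly_act] ring_homo.power[OF ring_homo_poly_act]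
        poly_act_lin_form lin_form_scale power_mult_distrib ring_homo.power[OF ring_homo_PConst] mult_ac)
  moreover have "PConst \<mu> * f = lin_form \<phi> ^ k * (PConst \<mu> * u)"
    by (simp add: u mult_ac)
  ultimately have "PConst (?c ^ k) * poly_act s u = PConst \<mu> * u"
    using f(1) \<phi> by simp
  moreover have "lin_form \<phi> dvd PConst (?c ^ k) * (u - poly_act s u)"
    using lin_form_dvd_poly_act_diff[OF w] by (rule dvd_mult)
  ultimately have "lin_form \<phi> dvd PConst (?c ^ k - \<mu>) * u"
    by (simp add: right_diff_distrib left_diff_distrib ring_homo.diff[OF ring_homo_PConst])
  then have "?c ^ k - \<mu> = 0"
    using nd dvd_PConst_mult by blast
  then have "\<mu> = ?c ^ k"
    by simp
  then show ?thesis
    using \<kappa> by (metis power_mult_distrib power_one)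
qed

text \<open>For invariant \<omega> and g in \<open>K\<close>, g maps the contraction with u to the
  contraction with g u. Eigenvectors u of s therefore give semi-invariants, whose order along H is
  restricted modulo e: at least e on each of the b basis vectors of \<open>W\<close>, at least e - 1
  on v0.\<close>

lemma form_lower:
  fixes \<phi> :: "('a::field, 'n::{finite,linorder}) vec"
  assumes "hyperplane_stabilizer G \<phi>"
    and inv: "\<And>g i. g \<in> G \<Longrightarrow> tensor_act dual_act g (\<omega> i) = \<omega> i"
  defines "e \<equiv> e_num G (hyperplane_stabilizer.H \<phi>)" and "b \<equiv> b_num G (hyperplane_stabilizer.H \<phi>) \<phi>"
  shows "lin_form \<phi> ^ (e * b + (e - 1)) dvd det (\<chi> i. \<omega> i)"
proof -
  interpret hyperplane_stabilizer G \<phi> by fact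
  let ?l = "lin_form \<phi>"
  obtain s v0 \<kappa> where s: "s \<in> K" "dual_apply \<phi> v0 = 1" "s *v v0 = \<kappa> *s v0" "\<kappa> \<noteq> 0"
    and e: "\<And>k. \<kappa> ^ k = 1 \<Longrightarrow> e dvd k" "e > 0"
    unfolding e_def using e_num_eigenvector by metis
  have W_sub: "vec.subspace W"
    by (simp add: W_def vec.subspace_span)
  obtain B Y :: "'n \<Rightarrow> ('a, 'n) vec" and i0 J where YB: "\<And>k j. dual_apply (Y k) (B j) = (if k = j then 1 else 0)"
    and B: "B i0 = v0" "i0 \<notin> J" "card J = vec.dim W" "\<And>j. j \<in> J \<Longrightarrow> B j \<in> W"
    by (rule adapted_basis[OF s(2) W_sub W_kernel]) auto
  obtain w where w: "root_vector \<phi> (matrix_inv s) w"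
    using K_root_vector[OF K_inv[OF s(1)]] .
  have \<kappa>w: "\<kappa> * (1 + dual_apply \<phi> w) = 1"
  proof -
    have "scales s \<kappa>"
    proof -
      obtain c where c: "scales s c"
        using K_scales[OF s(1)] .
      then have "c = \<kappa>"
        unfolding scales_def using s(2,3) by (metis dual_apply_scale mult.right_neutral)
      then show ?thesis
        using c by simp
    qed
    then have "scales (s ** matrix_inv s) (\<kappa> * (1 + dual_apply \<phi> w))"
      using scales_root_vector[OF w] scales_mult by blast
    then show ?thesis
      unfolding matrix_inv(1)[OF K_invertible[OF s(1)]] using scales_1 scales_unique by blast
  qed
  have act: "poly_act g (pair (\<omega> i) u) = pair (\<omega> i) (g *v u)" if "g \<in> K" for g i u
    using pair_form_act[of g "\<omega> i" "g *v u"] inv[OF K_G[OF that]]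
    by (simp add: matrix_vector_mul_assoc matrix_inv(2)[OF K_invertible[OF that]])
  have v0_dvd: "?l ^ (e - 1) dvd pair (\<omega> i) v0" for i
  proof (rule ccontr)
    assume "\<not> ?thesis"
    then obtain k where k: "k < e - 1" "?l ^ k dvd pair (\<omega> i) v0" "\<not> ?l ^ Suc k dvd pair (\<omega> i) v0"
      using power_dvd_exact by blast
    have "poly_act s (pair (\<omega> i) v0) = PConst \<kappa> * pair (\<omega> i) v0"
      using act[OF s(1)] s(3) by simp
    \<comment> \<open>Here \<mu> = \<kappa>, so an exact order k makes e divide k + 1, impossible
      for k < e - 1.\<close>
    from exact_power_semi_invariant[OF \<phi> w \<kappa>w this k(2,3)] have "\<kappa> ^ Suc k = 1"
      by (simp add: mult.commute)
    then have "e dvd Suc k"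
      by (rule e(1))
    then show False
      using k(1) by (auto dest: dvd_imp_le)
  qed
  have W_dvd: "?l dvd pair (\<omega> i) u" if "u \<in> W" for i u
  proof -
    have "vec.subspace {u. ?l dvd pair (\<omega> i) u}"
      by (rule vec.subspaceI) auto
    moreover have "{w. \<exists>t\<in>G. transvection_about H t \<and> root_vector \<phi> t w} \<subseteq> {u. ?l dvd pair (\<omega> i) u}"
    proof safe
      fix x t
      assume t: "t \<in> G" "transvection_about H t" "root_vector \<phi> t x"
      then have tK: "t \<in> K"
        using transvection_K by blast
      obtain x' where x': "root_vector \<phi> (matrix_inv t) x'"
        using K_root_vector[OF K_inv[OF tK]] .
      \<comment> \<open>The contraction with x is therefore t f - f for the contraction f with v0,
        which \<phi> divides.\<close>
      have "t *v v0 = v0 + x"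
        using t(3) s(2) by (simp add: root_vector_def)
      then have "poly_act t (pair (\<omega> i) v0) = pair (\<omega> i) v0 + pair (\<omega> i) x"
        using act[OF tK] by simp
      then show "?l dvd pair (\<omega> i) x"
        using lin_form_dvd_poly_act_diff[OF x', of "pair (\<omega> i) v0"] by simp
    qed
    ultimately have "W \<subseteq> {u. ?l dvd pair (\<omega> i) u}"
      unfolding W_def by (intro vec.span_minimal)
    then show ?thesis
      using that by blast
  qed
  have W_power_dvd: "?l ^ e dvd pair (\<omega> i) u" if u: "u \<in> W" for i u
  proof (rule ccontr)
    assume "\<not> ?thesis"
    then obtain k where k: "k < e" "?l ^ k dvd pair (\<omega> i) u" "\<not> ?l ^ Suc k dvd pair (\<omega> i) u"
      using power_dvd_exact by blast
    have "s *v u = u"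
      using s(1) W_kernel[OF u] by (simp add: K_def H_def)
    then have "poly_act s (pair (\<omega> i) u) = PConst 1 * pair (\<omega> i) u"
      using act[OF s(1)] by simp
    \<comment> \<open>Here \<mu> = 1, so e divides the exact order k; as k < e, only k = 0 remains,
      and \<open>W_dvd\<close> excludes it.\<close>
    from exact_power_semi_invariant[OF \<phi> w \<kappa>w this k(2,3)] have "e dvd k"
      using e(1) by simp
    then have "k = 0"
      using k(1) by (auto dest: dvd_imp_le)
    then show False
      using k(3) W_dvd[OF u] by simp
  qed
  let ?n = "\<lambda>k. if k \<in> J then e else if k = i0 then e - 1 else 0"
  have "?l ^ ?n k dvd pair (\<omega> i) (B k)" for i k
    using W_power_dvd[OF B(4)] v0_dvd B(1) by simp
  moreover have "det (\<chi> k. B k) \<noteq> 0"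
    using dual_bases_det[OF YB] by auto
  ultimately have "?l ^ (\<Sum>k\<in>UNIV. ?n k) dvd det (\<chi> i. \<omega> i)"
    by (intro power_dvd_det_pair)
  also have "(\<Sum>k\<in>UNIV. ?n k) = e * b + (e - 1)"
  proof -
    have "(\<Sum>k\<in>UNIV. ?n k) = (\<Sum>k\<in>UNIV. (if k \<in> J then e else 0) + (if k = i0 then e - 1 else 0))"
      using B(2) by (intro sum.cong) auto
    also have "\<dots> = e * b + (e - 1)"
      using B(3) dim_W by (simp add: sum.distrib sum.If_cases b_def)
    finally show ?thesis .
  qed
  finally show ?thesis .
qed

text \<open>
  For a linear form \<open>y\<close> the form \<open>\<phi> \<otimes> y - y \<otimes> \<phi>\<close> is multiplied by \<open>\<chi>(g)\<close> under \<open>g \<in> K\<close> with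
  \<open>g \<phi> = \<chi>(g) \<phi>\<close>, because \<open>g y - y\<close> is a multiple of \<open>\<phi>\<close>; since \<open>\<chi>(g)\<^sup>e = 1\<close>, the factor
  \<open>\<phi>\<^bsup>e - 1\<^esup>\<close> makes it invariant.
\<close>

lemma form_upper:
  fixes \<phi> :: "('a::field, 'n::{finite,linorder}) vec"
  assumes "hyperplane_stabilizer G \<phi>"
  defines "e \<equiv> e_num G (hyperplane_stabilizer.H \<phi>)" and "b \<equiv> b_num G (hyperplane_stabilizer.H \<phi>) \<phi>"
  shows "\<exists>\<eta> c. c \<noteq> 0 \<and> det (\<chi> i. \<eta> i) = PConst c * lin_form \<phi> ^ (e * b + (e - 1)) \<and>
    (\<forall>g\<in>hyperplane_stabilizer.K G \<phi>. \<forall>i. tensor_act dual_act g (\<eta> i) = \<eta> i)"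
proof -
  interpret hyperplane_stabilizer G \<phi> by fact
  let ?l = "lin_form \<phi>"
  obtain s v0 \<kappa> where s: "s \<in> K" "dual_apply \<phi> v0 = 1" "s *v v0 = \<kappa> *s v0"
    "diag_refls G H \<noteq> {} \<Longrightarrow> \<kappa> \<noteq> 1"
    and e: "\<And>g c. g \<in> K \<Longrightarrow> scales g c \<Longrightarrow> c ^ e = 1" "e > 0"
    unfolding e_def using e_num_eigenvector by metis
  have W_sub: "vec.subspace W"
    by (simp add: W_def vec.subspace_span)
  obtain B Y :: "'n \<Rightarrow> ('a, 'n) vec" and i0 J where YB: "\<And>k j. dual_apply (Y k) (B j) = (if k = j then 1 else 0)"
    and B: "B i0 = v0" "Y i0 = \<phi>" "i0 \<notin> J" "card J = vec.dim W"
    "\<And>k w. k \<notin> J \<Longrightarrow> w \<in> W \<Longrightarrow> dual_apply (Y k) w = 0"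
    by (rule adapted_basis[OF s(2) W_sub W_kernel]) auto
  \<comment> \<open>The indices in \<open>J\<close> carry order e each and i0 carries e - 1; the
    remaining dual vectors stay constant and contribute nothing.\<close>
  define \<eta> where "\<eta> k =
    (if k \<in> J then ?l ^ (e - 1) *s (?l *s tensor_one (Y k) - lin_form (Y k) *s tensor_one \<phi>)
     else if k = i0 then ?l ^ (e - 1) *s tensor_one \<phi> else tensor_one (Y k))" for k
  have "tensor_act dual_act g (\<eta> k) = \<eta> k" if g: "g \<in> K" for g k
  proof -
    obtain w where w: "root_vector \<phi> (matrix_inv g) w"
      using K_root_vector[OF K_inv[OF g]] .
    let ?c = "1 + dual_apply \<phi> w"
    have "?c ^ e = 1"
      using e(1)[OF K_inv[OF g] scales_root_vector[OF w]] .
    then have "?c ^ (e - 1) * ?c = 1"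
      using e(2) by (metis Suc_diff_1 power_Suc2)
    then have ce: "PConst ?c ^ (e - 1) * PConst ?c = (1 :: ('a, 'n) poly_ring)"
      unfolding ring_homo.power[OF ring_homo_PConst, symmetric] ring_homo.mult[OF ring_homo_PConst, symmetric]
      by simp
    have \<phi>_act: "dual_act g \<phi> = ?c *s \<phi>"
      by (simp add: dual_act_root_vector[OF w] vector_sadd_rdistrib)
    have l_act: "poly_act g (?l ^ (e - 1)) = PConst ?c ^ (e - 1) * ?l ^ (e - 1)"
      by (simp add: ring_homo.power[OF ring_homo_poly_act] poly_act_lin_form \<phi>_act lin_form_scale
          power_mult_distrib)
    have t_add: "tensor_one (u + v) = tensor_one u + tensor_one v" for u v :: "('a, 'n) vec"
      by (simp add: tensor_one_def vec_eq_iff ring_homo.add[OF ring_homo_PConst])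
    have t_scale: "tensor_one (c *s v) = PConst c *s tensor_one v" for c and v :: "('a, 'n) vec"
      by (simp add: tensor_one_def vec_eq_iff ring_homo.mult[OF ring_homo_PConst])
    have act_diff: "tensor_act dual_act g (\<xi> - \<zeta>) = tensor_act dual_act g \<xi> - tensor_act dual_act g \<zeta>"
      for \<xi> \<zeta> :: "(('a, 'n) poly_ring, 'n) vec"
      using form_act.act_add[of g "\<xi> - \<zeta>" \<zeta>] by (simp add: eq_diff_eq)
    consider "k \<in> J" | "k \<notin> J" "k = i0" | "k \<notin> J" "k \<noteq> i0"
      by blast
    then show ?thesis
    proof cases
      case 1
      let ?a = "dual_apply (Y k) w"
      have "tensor_act dual_act g (?l *s tensor_one (Y k) - lin_form (Y k) *s tensor_one \<phi>) =
          PConst ?c *s (?l *s tensor_one (Y k) - lin_form (Y k) *s tensor_one \<phi>)"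
        unfolding act_diff form_act.act_scale form_act.act_tensor_one poly_act_lin_form \<phi>_act
          dual_act_root_vector[OF w, of "Y k"] t_add t_scale lin_form_add lin_form_scale
        by (simp add: vec_eq_iff algebra_simps)
      then have "tensor_act dual_act g (\<eta> k) = (PConst ?c ^ (e - 1) * PConst ?c) *s \<eta> k"
        using 1 by (simp only: \<eta>_def if_True form_act.act_scale l_act) (simp add: vec_eq_iff mult_ac)
      then show ?thesis
        by (simp only: ce vector_smult_lid)
    next
      case 2
      then have "\<eta> k = ?l ^ (e - 1) *s tensor_one \<phi>"
        by (simp add: \<eta>_def)
      then have "tensor_act dual_act g (\<eta> k) = (PConst ?c ^ (e - 1) * PConst ?c) *s \<eta> k"
        by (simp only: form_act.act_scale form_act.act_tensor_one l_act \<phi>_act t_scale)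
          (simp add: vec_eq_iff mult_ac)
      then show ?thesis
        by (simp only: ce vector_smult_lid)
    next
      case 3
      \<comment> \<open>Outside \<open>J\<close> and i0 the form Y k kills both \<open>W\<close> and
        v0, hence every root vector of \<open>K\<close>, so it is fixed by \<open>K\<close>.\<close>
      have "w - dual_apply \<phi> w *s v0 \<in> W"
        by (rule root_vector_mod_W[OF s K_inv[OF g] w])
      then have "dual_apply (Y k) (w - dual_apply \<phi> w *s v0) = 0"
        using B(5) 3 by blast
      then have "dual_apply (Y k) w = 0"
        using YB[of k i0] 3 by (simp add: B(1))
      then show ?thesis
        using 3 by (simp add: \<eta>_def form_act.act_tensor_one dual_act_root_vector[OF w])
    qed
  qed
  moreover have "\<exists>c. c \<noteq> 0 \<and> det (\<chi> i. \<eta> i) = PConst c * ?l ^ (e * b + (e - 1))"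
  proof -
    let ?A = "\<chi> i k. pair (\<eta> i) (B k)"
    let ?d = "\<lambda>k. ?l ^ (if k \<in> J then e else if k = i0 then e - 1 else 0)"
    have le: "?l ^ (e - Suc 0) * ?l = ?l ^ e"
      using e(2) by (simp flip: power_Suc2)
    have \<phi>B: "dual_apply \<phi> (B j) = (if i0 = j then 1 else 0)" for j
      using YB[of i0 j] B(2) by simp
    \<comment> \<open>Off the diagonal only column i0 can be nonzero: the correction term contains
      \<phi>, which vanishes on every B j other than v0.\<close>
    have entry: "pair (\<eta> k) (B j) = (if k = j then ?d k else if j = i0 then pair (\<eta> k) (B j) else 0)" for k j
      using B(3) by (auto simp: \<eta>_def YB \<phi>B le)
    have "det ?A = (\<Prod>k\<in>UNIV. ?A $ k $ k)"
    proof (rule det_arrow_column)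
      show "?A $ k $ j = 0" if "k \<noteq> j" "j \<noteq> i0" for k j
        using entry[of k j] that by simp
    qed
    also have "\<dots> = (\<Prod>k\<in>UNIV. ?d k)"
    proof (rule prod.cong)
      show "?A $ k $ k = ?d k" for k
        using entry[of k k] by (simp only: vec_lambda_beta simp_thms if_True)
    qed simp
    also have "\<dots> = ?l ^ (\<Sum>k\<in>UNIV. if k \<in> J then e else if k = i0 then e - 1 else 0)"
      by (simp only: power_sum)
    also have "(\<Sum>k\<in>UNIV. if k \<in> J then e else if k = i0 then e - 1 else 0) =
        (\<Sum>k\<in>UNIV. (if k \<in> J then e else 0) + (if k = i0 then e - 1 else 0))"
      using B(3) by (intro sum.cong) auto
    also have "\<dots> = e * b + (e - 1)"
      using B(4) dim_W by (simp add: sum.distrib sum.If_cases b_def)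
    finally have eq: "det (\<chi> i. \<eta> i) * PConst (det (\<chi> k. B k)) = ?l ^ (e * b + (e - 1))"
      by (simp only: det_pair)
    have nz: "det (\<chi> k. B k) \<noteq> 0"
      using dual_bases_det[OF YB] by auto
    have "PConst (1 / det (\<chi> k. B k)) * ?l ^ (e * b + (e - 1)) =
        (PConst (1 / det (\<chi> k. B k)) * PConst (det (\<chi> k. B k))) * det (\<chi> i. \<eta> i)"
      unfolding eq[symmetric] by (simp only: mult_ac)
    then have "det (\<chi> i. \<eta> i) = PConst (1 / det (\<chi> k. B k)) * ?l ^ (e * b + (e - 1))"
      by (simp only: PConst_inverse[OF nz] mult_1_left)
    then show ?thesis
      using nz by (intro exI[of _ "1 / det (\<chi> k. B k)"]) simp
  qed
  ultimately show ?thesis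
    by blast
qed


section \<open>Saito's criterion for \<open>S \<otimes> V\<close> and \<open>S \<otimes> V\<^sup>*\<close>\<close>

lemma wedge_family_doteq_iff:
  fixes \<theta> :: "'n::{finite,linorder} \<Rightarrow> (('a::field, 'n) poly_ring, 'n) vec"
  shows "wedge_family \<theta> \<doteq> q *s vol \<longleftrightarrow> (\<exists>a. a \<noteq> 0 \<and> det (\<chi> i. \<theta> i) = PConst a * q)"
proof -
  let ?vol = "vol :: (('a, 'n) poly_ring, 'n) exterior"
  have "p *s ?vol = p' *s ?vol \<longleftrightarrow> p = p'" for p p'
  proof
    assume "p *s ?vol = p' *s ?vol"
    then have "(p *s ?vol) $ UNIV = (p' *s ?vol) $ UNIV"
      by (rule arg_cong)
    then show "p = p'"
      by (simp add: vol_eq_axis)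
  qed simp
  then show ?thesis
    by (simp add: eq_up_to_scalar_def wedge_family_eq_det vector_smult_assoc)
qed

lemma
  fixes G :: "('a::field ^ 'n ^ 'n) set"
  assumes G: "subgroup G GL" "finite G" "defines_hyperplanes G l" and H: "H \<in> refl_hyperplanes G"
  shows refl_hyperplane_stabilizer: "hyperplane_stabilizer G (l H)"
    and refl_hyperplane_H: "hyperplane_stabilizer.H (l H) = H"
    and refl_hyperplane_K: "hyperplane_stabilizer.K G (l H) = {g\<in>G. \<forall>v\<in>H. g *v v = v}"
proof -
  have ker: "{v. dual_apply (l H) v = 0} = H"
    using G(3) H by (simp add: defines_hyperplanes_def)
  show *: "hyperplane_stabilizer G (l H)"
    using G H reflection_about_form_neq_0[OF _ ker]
    by (auto simp: hyperplane_stabilizer_def refl_hyperplanes_def)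
  show H': "hyperplane_stabilizer.H (l H) = H"
    by (simp add: hyperplane_stabilizer.H_def[OF *] ker)
  show "hyperplane_stabilizer.K G (l H) = {g\<in>G. \<forall>v\<in>H. g *v v = v}"
    by (simp add: hyperplane_stabilizer.K_def[OF *] H')
qed

theorem theorem3p2:
  fixes G :: "(('a::field, 'n::{finite,linorder}) vec, 'n) vec set"
    and \<l> :: "('a, 'n) vec set \<Rightarrow> ('a, 'n) vec"
  assumes "subgroup G GL" and "finite G" and "defines_hyperplanes G \<l>"
  shows
    "(\<forall>(\<theta> :: 'n \<Rightarrow> (('a, 'n) poly_ring, 'n) vec) d.
        (\<forall>i. \<theta> i \<in> vec_invariants G \<and> homogeneous (d i) (\<theta> i)) \<longrightarrow>
        (free_basis (poly_invariants G) (vec_invariants G) \<theta> \<longleftrightarrow>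
           wedge_family \<theta> \<doteq> Q_poly G \<l> *s vol) \<and>
        (wedge_family \<theta> \<doteq> Q_poly G \<l> *s vol \<longleftrightarrow>
           fract_independent \<theta> \<and>
           (\<Sum>i\<in>UNIV. d i) = poly_deg (Q_poly G \<l>) \<and>
           poly_deg (Q_poly G \<l>) = card (refl_hyperplanes G))) \<and>
     (\<forall>(\<omega> :: 'n \<Rightarrow> (('a, 'n) poly_ring, 'n) vec) d.
        (\<forall>i. \<omega> i \<in> form_invariants G \<and> homogeneous (d i) (\<omega> i)) \<longrightarrow>
        (free_basis (poly_invariants G) (form_invariants G) \<omega> \<longleftrightarrow>
           wedge_family \<omega> \<doteq> (Q_tilde G \<l> * Q_det G \<l>) *s vol) \<and>
        (wedge_family \<omega> \<doteq> (Q_tilde G \<l> * Q_det G \<l>) *s vol \<longleftrightarrow>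
           fract_independent \<omega> \<and>
           (\<Sum>i\<in>UNIV. d i) =
             (\<Sum>H\<in>refl_hyperplanes G. e_num G H * b_num G H (\<l> H) + e_num G H - 1)))"
proof (intro conjI allI impI)
  note stab = refl_hyperplane_stabilizer[OF assms] and stab_H = refl_hyperplane_H[OF assms]
    and stab_K = refl_hyperplane_K[OF assms]
  interpret V: saito_data "\<lambda>g. g" "(*v)" G \<l> "\<lambda>_. 1"
  proof (intro saito_data.intro saito_data_axioms.intro vec_act.covariant_action_axioms assms)
    fix H and \<eta> :: "'n \<Rightarrow> (('a, 'n) poly_ring, 'n) vec"
    assume H: "H \<in> refl_hyperplanes G" and \<eta>: "\<And>i g. g \<in> G \<Longrightarrow> tensor_act (*v) g (\<eta> i) = \<eta> i"
    interpret hyperplane_stabilizer G "\<l> H"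
      by (rule stab[OF H])
    obtain s where s: "s \<in> G" "reflection_about H s"
      using H by (auto simp: refl_hyperplanes_def)
    then have sK: "s \<in> K" "s \<noteq> mat 1"
      by (auto simp: stab_K[OF H] reflection_about_def)
    obtain v0 where v0: "dual_apply (\<l> H) v0 = 1"
      using dual_apply_eq_1[OF \<phi>] .
    obtain B Y :: "'n \<Rightarrow> ('a, 'n) vec" and i0 J where Y: "Y i0 = \<l> H"
      and YB: "\<And>k j. dual_apply (Y k) (B j) = (if k = j then 1 else 0)"
      by (rule adapted_basis[OF v0 vec.subspace_single_0]) auto
    \<comment> \<open>Only the contraction with Y i0, the form of H itself, is claimed to be
      divisible, so the exponents add up to 1.\<close>
    have "lin_form (\<l> H) ^ (\<Sum>k\<in>UNIV. if k = i0 then 1 else 0) dvd det (\<chi> i. \<eta> i)"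
    proof (rule power_dvd_det_pair)
      show "det (\<chi> k. Y k) \<noteq> 0"
        using dual_bases_det[OF YB] by auto
      show "lin_form (\<l> H) ^ (if k = i0 then 1 else 0) dvd pair (\<eta> i) (Y k)" for i k
        using vec_lower[OF stab[OF H] sK \<eta>[OF s(1)]] Y by simp
    qed
    then show "lin_form (\<l> H) ^ 1 dvd det (\<chi> i. \<eta> i)"
      by simp
  next
    fix H
    assume H: "H \<in> refl_hyperplanes G"
    show "\<exists>\<eta> c. c \<noteq> 0 \<and> det (\<chi> i. \<eta> i) = PConst c * lin_form (\<l> H) ^ 1 \<and>
        (\<forall>g\<in>G. (\<forall>v\<in>H. g *v v = v) \<longrightarrow> (\<forall>i. tensor_act (*v) g (\<eta> i) = \<eta> i))"
      using vec_upper[OF stab[OF H]] unfolding stab_K[OF H] by (simp add: Ball_def imp_conjL)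
  qed
  interpret F: saito_data "\<lambda>g. transpose (matrix_inv g)" dual_act G \<l>
    "\<lambda>H. e_num G H * b_num G H (\<l> H) + (e_num G H - 1)"
  proof (intro saito_data.intro saito_data_axioms.intro form_act.covariant_action_axioms assms)
    fix H and \<eta> :: "'n \<Rightarrow> (('a, 'n) poly_ring, 'n) vec"
    assume H: "H \<in> refl_hyperplanes G" and \<eta>: "\<And>i g. g \<in> G \<Longrightarrow> tensor_act dual_act g (\<eta> i) = \<eta> i"
    show "lin_form (\<l> H) ^ (e_num G H * b_num G H (\<l> H) + (e_num G H - 1)) dvd det (\<chi> i. \<eta> i)"
      using form_lower[OF stab[OF H], of \<eta>] \<eta> unfolding stab_H[OF H] by blast
  next
    fix H
    assume H: "H \<in> refl_hyperplanes G"
    show "\<exists>\<eta> c. c \<noteq> 0 \<and>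
        det (\<chi> i. \<eta> i) = PConst c * lin_form (\<l> H) ^ (e_num G H * b_num G H (\<l> H) + (e_num G H - 1)) \<and>
        (\<forall>g\<in>G. (\<forall>v\<in>H. g *v v = v) \<longrightarrow> (\<forall>i. tensor_act dual_act g (\<eta> i) = \<eta> i))"
      using form_upper[OF stab[OF H]] unfolding stab_K[OF H] stab_H[OF H] by (simp add: Ball_def imp_conjL)
  qed
  have V: "V.Inv = vec_invariants G" "V.Q = Q_poly G \<l>"
    unfolding V.Inv_def vec_invariants_def V.Q_def Q_poly_def by simp_all
  have F: "F.Inv = form_invariants G" "F.Q = Q_tilde G \<l> * Q_det G \<l>"
    unfolding F.Inv_def form_invariants_def F.Q_def Q_tilde_def Q_det_def
    by (simp_all add: power_add prod.distrib)
  have deg: "poly_deg (Q_poly G \<l>) = card (refl_hyperplanes G)"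
    using poly_deg_homogeneous[OF V.Q_homogeneous V.Q_neq_0] unfolding V by simp
  {
    fix \<theta> :: "'n \<Rightarrow> (('a, 'n) poly_ring, 'n) vec" and d
    assume \<theta>: "\<forall>i. \<theta> i \<in> vec_invariants G \<and> homogeneous (d i) (\<theta> i)"
    then have inv: "\<And>i. \<theta> i \<in> V.Inv" and hom: "\<And>i. homogeneous (d i) (\<theta> i)"
      by (simp_all add: V)
    show "free_basis (poly_invariants G) (vec_invariants G) \<theta> \<longleftrightarrow>
        wedge_family \<theta> \<doteq> Q_poly G \<l> *s vol"
      unfolding wedge_family_doteq_iff
    proof
      assume "free_basis (poly_invariants G) (vec_invariants G) \<theta>"
      from V.det_if_free_basis[OF inv hom, unfolded V, OF this]
      show "\<exists>a. a \<noteq> 0 \<and> det (\<chi> i. \<theta> i) = PConst a * (Q_poly G \<l>)" .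
    next
      assume "\<exists>a. a \<noteq> 0 \<and> det (\<chi> i. \<theta> i) = PConst a * (Q_poly G \<l>)"
      then obtain a where a: "a \<noteq> 0" "det (\<chi> i. \<theta> i) = PConst a * (Q_poly G \<l>)"
        by blast
      from V.free_basis_if_det[OF inv, unfolded V, OF a(2,1)]
      show "free_basis (poly_invariants G) (vec_invariants G) \<theta>" .
    qed
    show "wedge_family \<theta> \<doteq> Q_poly G \<l> *s vol \<longleftrightarrow> fract_independent \<theta> \<and>
        (\<Sum>i\<in>UNIV. d i) = poly_deg (Q_poly G \<l>) \<and> poly_deg (Q_poly G \<l>) = card (refl_hyperplanes G)"
      using V.det_iff_degree[OF inv hom] unfolding wedge_family_doteq_iff V deg by simp
  next
    fix \<omega> :: "'n \<Rightarrow> (('a, 'n) poly_ring, 'n) vec" and d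
    assume \<omega>: "\<forall>i. \<omega> i \<in> form_invariants G \<and> homogeneous (d i) (\<omega> i)"
    then have inv: "\<And>i. \<omega> i \<in> F.Inv" and hom: "\<And>i. homogeneous (d i) (\<omega> i)"
      by (simp_all add: F)
    show "free_basis (poly_invariants G) (form_invariants G) \<omega> \<longleftrightarrow>
        wedge_family \<omega> \<doteq> (Q_tilde G \<l> * Q_det G \<l>) *s vol"
      unfolding wedge_family_doteq_iff
    proof
      assume "free_basis (poly_invariants G) (form_invariants G) \<omega>"
      from F.det_if_free_basis[OF inv hom, unfolded F, OF this]
      show "\<exists>a. a \<noteq> 0 \<and> det (\<chi> i. \<omega> i) = PConst a * (Q_tilde G \<l> * Q_det G \<l>)" .
    next
      assume "\<exists>a. a \<noteq> 0 \<and> det (\<chi> i. \<omega> i) = PConst a * (Q_tilde G \<l> * Q_det G \<l>)"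
      then obtain a where a: "a \<noteq> 0" "det (\<chi> i. \<omega> i) = PConst a * (Q_tilde G \<l> * Q_det G \<l>)"
        by blast
      from F.free_basis_if_det[OF inv, unfolded F, OF a(2,1)]
      show "free_basis (poly_invariants G) (form_invariants G) \<omega>" .
    qed
    \<comment> \<open>Subtraction is truncated: e b + e - 1 and e b + (e - 1) agree because e is at
      least 1.\<close>
    have "e_num G H > 0" if "H \<in> refl_hyperplanes G" for H
      using hyperplane_stabilizer.e_num_eigenvector[OF stab[OF that]] unfolding stab_H[OF that] by metis
    then have "(\<Sum>H\<in>refl_hyperplanes G. e_num G H * b_num G H (\<l> H) + e_num G H - 1) =
        (\<Sum>H\<in>refl_hyperplanes G. e_num G H * b_num G H (\<l> H) + (e_num G H - 1))"
      by (intro sum.cong) (auto simp: Suc_le_eq)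
    then show "wedge_family \<omega> \<doteq> (Q_tilde G \<l> * Q_det G \<l>) *s vol \<longleftrightarrow> fract_independent \<omega> \<and>
        (\<Sum>i\<in>UNIV. d i) = (\<Sum>H\<in>refl_hyperplanes G. e_num G H * b_num G H (\<l> H) + e_num G H - 1)"
      using F.det_iff_degree[OF inv hom] by (simp only: wedge_family_doteq_iff F)
  }
qed

end
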